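(* There are constants $0<\lambda_0<\infty$ and $0<\varepsilon_0<1$ such that for $p=\frac1{2n}(1+\varepsilon)=\frac1{2n}(1+\lambda_n n^{-1/3})$ with $\lambda_0\le|\lambda_n|\le\varepsilon_0n^{1/3}$, and all strictly distinct literals $x,y$: (i) if $\varepsilon<0$, \[ \Pr\big(x\underset{F_{n,p}}{\rightsquigarrow}\overline x\big)\Pr\big(y\underset{F_{n,p}}{\rightsquigarrow}\overline y\big)\le\Pr\big(x\underset{F_{n,p}}{\rightsquigarrow}\overline x\text{ and }y\underset{F_{n,p}}{\rightsquigarrow}\overline y\big)=O\Big(\frac{n^{-2/3}}{\lambda_n^4}\Big); \] (ii) if $\varepsilon>0$, \[ 0\le\Pr\big(x\underset{F_{n,p}}{\rightsquigarrow}\overline x\text{ and }y\underset{F_{n,p}}{\rightsquigarrow}\overline y\big)-\Pr\big(x\underset{F_{n,p}}{\rightsquigarrow}\overline x\big)\Pr\big(y\underset{F_{n,p}}{\rightsquigarrow}\overline y\big)=O\Big(\frac{n^{-2/3}}{\lambda_n}\Big). \]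
   Context: Variables $x_1,\dots,x_n$, literals $x_i,\overline x_i$; literals $u,v$ are strictly distinct if $u\ne v$ and $u\ne\overline v$. A 2-clause is $u\vee v$ with $u,v$ strictly distinct, $u\vee v=v\vee u$. $F_{n,p}$ contains each of the $4\binom n2$ clauses independently with probability $p$. The digraph $D_F$ on the literals has an edge $x\to y$ iff $\overline x\vee y$ is a clause of $F$; $x\underset{F}{\rightsquigarrow}y$ means a directed path from $x$ to $y$ in $D_F$. $O(g)$ means bounded by a universal constant times $|g|$. *)

theory Defs
  imports "HOL-Probability.Probability" "HOL-Probability.Product_PMF"
begin

datatype literal = Pos nat | Neg nat

fun neg :: "literal \<Rightarrow> literal" where
  "neg (Pos i) = Neg i"
| "neg (Neg i) = Pos i"

definition literals :: "nat \<Rightarrow> literal set" where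
  "literals n = Pos ` {1..n} \<union> Neg ` {1..n}"

definition strictly_distinct :: "literal \<Rightarrow> literal \<Rightarrow> bool" where
  "strictly_distinct u v \<longleftrightarrow> u \<noteq> v \<and> u \<noteq> neg v"

text \<open>A clause is the unordered pair of its two literals; a formula is a set of clauses.\<close>

definition clauses :: "nat \<Rightarrow> literal set set" where
  "clauses n = {{u, v} | u v. u \<in> literals n \<and> v \<in> literals n \<and> strictly_distinct u v}"

definition random_formula :: "nat \<Rightarrow> real \<Rightarrow> literal set set pmf" where
  "random_formula n p =
     map_pmf (\<lambda>f. {c \<in> clauses n. f c}) (Pi_pmf (clauses n) False (\<lambda>_. bernoulli_pmf p))"

definition implication_digraph :: "literal set set \<Rightarrow> (literal \<times> literal) set" where
  "implication_digraph F = {(x, y). {neg x, y} \<in> F}"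

text \<open>The path of length zero is allowed; this is immaterial for paths from a literal to
  its negation.\<close>

definition leads_to :: "literal set set \<Rightarrow> literal \<Rightarrow> literal \<Rightarrow> bool" where
  "leads_to F x y \<longleftrightarrow> (x, y) \<in> (implication_digraph F)\<^sup>*"

text \<open>The following facts confirm that the product above ranges over a finite set of the expected
  size, so that \<^const>\<open>Pi_pmf\<close> is a genuine product distribution.\<close>

lemma finite_clauses: "finite (clauses n)"
proof (rule finite_subset)
  show "clauses n \<subseteq> Pow (literals n)"
    by (auto simp: clauses_def)
  show "finite (Pow (literals n))"
    by (simp add: literals_def)
qed

lemma card_clauses: "card (clauses n) = 4 * (n choose 2)"
proof -
  have fin: "finite (literals n)"
    by (simp add: literals_def)
  have "card (literals n) = card (Pos ` {1..n}) + card (Neg ` {1..n})"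
    unfolding literals_def by (intro card_Un_disjoint) auto
  also have "\<dots> = 2 * n"
    by (simp add: card_image inj_on_def)
  finally have card_lits: "card (literals n) = 2 * n" .
  have neg_neg: "neg (neg u) = u" for u
    by (cases u) auto
  let ?T = "{A. A \<subseteq> literals n \<and> card A = 2}"
  let ?C = "(\<lambda>i. {Pos i, Neg i}) ` {1..n}"
  have sub: "?C \<subseteq> ?T"
    by (auto simp: literals_def)
  have pair: "{u, v} \<in> ?C \<longleftrightarrow> u = neg v" if "u \<in> literals n" "v \<in> literals n" for u v
    using that by (cases u; cases v) (auto simp: literals_def doubleton_eq_iff image_iff)
  have eq: "clauses n = ?T - ?C"
  proof (intro equalityI subsetI)
    fix A assume "A \<in> clauses n"
    then obtain u v where uv: "A = {u, v}" "u \<in> literals n" "v \<in> literals n"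
        "u \<noteq> v" "u \<noteq> neg v"
      by (auto simp: clauses_def strictly_distinct_def)
    then show "A \<in> ?T - ?C"
      using pair[of u v] by auto
  next
    fix A assume A: "A \<in> ?T - ?C"
    then obtain u v where uv: "A = {u, v}" "u \<noteq> v"
      by (auto simp: card_2_iff)
    then show "A \<in> clauses n"
      using A pair[of u v] unfolding clauses_def strictly_distinct_def by blast
  qed
  have "finite ?T"
    using fin by simp
  then have "card (clauses n) = card ?T - card ?C"
    unfolding eq using sub by (intro card_Diff_subset) (auto intro: finite_subset)
  also have "card ?T = (2 * n) choose 2"
    using n_subsets[OF fin, of 2] card_lits by simp
  also have "card ?C = n"
    by (subst card_image) (auto simp: inj_on_def doubleton_eq_iff)
  also have "((2 * n) choose 2) - n = 4 * (n choose 2)"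
  proof -
    have "even (n * (n - 1))" by (cases n) auto
    then obtain k where "n * (n - 1) = 2 * k" by blast
    moreover have "2 * n * (2 * n - 1) = 2 * (2 * (n * (n - 1)) + n)"
      by (cases n) (auto simp: algebra_simps)
    ultimately show ?thesis
      by (simp only: choose_two) simp
  qed
  finally show ?thesis .
qed

end

theory Submission imports Defs begin

text \<open>Conditionally on the out-cluster of \<open>x\<close> being a consistent set \<open>S\<close>, no clause leads from \<open>S\<close> to
  the remaining variables or to the negations of \<open>S\<close>, and the clauses on the remaining variables are
  unaffected. Hence both the cluster probabilities and the gain of \<open>y \<leadsto> \<not>y\<close> from conditioning on
  \<open>\<not>(x \<leadsto> \<not>x)\<close> are explicit sums over the size \<open>k\<close> of the cluster. The only
  unknown in them is the probability \<open>reach_prob p k\<close> that a random digraph on \<open>k\<close> vertices is reachable from a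
  root, about which nothing is needed but that the out-cluster sizes in a random digraph on \<open>N\<close>
  vertices form a probability distribution for every \<open>N\<close>: comparing the distributions for different \<open>N\<close>
  at the same \<open>p\<close> (supercritical ones with their subcritical duals) gives the moments of the cluster
  size. Lower bounds are the Harris inequality.\<close>

section \<open>The product measure\<close>

text \<open>Write u(m) for \<open>contra_prob p m\<close>. The covariance of the two events is at
  most the sum over k of \<open>Pk p n k\<close> times u(n) - (n-k)/(n-1) u(n-k), because a cluster
  of size k uses up k variables and misses the variable of y with probability (n-k)/(n-1). Hence the
  increments of u have to be bounded, for which separate estimates of u(n) and u(n-k) are too
  coarse. The bound comes from adding one variable v: a new contradiction forces the old cluster to
  hit both literals of v, or to hit one that is itself contradictory, at a cost of (kp)^2 + 2kpu.
  Let 2pn = 1 - d or 1 + d. The cluster size has first and second moments of order 1/d and 1/d^3,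
  and u(n) is at most of order 1/(n d^2) below and d above the threshold. So the increments are of
  order 1/(n^2 d^3) and 1/n, and averaging over k adds a factor 1/d. This gives 1/(n^2 d^4) and 1/(n
  d), the claimed orders for d = |lambda| n^(-1/3). The value u(n) itself is the mass that
  \<open>Pk\<close> lacks against \<open>Qk\<close> on 2n vertices: they differ in the number of
  available literals and of forbidden clauses, two effects that nearly cancel when 2pn is close to
  1.\<close>

definition expect :: "real \<Rightarrow> 'a set \<Rightarrow> ('a set \<Rightarrow> real) \<Rightarrow> real" where
  "expect p E f = (\<Sum>F\<in>Pow E. p ^ card F * (1 - p) ^ card (E - F) * f F)"

definition Pr :: "real \<Rightarrow> 'a set \<Rightarrow> ('a set \<Rightarrow> bool) \<Rightarrow> real" where
  "Pr p E A = expect p E (\<lambda>F. of_bool (A F))"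

lemma expect_empty [simp]: "expect p {} f = f {}"
  by (simp add: expect_def)

lemma expect_insert:
  assumes "finite E" "e \<notin> E"
  shows "expect p (insert e E) f = p * expect p E (\<lambda>F. f (insert e F)) + (1 - p) * expect p E f"
proof -
  have fin: "finite F" if "F \<in> Pow E" for F
    using that assms(1) finite_subset by auto
  have inj: "inj_on (insert e) (Pow E)"
    using assms(2) by (auto simp: inj_on_def)
  have disj: "Pow E \<inter> insert e ` Pow E = {}"
    using assms(2) by auto
  have 1: "(\<Sum>F\<in>Pow E. p ^ card F * (1 - p) ^ card (insert e E - F) * f F) = (1 - p) * expect p E f"
    unfolding expect_def sum_distrib_left
  proof (rule sum.cong[OF refl])
    fix F assume F: "F \<in> Pow E"
    have "insert e E - F = insert e (E - F)" using F assms by auto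
    then have "card (insert e E - F) = Suc (card (E - F))" using assms by simp
    then show "p ^ card F * (1 - p) ^ card (insert e E - F) * f F
        = (1 - p) * (p ^ card F * (1 - p) ^ card (E - F) * f F)" by simp
  qed
  have 2: "(\<Sum>F\<in>insert e ` Pow E. p ^ card F * (1 - p) ^ card (insert e E - F) * f F)
      = p * expect p E (\<lambda>F. f (insert e F))"
    unfolding expect_def sum_distrib_left sum.reindex[OF inj] o_def
  proof (rule sum.cong[OF refl])
    fix F assume F: "F \<in> Pow E"
    have e: "insert e E - insert e F = E - F" using F assms by auto
    have "card (insert e F) = Suc (card F)" using F assms fin[OF F] by (subst card_insert_disjoint) auto
    then show "p ^ card (insert e F) * (1 - p) ^ card (insert e E - insert e F) * f (insert e F)
        = p * (p ^ card F * (1 - p) ^ card (E - F) * f (insert e F))" by (simp add: e)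
  qed
  show ?thesis
    unfolding expect_def[of p "insert e E"] Pow_insert
    by (subst sum.union_disjoint) (use assms disj 1 2 in auto)
qed

lemma expect_cong:
  assumes "\<And>F. F \<subseteq> E \<Longrightarrow> f F = g F"
  shows "expect p E f = expect p E g"
  unfolding expect_def by (rule sum.cong) (use assms in auto)

lemma Pr_cong:
  assumes "\<And>F. F \<subseteq> E \<Longrightarrow> A F \<longleftrightarrow> B F"
  shows "Pr p E A = Pr p E B"
  unfolding Pr_def by (rule expect_cong) (use assms in auto)

lemma expect_mult_left: "expect p E (\<lambda>F. c * f F) = c * expect p E f"
  unfolding expect_def by (simp add: sum_distrib_left mult_ac)

lemma expect_add: "expect p E (\<lambda>F. f F + g F) = expect p E f + expect p E g"
  unfolding expect_def by (simp add: sum.distrib algebra_simps)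

lemma expect_sum: "expect p E (\<lambda>F. \<Sum>i\<in>I. f i F) = (\<Sum>i\<in>I. expect p E (f i))"
  unfolding expect_def by (simp add: sum_distrib_left) (rule sum.swap)

lemma expect_const: "finite E \<Longrightarrow> expect p E (\<lambda>_. c) = c"
  by (induction E rule: finite_induct) (auto simp: expect_insert algebra_simps)

lemma expect_Un:
  assumes "finite E1" "finite E2" "E1 \<inter> E2 = {}"
  shows "expect p (E1 \<union> E2) f = expect p E1 (\<lambda>F1. expect p E2 (\<lambda>F2. f (F1 \<union> F2)))"
  using assms(1,3)
proof (induction E1 arbitrary: f rule: finite_induct)
  case empty
  then show ?case by simp
next
  case (insert e E)
  then show ?case using assms(2) by (simp add: expect_insert)
qed

lemma Pr_indep:
  assumes "finite E" "E1 \<subseteq> E" "E2 \<subseteq> E" "E1 \<inter> E2 = {}"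
  shows "Pr p E (\<lambda>F. A (F \<inter> E1) \<and> B (F \<inter> E2)) = Pr p E1 A * Pr p E2 B"
proof -
  let ?G = "E - E1 - E2"
  have fin: "finite E1" "finite E2" "finite ?G" using assms finite_subset by auto
  have E: "E = E1 \<union> (E2 \<union> ?G)" using assms by auto
  have "Pr p E (\<lambda>F. A (F \<inter> E1) \<and> B (F \<inter> E2)) =
    expect p E1 (\<lambda>F1. expect p E2 (\<lambda>F2. expect p ?G (\<lambda>F3. of_bool (A ((F1 \<union> (F2 \<union> F3)) \<inter> E1) \<and> B ((F1 \<union> (F2 \<union> F3)) \<inter> E2)))))"
    unfolding Pr_def
    apply (subst E, subst expect_Un)
    using assms fin apply (auto simp only: finite_Un)[3]
    apply (rule expect_cong, subst expect_Un)
    using fin by auto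
  also have "\<dots> = expect p E1 (\<lambda>F1. expect p E2 (\<lambda>F2. expect p ?G (\<lambda>F3. of_bool (A F1) * of_bool (B F2))))"
  proof (intro expect_cong)
    fix F1 F2 F3 assume "F1 \<subseteq> E1" "F2 \<subseteq> E2" "F3 \<subseteq> ?G"
    then have "(F1 \<union> (F2 \<union> F3)) \<inter> E1 = F1" "(F1 \<union> (F2 \<union> F3)) \<inter> E2 = F2" using assms by auto
    then show "(of_bool (A ((F1 \<union> (F2 \<union> F3)) \<inter> E1) \<and> B ((F1 \<union> (F2 \<union> F3)) \<inter> E2)) :: real)
      = of_bool (A F1) * of_bool (B F2)" by auto
  qed
  also have "\<dots> = Pr p E1 A * Pr p E2 B"
    unfolding Pr_def by (simp add: expect_const fin expect_mult_left mult.commute[of _ "expect p E2 _"])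
  finally show ?thesis .
qed

lemma Pr_True: "finite E \<Longrightarrow> Pr p E (\<lambda>_. True) = 1"
  unfolding Pr_def by (simp add: expect_const)

lemma Pr_restrict:
  assumes "finite E" "E1 \<subseteq> E"
  shows "Pr p E (\<lambda>F. A (F \<inter> E1)) = Pr p E1 A"
  using Pr_indep[OF assms, of "{}" p A "\<lambda>_. True"] by (simp add: Pr_True)

lemma Pr_indep3:
  assumes "finite E" "E1 \<subseteq> E" "E2 \<subseteq> E" "E3 \<subseteq> E"
    "E1 \<inter> E2 = {}" "E1 \<inter> E3 = {}" "E2 \<inter> E3 = {}"
  shows "Pr p E (\<lambda>F. A (F \<inter> E1) \<and> B (F \<inter> E2) \<and> D (F \<inter> E3)) = Pr p E1 A * Pr p E2 B * Pr p E3 D"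
proof -
  have "Pr p E (\<lambda>F. A (F \<inter> E1) \<and> B (F \<inter> E2) \<and> D (F \<inter> E3))
     = Pr p E (\<lambda>F. A (F \<inter> E1) \<and> (\<lambda>G. B (G \<inter> E2) \<and> D (G \<inter> E3)) (F \<inter> (E2 \<union> E3)))"
    by (intro Pr_cong) (simp add: Int_absorb1 Int_assoc)
  also have "\<dots> = Pr p E1 A * Pr p (E2 \<union> E3) (\<lambda>G. B (G \<inter> E2) \<and> D (G \<inter> E3))"
    by (rule Pr_indep) (use assms in auto)
  also have "Pr p (E2 \<union> E3) (\<lambda>G. B (G \<inter> E2) \<and> D (G \<inter> E3)) = Pr p E2 B * Pr p E3 D"
    by (rule Pr_indep) (use assms finite_subset in auto)
  finally show ?thesis by simp
qed

lemma Pr_not: "finite E \<Longrightarrow> Pr p E (\<lambda>F. \<not> A F) = 1 - Pr p E A"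
proof -
  assume "finite E"
  have "Pr p E A + Pr p E (\<lambda>F. \<not> A F) = expect p E (\<lambda>_. 1)"
    unfolding Pr_def expect_add[symmetric] by (rule expect_cong) auto
  then show ?thesis using \<open>finite E\<close> by (simp add: expect_const)
qed

lemma Pr_split: "Pr p E A = Pr p E (\<lambda>F. A F \<and> B F) + Pr p E (\<lambda>F. A F \<and> \<not> B F)"
  unfolding Pr_def expect_add[symmetric] by (rule expect_cong) auto

lemma Pr_partition:
  assumes "finite I" "\<And>F. F \<subseteq> E \<Longrightarrow> A F \<Longrightarrow> h F \<in> I"
  shows "Pr p E A = (\<Sum>i\<in>I. Pr p E (\<lambda>F. h F = i \<and> A F))"
  unfolding Pr_def expect_sum[symmetric]
proof (rule expect_cong)
  fix F assume F: "F \<subseteq> E"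
  show "(of_bool (A F) :: real) = (\<Sum>i\<in>I. of_bool (h F = i \<and> A F))"
  proof (cases "A F")
    case True
    then have "(\<Sum>i\<in>I. of_bool (h F = i \<and> A F)) = (\<Sum>i\<in>I. if h F = i then 1 else (0::real))"
      by (intro sum.cong) auto
    then show ?thesis using True assms F by simp
  qed auto
qed

lemma Pr_empty_inter:
  assumes "finite E"
  shows "Pr p E (\<lambda>F. F = {}) = (1 - p) ^ card E"
  using assms unfolding Pr_def by (induction E rule: finite_induct) (auto simp: expect_insert expect_const)

section \<open>Monotonicity, positive correlation, and the link to the probability mass
  function\<close>

context
  fixes p :: real
  assumes p: "0 \<le> p" "p \<le> 1"
begin

lemma expect_mono:
  assumes "\<And>F. F \<subseteq> E \<Longrightarrow> f F \<le> g F"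
  shows "expect p E f \<le> expect p E g"
  unfolding expect_def by (intro sum_mono mult_left_mono) (use assms p in auto)

lemma Pr_mono:
  assumes "\<And>F. F \<subseteq> E \<Longrightarrow> A F \<Longrightarrow> B F"
  shows "Pr p E A \<le> Pr p E B"
  unfolding Pr_def by (rule expect_mono) (use assms in auto)

lemma Pr_nonneg: "0 \<le> Pr p E A"
  unfolding Pr_def expect_def by (intro sum_nonneg) (use p in auto)

lemma Pr_le_1: "finite E \<Longrightarrow> Pr p E A \<le> 1"
  using Pr_mono[of E A "\<lambda>_. True"] Pr_True[of E p] by simp

lemma Pr_disj_le: "Pr p E (\<lambda>F. A F \<or> B F) \<le> Pr p E A + Pr p E B"
  unfolding Pr_def expect_add[symmetric] by (rule expect_mono) auto

lemma Pr_hit_le: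
  assumes "finite E"
  shows "Pr p E (\<lambda>F. F \<noteq> {}) \<le> real (card E) * p"
proof -
  have "1 - real (card E) * p \<le> (1 - p) ^ card E"
    using Bernoulli_inequality[of "- p" "card E"] p by simp
  then show ?thesis using Pr_not[OF assms, of p "\<lambda>F. F = {}"] Pr_empty_inter[OF assms] by simp
qed

text \<open>Induction over the elements of \<open>E\<close>. Conditioning on one element replaces
  each function by its averages with and without it. For increasing functions these averages are
  ordered the same way, so the product of the two mixtures falls short of the mixture of the
  products by \<open>p * (1 - p) * ((a - b) * (c - d))\<close>, which is nonnegative.\<close>

lemma Harris_expect:
  assumes "finite E"
    "\<And>F G. F \<subseteq> G \<Longrightarrow> G \<subseteq> E \<Longrightarrow> f F \<le> f G" "\<And>F G. F \<subseteq> G \<Longrightarrow> G \<subseteq> E \<Longrightarrow> g F \<le> g G"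
  shows "expect p E f * expect p E g \<le> expect p E (\<lambda>F. f F * g F)"
  using assms
proof (induction E arbitrary: f g rule: finite_induct)
  case empty
  then show ?case by simp
next
  case (insert e E)
  let ?f1 = "\<lambda>F. f (insert e F)" and ?g1 = "\<lambda>F. g (insert e F)"
  have m1: "?f1 F \<le> ?f1 G" "?g1 F \<le> ?g1 G" "f F \<le> f G" "g F \<le> g G"
    if "F \<subseteq> G" "G \<subseteq> E" for F G
    using that by (auto intro!: insert.prems)
  have I1: "expect p E ?f1 * expect p E ?g1 \<le> expect p E (\<lambda>F. ?f1 F * ?g1 F)"
    and I0: "expect p E f * expect p E g \<le> expect p E (\<lambda>F. f F * g F)"
    using insert.IH[of ?f1 ?g1, OF m1(1) m1(2)] insert.IH[of f g, OF m1(3) m1(4)] by simp_all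
  have D: "expect p E f \<le> expect p E ?f1" "expect p E g \<le> expect p E ?g1"
    by (rule expect_mono, rule insert.prems; blast)+
  define a b c d where "a = expect p E ?f1" "b = expect p E f" "c = expect p E ?g1" "d = expect p E g"
  have "(p * a + (1 - p) * b) * (p * c + (1 - p) * d)
      = p * (a * c) + (1 - p) * (b * d) - p * (1 - p) * ((a - b) * (c - d))"
    by (simp add: algebra_simps)
  also have "\<dots> \<le> p * (a * c) + (1 - p) * (b * d)"
    using D p unfolding a_b_c_d_def[symmetric] by simp
  also have "\<dots> \<le> p * expect p E (\<lambda>F. ?f1 F * ?g1 F) + (1 - p) * expect p E (\<lambda>F. f F * g F)"
    by (intro add_mono mult_left_mono) (use I0 I1 p in \<open>auto simp: a_b_c_d_def\<close>)
  finally show ?case using insert.hyps by (simp add: expect_insert a_b_c_d_def)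
qed

lemma Harris_Pr:
  assumes "finite E" "\<And>F G. F \<subseteq> G \<Longrightarrow> A F \<Longrightarrow> A G" "\<And>F G. F \<subseteq> G \<Longrightarrow> B F \<Longrightarrow> B G"
  shows "Pr p E A * Pr p E B \<le> Pr p E (\<lambda>F. A F \<and> B F)"
  unfolding Pr_def of_bool_conj
  by (rule Harris_expect[OF assms(1)]) (use assms(2,3) in \<open>auto simp: of_bool_def\<close>)

text \<open>\<open>expect\<close> is a finite sum over subsets, so that conditioning amounts to
  splitting sets of clauses. This lemma carries the results over to the probability mass function of
  the random formula.\<close>

lemma prob_random_subset:
  assumes fin: "finite E"
  shows "measure_pmf.prob
           (map_pmf (\<lambda>f. {c \<in> E. f c}) (Pi_pmf E False (\<lambda>_. bernoulli_pmf p))) {F. A F} = Pr p E A"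
proof -
  let ?P = "Pi_pmf E False (\<lambda>_. bernoulli_pmf p)"
  let ?M = "map_pmf (\<lambda>f. {c \<in> E. f c}) ?P"
  have set_M: "set_pmf ?M \<subseteq> Pow E" by auto
  have finS: "finite (set_pmf ?M)" using set_M fin finite_subset by blast
  have pmf_M: "pmf ?M F = p ^ card F * (1 - p) ^ card (E - F)" if F: "F \<subseteq> E" for F
  proof -
    have "pmf ?M F = measure_pmf.prob ?P ((\<lambda>f. {c \<in> E. f c}) -` {F})" by (rule pmf_map)
    \<comment> \<open>The preimage of \<open>F\<close> also contains functions that are true
      somewhere outside \<open>E\<close>; \<open>Pi_pmf\<close> gives them mass zero because the
      default value is \<open>False\<close>.\<close>
    also have "\<dots> = measure_pmf.prob ?P {\<lambda>c. c \<in> F}"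
    proof (rule measure_prob_cong_0)
      fix f assume f: "f \<in> (\<lambda>f. {c \<in> E. f c}) -` {F} - {\<lambda>c. c \<in> F}"
      then obtain c where "f c \<noteq> (c \<in> F)" by auto
      then have "c \<notin> E" "f c" using f F by auto
      then show "pmf ?P f = 0" using fin by (intro pmf_Pi_outside) auto
    qed (use F in auto)
    also have "\<dots> = pmf ?P (\<lambda>c. c \<in> F)" by (simp add: measure_pmf_single)
    also have "\<dots> = (\<Prod>c\<in>E. pmf (bernoulli_pmf p) (c \<in> F))"
      using F by (intro pmf_Pi'[OF fin]) auto
    also have "\<dots> = (\<Prod>c\<in>E. if c \<in> F then p else 1 - p)"
      by (rule prod.cong) (use p in auto)
    also have "\<dots> = (\<Prod>c\<in>E \<inter> F. p) * (\<Prod>c\<in>E \<inter> - F. 1 - p)"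
      using prod.If_cases[OF fin, of "\<lambda>c. c \<in> F" "\<lambda>_. p" "\<lambda>_. 1 - p"] by simp
    also have "\<dots> = p ^ card F * (1 - p) ^ card (E - F)"
      using F by (simp add: Int_absorb1 Diff_eq)
    finally show ?thesis .
  qed
  have "measure_pmf.prob ?M {F. A F} = measure_pmf.prob ?M (Pow E \<inter> {F. A F})"
    by (rule measure_pmf.finite_measure_eq_AE) (use set_M in \<open>auto simp: AE_measure_pmf_iff\<close>)
  also have "\<dots> = (\<Sum>F\<in>Pow E \<inter> {F. A F}. pmf ?M F)"
    by (rule measure_measure_pmf_finite) (use fin in auto)
  also have "\<dots> = (\<Sum>F\<in>Pow E. if A F then pmf ?M F else 0)"
    using sum.inter_restrict[of "Pow E" "pmf ?M" "{F. A F}"] fin by simp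
  also have "\<dots> = Pr p E A"
    unfolding Pr_def expect_def by (rule sum.cong) (use pmf_M in auto)
  finally show ?thesis .
qed

end

section \<open>Out-clusters\<close>

fun var :: "literal \<Rightarrow> nat" where
  "var (Pos i) = i"
| "var (Neg i) = i"

lemma neg_neg [simp]: "neg (neg u) = u"
  by (cases u) auto

lemma neg_inject [simp]: "neg u = neg v \<longleftrightarrow> u = v"
  by (cases u; cases v) auto

lemma neg_neq [simp]: "neg u \<noteq> u" "u \<noteq> neg u"
  by (cases u; simp)+

lemma var_neg [simp]: "var (neg u) = var u"
  by (cases u) auto

lemma var_eq_iff: "var u = var v \<longleftrightarrow> u = v \<or> u = neg v"
  by (cases u; cases v) auto

lemma strictly_distinct_iff_var: "strictly_distinct u v \<longleftrightarrow> var u \<noteq> var v"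
  unfolding strictly_distinct_def var_eq_iff by auto

definition lits :: "nat set \<Rightarrow> literal set" where
  "lits V = {z. var z \<in> V}"

lemma lits_altdef: "lits V = Pos ` V \<union> Neg ` V"
proof -
  have "z \<in> lits V \<longleftrightarrow> z \<in> Pos ` V \<union> Neg ` V" for z
    by (cases z) (auto simp: lits_def)
  then show ?thesis by blast
qed

lemma finite_lits: "finite V \<Longrightarrow> finite (lits V)"
  by (simp add: lits_altdef)

definition clauses_on :: "nat set \<Rightarrow> literal set set" where
  "clauses_on V = {{u, v} | u v. u \<in> lits V \<and> v \<in> lits V \<and> var u \<noteq> var v}"

lemma clauses_eq_clauses_on: "clauses n = clauses_on {1..n}"
  unfolding clauses_def clauses_on_def literals_def lits_altdef strictly_distinct_iff_var ..

lemma finite_clauses_on: "finite V \<Longrightarrow> finite (clauses_on V)"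
  by (rule finite_subset[of _ "Pow (lits V)"]) (auto simp: clauses_on_def finite_lits)

lemma clauses_on_pair: "{u, v} \<in> clauses_on V \<longleftrightarrow> var u \<in> V \<and> var v \<in> V \<and> var u \<noteq> var v"
  unfolding clauses_on_def lits_def by (auto simp: doubleton_eq_iff)

lemma clauses_on_mono: "V \<subseteq> W \<Longrightarrow> clauses_on V \<subseteq> clauses_on W"
  unfolding clauses_on_def lits_def by blast

section \<open>Consistent sets of literals and the duality of the implication digraph\<close>

definition consistent :: "literal set \<Rightarrow> bool" where
  "consistent S \<longleftrightarrow> (\<forall>z\<in>S. neg z \<notin> S)"

lemma inj_on_var: "consistent S \<Longrightarrow> inj_on var S"
  unfolding inj_on_def var_eq_iff consistent_def by auto

definition out_cluster :: "literal set set \<Rightarrow> literal \<Rightarrow> literal set" where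
  "out_cluster F x = {z. leads_to F x z}"

lemma out_cluster_self [simp]: "x \<in> out_cluster F x"
  by (simp add: out_cluster_def leads_to_def)

lemma out_cluster_step: "w \<in> out_cluster F x \<Longrightarrow> {neg w, z} \<in> F \<Longrightarrow> z \<in> out_cluster F x"
  unfolding out_cluster_def leads_to_def implication_digraph_def
  by (auto intro: rtrancl_into_rtrancl)

lemma out_cluster_induct [consumes 1, case_names self step]:
  assumes "z \<in> out_cluster F x" "P x"
    "\<And>w z. w \<in> out_cluster F x \<Longrightarrow> P w \<Longrightarrow> {neg w, z} \<in> F \<Longrightarrow> P z"
  shows "P z"
proof -
  have "(x, z) \<in> (implication_digraph F)\<^sup>*" using assms(1) by (simp add: out_cluster_def leads_to_def)
  then show ?thesis
  proof (induction rule: rtrancl_induct)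
    case base
    then show ?case by (rule assms(2))
  next
    case (step w z)
    then show ?case using assms(3)[of w z]
      by (simp add: out_cluster_def leads_to_def implication_digraph_def)
  qed
qed

lemma out_cluster_subset:
  assumes "x \<in> S" "\<And>w z. w \<in> S \<Longrightarrow> {neg w, z} \<in> F \<Longrightarrow> z \<in> S"
  shows "out_cluster F x \<subseteq> S"
proof
  fix z assume "z \<in> out_cluster F x"
  then show "z \<in> S" by (induction rule: out_cluster_induct) (use assms in auto)
qed

lemma out_cluster_mono: "F \<subseteq> G \<Longrightarrow> out_cluster F x \<subseteq> out_cluster G x"
  by (rule out_cluster_subset) (auto intro: out_cluster_step)

lemma leads_to_mono: "F \<subseteq> G \<Longrightarrow> leads_to F x y \<Longrightarrow> leads_to G x y"
  using out_cluster_mono[of F G x] by (auto simp: out_cluster_def)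

text \<open>The clause \<open>{neg y, z}\<close> gives the edge from \<open>y\<close> to
  \<open>z\<close> and also the edge from \<open>neg z\<close> to \<open>neg y\<close>. So every
  path can be reversed with all its literals negated.\<close>

lemma leads_to_contrapositive: "leads_to F x y \<Longrightarrow> leads_to F (neg y) (neg x)"
  unfolding leads_to_def
proof (induction rule: rtrancl_induct)
  case (step y z)
  then have "(neg z, neg y) \<in> implication_digraph F"
    by (simp add: implication_digraph_def insert_commute)
  then show ?case using step.IH by (rule converse_rtrancl_into_rtrancl)
qed simp

text \<open>If both \<open>z\<close> and \<open>neg z\<close> are reached from \<open>x\<close>,
  reversing the path to \<open>neg z\<close> gives a path from \<open>z\<close> to
  \<open>neg x\<close>, which continues the path to \<open>z\<close>.\<close>

lemma consistent_out_cluster: "consistent (out_cluster F x) \<longleftrightarrow> \<not> leads_to F x (neg x)"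
proof
  assume "consistent (out_cluster F x)"
  then show "\<not> leads_to F x (neg x)"
    using out_cluster_self[of x F] unfolding consistent_def out_cluster_def by blast
next
  assume n: "\<not> leads_to F x (neg x)"
  show "consistent (out_cluster F x)"
    unfolding consistent_def
  proof safe
    fix z assume "z \<in> out_cluster F x" "neg z \<in> out_cluster F x"
    then have "leads_to F x z" "leads_to F x (neg z)" by (auto simp: out_cluster_def)
    then have "leads_to F x z" "leads_to F z (neg x)" using leads_to_contrapositive by force+
    then show False using n unfolding leads_to_def by (meson rtrancl_trans)
  qed
qed

lemma out_cluster_lits:
  assumes "F \<subseteq> clauses_on V" "x \<in> lits V"
  shows "out_cluster F x \<subseteq> lits V"
proof (rule out_cluster_subset)
  fix w z assume "{neg w, z} \<in> F"
  then show "z \<in> lits V" using assms(1) clauses_on_pair[of "neg w" z V] by (auto simp: lits_def)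
qed (rule assms)

section \<open>Splitting the clauses along a cluster\<close>

text \<open>The edges between members of \<open>S\<close>. For consistent \<open>S\<close>, distinct
  ordered pairs give distinct clauses, since the other edge of such a clause runs between negations
  and hence outside \<open>S\<close>. So the formula restricted to \<open>inside S\<close> is a
  random digraph on \<open>card S\<close> vertices with independent edges.\<close>

definition inside :: "literal set \<Rightarrow> literal set set" where
  "inside S = {{neg w, z} | w z. w \<in> S \<and> z \<in> S \<and> w \<noteq> z}"

definition bdry :: "literal set set \<Rightarrow> literal set \<Rightarrow> literal set set" where
  "bdry E S = {c \<in> E. \<exists>w\<in>S. \<exists>z. z \<notin> S \<and> c = {neg w, z}}"

lemma finite_inside: "finite S \<Longrightarrow> finite (inside S)"
  by (rule finite_subset[of _ "Pow (neg ` S \<union> S)"]) (auto simp: inside_def)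

lemma inside_mono: "T \<subseteq> S \<Longrightarrow> inside T \<subseteq> inside S"
  unfolding inside_def by blast

lemma inside_inter_bdry: "consistent S \<Longrightarrow> inside S \<inter> bdry E S = {}"
  unfolding inside_def bdry_def consistent_def by (auto simp: doubleton_eq_iff)

lemma inside_subset_clauses_on: "consistent S \<Longrightarrow> S \<subseteq> lits V \<Longrightarrow> inside S \<subseteq> clauses_on V"
  unfolding inside_def by (auto simp: clauses_on_pair lits_def var_eq_iff consistent_def)

text \<open>Paths that stay in the cluster need only the clauses in \<open>inside S\<close>, and
  nothing leaves \<open>S\<close> exactly when no boundary clause is present. For consistent
  \<open>S\<close> these are conditions on disjoint sets of clauses, which makes the probability of
  a cluster a product.\<close>

lemma out_cluster_eq_iff:
  assumes "F \<subseteq> E" "x \<in> S"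
  shows "out_cluster F x = S \<longleftrightarrow> out_cluster (F \<inter> inside S) x = S \<and> F \<inter> bdry E S = {}"
proof (intro iffI conjI)
  assume S: "out_cluster F x = S"
  have "z \<in> out_cluster (F \<inter> inside S) x" if "z \<in> out_cluster F x" for z
    using that
  proof (induction rule: out_cluster_induct)
    case (step w z)
    show ?case
    proof (cases "z = w")
      case False
      then have "{neg w, z} \<in> F \<inter> inside S"
        using step out_cluster_step[OF step.hyps(1) step.hyps(2)] S unfolding inside_def by auto
      then show ?thesis by (rule out_cluster_step[OF step.IH])
    qed (use step in simp)
  qed simp
  moreover have "out_cluster (F \<inter> inside S) x \<subseteq> S" using out_cluster_mono[of "F \<inter> inside S" F x] S by simp
  ultimately show "out_cluster (F \<inter> inside S) x = S" using S by blast
  show "F \<inter> bdry E S = {}"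
    using out_cluster_step[of _ F x] S unfolding bdry_def by blast
next
  assume *: "out_cluster (F \<inter> inside S) x = S \<and> F \<inter> bdry E S = {}"
  have "out_cluster F x \<subseteq> S"
  proof (rule out_cluster_subset[OF assms(2)])
    fix w z assume "w \<in> S" "{neg w, z} \<in> F"
    then show "z \<in> S" using * assms(1) unfolding bdry_def by blast
  qed
  then show "out_cluster F x = S" using * out_cluster_mono[of "F \<inter> inside S" F x] by auto
qed

lemma out_cluster_eq_local:
  assumes "F \<subseteq> E" "x \<in> S"
  shows "out_cluster F x = S \<longleftrightarrow> out_cluster (F \<inter> (inside S \<union> bdry E S)) x = S"
proof -
  let ?D = "inside S \<union> bdry E S"
  have "F \<inter> ?D \<inter> inside S = F \<inter> inside S" "F \<inter> ?D \<inter> bdry E S = F \<inter> bdry E S" by auto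
  then show ?thesis
    using out_cluster_eq_iff[OF assms] out_cluster_eq_iff[of "F \<inter> ?D" E x S] assms by auto
qed

lemma Pr_out_cluster_eq:
  assumes "finite E" "consistent S" "x \<in> S" "inside S \<subseteq> E"
  shows "Pr p E (\<lambda>F. out_cluster F x = S)
    = Pr p (inside S) (\<lambda>F. out_cluster F x = S) * (1 - p) ^ card (bdry E S)"
proof -
  have b: "bdry E S \<subseteq> E" by (auto simp: bdry_def)
  have "Pr p E (\<lambda>F. out_cluster F x = S)
      = Pr p E (\<lambda>F. (\<lambda>G. out_cluster G x = S) (F \<inter> inside S) \<and> (\<lambda>G. G = {}) (F \<inter> bdry E S))"
    by (rule Pr_cong, rule out_cluster_eq_iff) (use assms in auto)
  also have "\<dots> = Pr p (inside S) (\<lambda>F. out_cluster F x = S) * Pr p (bdry E S) (\<lambda>G. G = {})"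
    by (rule Pr_indep) (use assms b inside_inter_bdry in auto)
  finally show ?thesis using Pr_empty_inter[OF finite_subset[OF b assms(1)]] by simp
qed

lemma card_bdry_inside:
  assumes "consistent S" "finite S" "T \<subseteq> S"
  shows "card (bdry (inside S) T) = card T * card (S - T)"
proof -
  have "bdry (inside S) T = (\<lambda>(w, z). {neg w, z}) ` (T \<times> (S - T))"
    (is "?L = ?reach_prob")
  proof (intro equalityI subsetI)
    fix c assume "c \<in> ?L"
    then obtain w z where wz: "w \<in> T" "z \<notin> T" "c = {neg w, z}" "c \<in> inside S"
      by (auto simp: bdry_def)
    then obtain a b where ab: "a \<in> S" "b \<in> S" "{neg w, z} = {neg a, b}" by (auto simp: inside_def)
    then have "z \<in> S" using wz assms(1,3) unfolding consistent_def by (auto simp: doubleton_eq_iff)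
    then show "c \<in> ?reach_prob" using wz by auto
  next
    fix c assume "c \<in> ?reach_prob"
    then obtain w z where wz: "w \<in> T" "z \<in> S" "z \<notin> T" "c = {neg w, z}" by auto
    then show "c \<in> ?L" using assms(3) unfolding bdry_def inside_def by auto
  qed
  moreover have "inj_on (\<lambda>(w, z). {neg w, z}) (T \<times> (S - T))"
    using assms(1,3) unfolding inj_on_def consistent_def by (auto simp: doubleton_eq_iff)
  ultimately show ?thesis by (simp add: card_image card_cartesian_product)
qed

text \<open>A clause with an edge out of \<open>S\<close> joins a negated member of \<open>S\<close>
  either to one of the \<open>2 * (m - k)\<close> literals of the other variables or to another
  negated member. In the second case two edges from \<open>S\<close> to negations belong to the same
  clause, so it is counted once per unordered pair.\<close>

lemma card_bdry_clauses_on: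
  assumes "consistent S" "finite V" "S \<subseteq> lits V" "card S = k" "card V = m"
  shows "card (bdry (clauses_on V) S) = 2 * k * (m - k) + k * (k - 1) div 2"
proof -
  let ?W = "V - var ` S"
  let ?f = "\<lambda>(w, z). {neg w, z}"
  let ?A = "?f ` (S \<times> lits ?W)" and ?B = "{c. c \<subseteq> neg ` S \<and> card c = 2}"
  have finS: "finite S" using assms finite_lits finite_subset by blast
  have "bdry (clauses_on V) S = ?A \<union> ?B"
  proof (intro equalityI subsetI)
    fix c assume "c \<in> bdry (clauses_on V) S"
    then obtain w z where wz: "w \<in> S" "z \<notin> S" "c = {neg w, z}" "{neg w, z} \<in> clauses_on V"
      by (auto simp: bdry_def)
    then have v: "var z \<in> V" "var z \<noteq> var w" by (auto simp: clauses_on_pair)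
    show "c \<in> ?A \<union> ?B"
    proof (cases "var z \<in> var ` S")
      case True
      then obtain s where "s \<in> S" "z = neg s" using wz(2) by (auto simp: var_eq_iff)
      then have "c \<in> ?B" using wz v by (auto simp: card_insert_if)
      then show ?thesis by simp
    next
      case False
      then show ?thesis using wz v by (auto simp: lits_def)
    qed
  next
    fix c assume "c \<in> ?A \<union> ?B"
    then show "c \<in> bdry (clauses_on V) S"
    proof
      assume "c \<in> ?A"
      then obtain w z where "w \<in> S" "c = {neg w, z}" "var z \<in> V" "var z \<notin> var ` S"
        by (auto simp: lits_def)
      moreover from this have "{neg w, z} \<in> clauses_on V"
        using assms(3) by (auto simp: clauses_on_pair lits_def) (metis imageI)
      ultimately show ?thesis by (auto simp: bdry_def)
    next
      assume "c \<in> ?B"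
      then obtain w z where wz: "w \<in> S" "z \<in> S" "w \<noteq> z" "c = {neg w, neg z}"
        by (auto simp: card_2_iff)
      moreover have "{neg w, neg z} \<in> clauses_on V"
        using wz assms(1,3) inj_onD[OF inj_on_var[OF assms(1)], of w z] by (auto simp: clauses_on_pair lits_def)
      ultimately show ?thesis using assms(1) by (auto simp: bdry_def consistent_def)
    qed
  qed
  moreover have "?A \<inter> ?B = {}"
  proof -
    have "{neg w, z} \<notin> ?B" if "z \<in> lits ?W" for w z
      using that by (auto simp: lits_def)
    then show ?thesis by auto
  qed
  moreover have "card ?A = 2 * k * (m - k)"
  proof -
    have "inj_on ?f (S \<times> lits ?W)"
      by (auto simp: inj_on_def doubleton_eq_iff lits_def)
    moreover have "card (lits ?W) = 2 * (m - k)"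
    proof -
      have "card (lits ?W) = card (Pos ` ?W) + card (Neg ` ?W)"
        unfolding lits_altdef using assms(2) by (intro card_Un_disjoint) auto
      also have "\<dots> = 2 * card ?W" by (simp add: card_image inj_on_def)
      also have "card ?W = card V - card (var ` S)"
        using assms(3) finS by (intro card_Diff_subset) (auto simp: lits_def)
      finally show ?thesis using assms by (simp add: card_image inj_on_var)
    qed
    ultimately show ?thesis using assms(4) by (simp add: card_image card_cartesian_product)
  qed
  moreover have "card ?B = k * (k - 1) div 2"
    using n_subsets[of "neg ` S" 2] finS assms(4) by (simp add: card_image inj_on_def choose_two)
  moreover have "finite ?A" "finite ?B" using finS assms(2) by (auto simp: finite_lits)
  ultimately show ?thesis by (simp add: card_Un_disjoint)
qed

text \<open>The probability that a root reaches all \<open>N\<close> vertices of a random digraph, obtained by conditioning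
  on the out-cluster of the root.\<close>

fun reach_prob :: "real \<Rightarrow> nat \<Rightarrow> real" where
  "reach_prob p N = 1 - (\<Sum>k\<in>{1..<N}. real ((N - 1) choose (k - 1)) * reach_prob p k * (1 - p) ^ (k * (N - k)))"

declare reach_prob.simps [simp del]

lemma sum_subsets_card:
  assumes "finite S" "x \<in> S"
  shows "(\<Sum>T\<in>{T. T \<subseteq> S \<and> x \<in> T}. g (card T))
    = (\<Sum>k=1..card S. real ((card S - 1) choose (k - 1)) * (g k :: real))"
proof -
  let ?U = "S - {x}"
  have fin: "finite ?U" using assms by simp
  have im: "{T. T \<subseteq> S \<and> x \<in> T} = insert x ` Pow ?U"
  proof (intro equalityI subsetI)
    fix T assume "T \<in> {T. T \<subseteq> S \<and> x \<in> T}"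
    then have "T = insert x (T - {x})" "T - {x} \<in> Pow ?U" by auto
    then show "T \<in> insert x ` Pow ?U" by blast
  qed (use assms in auto)
  have inj: "inj_on (insert x) (Pow ?U)" by (auto simp: inj_on_def)
  have c: "card (insert x T) = Suc (card T)" if "T \<in> Pow ?U" for T
    using that fin finite_subset by (subst card_insert_disjoint) auto
  have "(\<Sum>T\<in>{T. T \<subseteq> S \<and> x \<in> T}. g (card T)) = (\<Sum>T\<in>Pow ?U. g (Suc (card T)))"
    unfolding im sum.reindex[OF inj] by (rule sum.cong) (use c in auto)
  also have "\<dots> = (\<Sum>j\<in>{..card ?U}. \<Sum>T\<in>{T \<in> Pow ?U. card T = j}. g (Suc (card T)))"
    by (rule sum.group[symmetric]) (use fin in \<open>auto intro: card_mono\<close>)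
  also have "\<dots> = (\<Sum>j\<in>{..card ?U}. real (card ?U choose j) * g (Suc j))"
    using n_subsets[OF fin] by (intro sum.cong) (auto simp: Pow_def)
  also have "\<dots> = (\<Sum>k=1..card S. real ((card S - 1) choose (k - 1)) * g k)"
    by (rule sum.reindex_bij_witness[of _ "\<lambda>k. k - 1" Suc]) (use assms card_gt_0_iff[of S] in auto)
  finally show ?thesis .
qed

text \<open>The cluster of the root within \<open>S\<close> is some \<open>T\<close>, which has the
  probability that the root reaches all of \<open>T\<close> times \<open>1 - p\<close> to the power
  \<open>card T * card (S - T)\<close>. Solving the total mass 1 for the term \<open>T = S\<close>
  is the recursion of \<open>reach_prob\<close>, so the result depends on \<open>card S\<close>
  alone.\<close>

lemma Pr_inside_eq_reach_prob:
  assumes "finite S" "consistent S" "x \<in> S"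
  shows "Pr p (inside S) (\<lambda>F. out_cluster F x = S) = reach_prob p (card S)"
  using assms
proof (induction "card S" arbitrary: S rule: less_induct)
  case less
  let ?N = "card S"
  let ?I = "{T. T \<subseteq> S \<and> x \<in> T}"
  have pos: "?N \<ge> 1" using less.prems by (auto simp: Suc_le_eq card_gt_0_iff)
  have cl: "out_cluster F x \<subseteq> S" if "F \<subseteq> inside S" for F
  proof (rule out_cluster_subset[OF less.prems(3)])
    fix w z assume "w \<in> S" "{neg w, z} \<in> F"
    then have "{neg w, z} \<in> inside S" using that by blast
    then show "z \<in> S" using \<open>w \<in> S\<close> less.prems(2) unfolding inside_def consistent_def
      by (auto simp: doubleton_eq_iff)
  qed
  have "1 = Pr p (inside S) (\<lambda>_. True)" using less.prems by (simp add: Pr_True finite_inside)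
  also have "\<dots> = (\<Sum>T\<in>?I. Pr p (inside S) (\<lambda>F. out_cluster F x = T \<and> True))"
    by (rule Pr_partition) (use less.prems cl in auto)
  also have "\<dots> = (\<Sum>T\<in>?I. Pr p (inside T) (\<lambda>F. out_cluster F x = T) * (1 - p) ^ (card T * (?N - card T)))"
  proof (rule sum.cong[OF refl])
    fix T assume T: "T \<in> ?I"
    then have "consistent T" using less.prems(2) by (auto simp: consistent_def)
    then have "Pr p (inside S) (\<lambda>F. out_cluster F x = T)
        = Pr p (inside T) (\<lambda>F. out_cluster F x = T) * (1 - p) ^ card (bdry (inside S) T)"
      using T less.prems by (intro Pr_out_cluster_eq) (auto simp: finite_inside inside_mono)
    moreover have "card (S - T) = ?N - card T"
      using T less.prems finite_subset by (intro card_Diff_subset) auto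
    ultimately show "Pr p (inside S) (\<lambda>F. out_cluster F x = T \<and> True)
      = Pr p (inside T) (\<lambda>F. out_cluster F x = T) * (1 - p) ^ (card T * (?N - card T))"
      using card_bdry_inside[of S T] T less.prems by simp
  qed
  also have "\<dots> = Pr p (inside S) (\<lambda>F. out_cluster F x = S) +
      (\<Sum>T\<in>?I - {S}. Pr p (inside T) (\<lambda>F. out_cluster F x = T) * (1 - p) ^ (card T * (?N - card T)))"
    using less.prems by (subst sum.remove[of _ S]) auto
  also have "(\<Sum>T\<in>?I - {S}. Pr p (inside T) (\<lambda>F. out_cluster F x = T) * (1 - p) ^ (card T * (?N - card T)))
     = (\<Sum>T\<in>?I - {S}. reach_prob p (card T) * (1 - p) ^ (card T * (?N - card T)))"
  proof (rule sum.cong[OF refl])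
    fix T assume T: "T \<in> ?I - {S}"
    then have "card T < card S" "finite T" "consistent T" "x \<in> T"
      using less.prems by (auto simp: consistent_def finite_subset intro!: psubset_card_mono)
    then show "Pr p (inside T) (\<lambda>F. out_cluster F x = T) * (1 - p) ^ (card T * (?N - card T))
        = reach_prob p (card T) * (1 - p) ^ (card T * (?N - card T))" using less.hyps[of T] by simp
  qed
  also have "\<dots> = (\<Sum>T\<in>?I. reach_prob p (card T) * (1 - p) ^ (card T * (?N - card T))) - reach_prob p ?N"
    using less.prems by (subst sum.remove[of ?I S]) auto
  also have "(\<Sum>T\<in>?I. reach_prob p (card T) * (1 - p) ^ (card T * (?N - card T)))
     = (\<Sum>k=1..?N. real ((?N - 1) choose (k - 1)) * (reach_prob p k * (1 - p) ^ (k * (?N - k))))"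
    using less.prems sum_subsets_card[of S x "\<lambda>k. reach_prob p k * (1 - p) ^ (k * (?N - k))"] by simp
  also have "\<dots> = (\<Sum>k\<in>{1..<?N}. real ((?N - 1) choose (k - 1)) * reach_prob p k * (1 - p) ^ (k * (?N - k))) + reach_prob p ?N"
  proof -
    have "{1..?N} = insert ?N {1..<?N}" using pos by auto
    then show ?thesis by (simp add: mult_ac)
  qed
  finally show ?case by (subst reach_prob.simps) simp
qed

section \<open>Contradictory literals\<close>

definition cons_sets :: "nat set \<Rightarrow> literal set set" where
  "cons_sets V = {S. S \<subseteq> lits V \<and> consistent S}"

lemma finite_cons_sets: "finite V \<Longrightarrow> finite (cons_sets V)"
  by (rule finite_subset[of _ "Pow (lits V)"]) (auto simp: cons_sets_def finite_lits)

lemma cons_sets_finite: "finite V \<Longrightarrow> S \<in> cons_sets V \<Longrightarrow> finite S"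
  using finite_lits finite_subset by (auto simp: cons_sets_def)

lemma consistent_insert: "var z \<notin> var ` S \<Longrightarrow> consistent (insert z S) \<longleftrightarrow> consistent S"
  unfolding consistent_def by (auto simp: image_iff var_eq_iff)

lemma cons_sets_insert_root:
  assumes "var z \<notin> W"
  shows "{S \<in> cons_sets (insert (var z) W). z \<in> S} = insert z ` cons_sets W"
proof (intro equalityI subsetI)
  fix S assume "S \<in> {S \<in> cons_sets (insert (var z) W). z \<in> S}"
  then have S: "S \<subseteq> lits (insert (var z) W)" "consistent S" "z \<in> S" by (auto simp: cons_sets_def)
  have "var s \<noteq> var z" if "s \<in> S - {z}" for s
    using S that unfolding var_eq_iff consistent_def by auto
  then have "S - {z} \<subseteq> lits W" using S(1) by (auto simp: lits_def)
  moreover have "consistent (S - {z})" using S(2) by (auto simp: consistent_def)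
  ultimately show "S \<in> insert z ` cons_sets W"
    using S(3) by (intro image_eqI[of _ _ "S - {z}"]) (auto simp: cons_sets_def)
next
  fix S assume "S \<in> insert z ` cons_sets W"
  then obtain T where T: "T \<subseteq> lits W" "consistent T" "S = insert z T" by (auto simp: cons_sets_def)
  then have "var z \<notin> var ` T" using assms by (auto simp: lits_def)
  then show "S \<in> {S \<in> cons_sets (insert (var z) W). z \<in> S}"
    using T consistent_insert[of z T] by (auto simp: cons_sets_def lits_def)
qed

lemma sum_cons_sets_insert:
  assumes "finite W" "var z \<notin> W"
  shows "(\<Sum>S\<in>insert z ` cons_sets W. g (card S)) = (\<Sum>S\<in>cons_sets W. g (Suc (card S)))"
proof -
  have nz: "z \<notin> S" if "S \<in> cons_sets W" for S
    using that assms by (auto simp: cons_sets_def lits_def)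
  then have "inj_on (insert z) (cons_sets W)" unfolding inj_on_def by (metis insert_ident)
  then have "(\<Sum>S\<in>insert z ` cons_sets W. g (card S)) = (\<Sum>S\<in>cons_sets W. g (card (insert z S)))"
    by (simp add: sum.reindex)
  also have "\<dots> = (\<Sum>S\<in>cons_sets W. g (Suc (card S)))"
    by (rule sum.cong) (use nz cons_sets_finite[OF assms(1)] in auto)
  finally show ?thesis .
qed

lemma cons_sets_insert:
  assumes "v \<notin> V"
  shows "cons_sets (insert v V) = cons_sets V \<union> insert (Pos v) ` cons_sets V \<union> insert (Neg v) ` cons_sets V"
proof -
  have "cons_sets (insert v V) = {S \<in> cons_sets (insert v V). Pos v \<notin> S \<and> Neg v \<notin> S}
      \<union> {S \<in> cons_sets (insert v V). Pos v \<in> S} \<union> {S \<in> cons_sets (insert v V). Neg v \<in> S}" by auto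
  moreover have "{S \<in> cons_sets (insert v V). Pos v \<notin> S \<and> Neg v \<notin> S} = cons_sets V"
    using assms by (auto simp: cons_sets_def lits_altdef)
  ultimately show ?thesis
    using cons_sets_insert_root[of "Pos v" V] cons_sets_insert_root[of "Neg v" V] assms by simp
qed

text \<open>A consistent set is a choice of variables with one sign for each. A further variable is
  absent, positive or negated, and Pascal's rule combines the three cases.\<close>

lemma sum_cons_sets:
  assumes "finite V"
  shows "(\<Sum>S\<in>cons_sets V. g (card S)) = (\<Sum>k\<le>card V. real (card V choose k) * 2 ^ k * (g k :: real))"
  using assms
proof (induction V arbitrary: g rule: finite_induct)
  case empty
  have "cons_sets {} = {{}}" by (auto simp: cons_sets_def lits_def consistent_def)
  then show ?case by simp
next
  case (insert v V)
  let ?c = "card V"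
  let ?A = "insert (Pos v) ` cons_sets V" and ?B = "insert (Neg v) ` cons_sets V"
  have fin: "finite (cons_sets V)" by (rule finite_cons_sets) fact
  have d1: "cons_sets V \<inter> ?A = {}" and d2: "(cons_sets V \<union> ?A) \<inter> ?B = {}"
    using insert.hyps by (auto simp: cons_sets_def lits_def)
  have "(\<Sum>S\<in>cons_sets (insert v V). g (card S))
    = (\<Sum>S\<in>cons_sets V. g (card S)) + (\<Sum>S\<in>?A. g (card S)) + (\<Sum>S\<in>?B. g (card S))"
    unfolding cons_sets_insert[OF insert.hyps(2)]
    by (subst sum.union_disjoint; (subst sum.union_disjoint)?) (use fin d1 d2 in auto)
  also have "(\<Sum>S\<in>?A. g (card S)) = (\<Sum>S\<in>cons_sets V. g (Suc (card S)))"
    by (rule sum_cons_sets_insert) (use insert.hyps in auto)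
  also have "(\<Sum>S\<in>?B. g (card S)) = (\<Sum>S\<in>cons_sets V. g (Suc (card S)))"
    by (rule sum_cons_sets_insert) (use insert.hyps in auto)
  also have "(\<Sum>S\<in>cons_sets V. g (card S)) + (\<Sum>S\<in>cons_sets V. g (Suc (card S))) + (\<Sum>S\<in>cons_sets V. g (Suc (card S)))
     = (\<Sum>k\<le>?c. real (?c choose k) * 2 ^ k * g k) + (\<Sum>k\<le>?c. real (?c choose k) * 2 ^ Suc k * g (Suc k))"
    using insert.IH[of g] insert.IH[of "\<lambda>k. g (Suc k)"] by (simp add: sum_distrib_left algebra_simps flip: sum.distrib)
  also have "(\<Sum>k\<le>?c. real (?c choose k) * 2 ^ k * g k) = g 0 + (\<Sum>k\<le>?c. real (?c choose Suc k) * 2 ^ Suc k * g (Suc k))"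
    using sum.atMost_Suc_shift[of "\<lambda>k. real (?c choose k) * 2 ^ k * g k" ?c]
    by (simp add: binomial_eq_0)
  also have "g 0 + (\<Sum>k\<le>?c. real (?c choose Suc k) * 2 ^ Suc k * g (Suc k)) + (\<Sum>k\<le>?c. real (?c choose k) * 2 ^ Suc k * g (Suc k))
     = g 0 + (\<Sum>k\<le>?c. real (Suc ?c choose Suc k) * 2 ^ Suc k * g (Suc k))"
    by (simp add: algebra_simps flip: sum.distrib)
  also have "\<dots> = (\<Sum>k\<le>Suc ?c. real (Suc ?c choose k) * 2 ^ k * g k)"
    by (subst sum.atMost_Suc_shift) simp
  finally show ?case using insert.hyps by simp
qed

lemma sum_cons_sets_root:
  assumes "finite V" "x \<in> lits V"
  shows "(\<Sum>S\<in>{S \<in> cons_sets V. x \<in> S}. g (card S))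
    = (\<Sum>k=1..card V. real ((card V - 1) choose (k - 1)) * 2 ^ (k - 1) * (g k :: real))"
proof -
  let ?W = "V - {var x}"
  have V: "V = insert (var x) ?W" using assms by (auto simp: lits_def)
  have c: "card V = Suc (card ?W)" using assms card.remove[of V "var x"] by (simp add: lits_def)
  have "(\<Sum>S\<in>{S \<in> cons_sets V. x \<in> S}. g (card S)) = (\<Sum>S\<in>insert x ` cons_sets ?W. g (card S))"
    by (subst V, subst cons_sets_insert_root) auto
  also have "\<dots> = (\<Sum>k\<le>card ?W. real (card ?W choose k) * 2 ^ k * g (Suc k))"
    using assms sum_cons_sets_insert[of ?W x g] sum_cons_sets[of ?W "\<lambda>k. g (Suc k)"] by simp
  also have "\<dots> = (\<Sum>k=1..card V. real ((card V - 1) choose (k - 1)) * 2 ^ (k - 1) * g k)"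
    by (rule sum.reindex_bij_witness[of _ "\<lambda>k. k - 1" Suc]) (use c in auto)
  finally show ?thesis .
qed

text \<open>\<open>Pk p m k\<close> is the probability that the out-cluster of a literal over \<open>m\<close> variables is consistent
  and has size \<open>k\<close>, \<open>contra_prob p m\<close> the probability that it is inconsistent. The value at
  \<open>m = 0\<close> is chosen to make \<open>contra_prob p\<close> monotone.\<close>

definition Pk :: "real \<Rightarrow> nat \<Rightarrow> nat \<Rightarrow> real" where
  "Pk p m k = real ((m - 1) choose (k - 1)) * 2 ^ (k - 1) * (reach_prob p k * (1 - p) ^ (2 * k * (m - k) + k * (k - 1) div 2))"

definition contra_prob :: "real \<Rightarrow> nat \<Rightarrow> real" where
  "contra_prob p m = (if m = 0 then 0 else 1 - (\<Sum>k=1..m. Pk p m k))"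

lemma Pr_out_cluster_clauses_on:
  assumes "finite V" "S \<in> cons_sets V" "x \<in> S"
  shows "Pr p (clauses_on V) (\<lambda>F. out_cluster F x = S)
    = reach_prob p (card S) * (1 - p) ^ (2 * card S * (card V - card S) + card S * (card S - 1) div 2)"
proof -
  have S: "consistent S" "S \<subseteq> lits V" using assms by (auto simp: cons_sets_def)
  show ?thesis
    using Pr_out_cluster_eq[OF finite_clauses_on[OF assms(1)] S(1) assms(3) inside_subset_clauses_on[OF S]]
      Pr_inside_eq_reach_prob[OF cons_sets_finite[OF assms(1,2)] S(1) assms(3)]
      card_bdry_clauses_on[OF S(1) assms(1) S(2) refl refl] by simp
qed

lemma sum_Pr_out_cluster:
  assumes "finite V" "x \<in> lits V"
  shows "(\<Sum>S\<in>{S \<in> cons_sets V. x \<in> S}. Pr p (clauses_on V) (\<lambda>F. out_cluster F x = S) * h (card S))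
    = (\<Sum>k=1..card V. Pk p (card V) k * h k)"
proof -
  have "(\<Sum>S\<in>{S \<in> cons_sets V. x \<in> S}. Pr p (clauses_on V) (\<lambda>F. out_cluster F x = S) * h (card S))
    = (\<Sum>S\<in>{S \<in> cons_sets V. x \<in> S}. (\<lambda>k. reach_prob p k * (1 - p) ^ (2 * k * (card V - k) + k * (k - 1) div 2) * h k) (card S))"
    by (rule sum.cong) (use assms Pr_out_cluster_clauses_on in auto)
  also have "\<dots> = (\<Sum>k=1..card V. Pk p (card V) k * h k)"
    by (subst sum_cons_sets_root[OF assms]) (simp add: Pk_def mult.assoc)
  finally show ?thesis .
qed

text \<open>The absence of a contradiction is partitioned by the consistent clusters, whose
  probabilities depend on their size alone. Therefore the value is the same for all
  literals.\<close>

lemma Pr_contradiction: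
  assumes "finite V" "x \<in> lits V"
  shows "Pr p (clauses_on V) (\<lambda>F. leads_to F x (neg x)) = contra_prob p (card V)"
proof -
  have "Pr p (clauses_on V) (\<lambda>F. \<not> leads_to F x (neg x))
    = (\<Sum>S\<in>{S \<in> cons_sets V. x \<in> S}. Pr p (clauses_on V) (\<lambda>F. out_cluster F x = S \<and> \<not> leads_to F x (neg x)))"
    by (rule Pr_partition, use finite_cons_sets[OF assms(1)] in simp)
      (use out_cluster_lits[OF _ assms(2)] consistent_out_cluster in \<open>auto simp: cons_sets_def\<close>)
  also have "\<dots> = (\<Sum>S\<in>{S \<in> cons_sets V. x \<in> S}. Pr p (clauses_on V) (\<lambda>F. out_cluster F x = S) * 1)"
    by (intro sum.cong refl) (auto intro!: Pr_cong simp: consistent_out_cluster[symmetric] cons_sets_def)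
  also have "\<dots> = (\<Sum>k=1..card V. Pk p (card V) k)"
    using sum_Pr_out_cluster[OF assms, of p "\<lambda>_. 1"] by simp
  finally show ?thesis
    using assms Pr_not[OF finite_clauses_on[OF assms(1)], of p "\<lambda>F. leads_to F x (neg x)"] by (auto simp: contra_prob_def lits_def)
qed

section \<open>A second contradiction outside the cluster of the first literal\<close>

text \<open>Whether the cluster of \<open>x\<close> is \<open>S\<close> is decided by
  \<open>inside S\<close> and the boundary of \<open>S\<close>, where every clause contains a
  variable of \<open>S\<close>. The clauses over the other variables are independent of them, and a
  contradiction of \<open>y\<close> found there persists in the whole formula.\<close>

lemma Pr_cluster_eq_conj_ge:
  assumes p: "0 \<le> p" "p \<le> 1" and "finite V" "S \<in> cons_sets V" "x \<in> S" "y \<in> lits V" "var y \<notin> var ` S"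
  shows "Pr p (clauses_on V) (\<lambda>F. out_cluster F x = S) * contra_prob p (card V - card S)
    \<le> Pr p (clauses_on V) (\<lambda>F. out_cluster F x = S \<and> leads_to F y (neg y))"
proof -
  let ?D = "inside S \<union> bdry (clauses_on V) S" and ?G = "clauses_on (V - var ` S)"
  have S: "consistent S" "S \<subseteq> lits V" "finite S" using assms cons_sets_finite by (auto simp: cons_sets_def)
  have sub: "?D \<subseteq> clauses_on V" "?G \<subseteq> clauses_on V"
    using inside_subset_clauses_on[OF S(1,2)] clauses_on_mono[of "V - var ` S" V] by (auto simp: bdry_def)
  have "{neg w, z} \<notin> ?G" if "w \<in> S" for w z using that by (simp add: clauses_on_pair)
  then have disj: "?D \<inter> ?G = {}" unfolding inside_def bdry_def by blast
  have fin: "finite (clauses_on V)" using assms by (intro finite_clauses_on)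
  have local: "out_cluster F x = S \<longleftrightarrow> out_cluster (F \<inter> ?D) x = S" if "F \<subseteq> clauses_on V" for F
    by (rule out_cluster_eq_local) (use that assms in auto)
  have "card (V - var ` S) = card V - card S"
    using S assms by (subst card_Diff_subset) (auto simp: lits_def card_image inj_on_var)
  then have "contra_prob p (card V - card S) = Pr p ?G (\<lambda>F. leads_to F y (neg y))"
    using Pr_contradiction[of "V - var ` S" y p] assms by (simp add: lits_def)
  moreover have "Pr p (clauses_on V) (\<lambda>F. out_cluster F x = S) = Pr p ?D (\<lambda>F. out_cluster F x = S)"
    unfolding Pr_restrict[OF fin sub(1), of p "\<lambda>F. out_cluster F x = S", symmetric]
    by (rule Pr_cong) (rule local)
  ultimately have "Pr p (clauses_on V) (\<lambda>F. out_cluster F x = S) * contra_prob p (card V - card S)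
     = Pr p (clauses_on V) (\<lambda>F. out_cluster (F \<inter> ?D) x = S \<and> leads_to (F \<inter> ?G) y (neg y))"
    using Pr_indep[OF fin sub disj, of p "\<lambda>F. out_cluster F x = S" "\<lambda>F. leads_to F y (neg y)"] by simp
  also have "\<dots> \<le> Pr p (clauses_on V) (\<lambda>F. out_cluster F x = S \<and> leads_to F y (neg y))"
  proof (rule Pr_mono[OF p])
    fix F assume F: "F \<subseteq> clauses_on V"
      and h: "out_cluster (F \<inter> ?D) x = S \<and> leads_to (F \<inter> ?G) y (neg y)"
    have "leads_to F y (neg y)" by (rule leads_to_mono[of "F \<inter> ?G"]) (use h in auto)
    then show "out_cluster F x = S \<and> leads_to F y (neg y)" using h local[OF F] by simp
  qed
  finally show ?thesis .
qed

text \<open>The ratio (m-k)/(m-1) is the fraction of the consistent sets of size \<open>k\<close>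
  around \<open>x\<close> that avoid the variable of another given literal.\<close>

lemma choose_pred_mult: "1 \<le> k \<Longrightarrow> k \<le> m \<Longrightarrow> 2 \<le> m \<Longrightarrow>
    real (m - 1) * real ((m - 2) choose (k - 1)) = real (m - k) * real ((m - 1) choose (k - 1))"
  using arg_cong[OF binomial_absorb_comp[of "m - 1" "k - 1"], of real]
  by (simp add: diff_diff_eq numeral_2_eq_2 of_nat_diff)

text \<open>The contradictions of \<open>y\<close> are split by whether \<open>x\<close> is
  contradictory too. If it is not, its cluster is consistent; when that cluster has size
  \<open>k\<close> and avoids the variable of \<open>y\<close>, the conditional probability of a
  contradiction of \<open>y\<close> is at least \<open>contra_prob p (m - k)\<close>.\<close>

lemma Pr_two_contradictions_le:
  assumes p: "0 \<le> p" "p \<le> 1" and "finite V" "x \<in> lits V" "y \<in> lits V" "var x \<noteq> var y" "card V = m"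
  shows "Pr p (clauses_on V) (\<lambda>F. leads_to F x (neg x) \<and> leads_to F y (neg y))
    \<le> contra_prob p m - (\<Sum>k=1..m. Pk p m k * (real (m - k) / real (m - 1)) * contra_prob p (m - k))"
proof -
  let ?V' = "V - {var y}"
  let ?I = "{S \<in> cons_sets V. x \<in> S}" and ?I' = "{S \<in> cons_sets ?V'. x \<in> S}"
  let ?h = "\<lambda>k. reach_prob p k * (1 - p) ^ (2 * k * (m - k) + k * (k - 1) div 2) * contra_prob p (m - k)"
  have "card {var x, var y} \<le> card V" using assms by (intro card_mono) (auto simp: lits_def)
  then have m2: "m \<ge> 2" using assms by simp
  have finI: "finite ?I" using assms finite_cons_sets by simp
  have cV': "card ?V' = m - 1" using assms by (auto simp: lits_def)
  have xV': "x \<in> lits ?V'" using assms by (auto simp: lits_def)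
  have I': "?I' = {S \<in> ?I. var y \<notin> var ` S}" unfolding cons_sets_def lits_def by (auto simp: image_iff)
  have "(\<Sum>k=1..m. Pk p m k * (real (m - k) / real (m - 1)) * contra_prob p (m - k))
      = (\<Sum>k=1..m. real ((m - 2) choose (k - 1)) * 2 ^ (k - 1) * ?h k)"
  proof (rule sum.cong[OF refl])
    fix k assume "k \<in> {1..m}"
    then have "real ((m - 1) choose (k - 1)) * (real (m - k) / real (m - 1)) = real ((m - 2) choose (k - 1))"
      using choose_pred_mult[of k m] m2 by (simp add: field_simps)
    from this[symmetric] show "Pk p m k * (real (m - k) / real (m - 1)) * contra_prob p (m - k)
        = real ((m - 2) choose (k - 1)) * 2 ^ (k - 1) * ?h k"
      unfolding Pk_def by (simp only: mult_ac)
  qed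
  also have "\<dots> = (\<Sum>k=1..m - 1. real ((m - 2) choose (k - 1)) * 2 ^ (k - 1) * ?h k)"
  proof -
    \<comment> \<open>The term \<open>k = m\<close> drops out because of the value
      \<open>contra_prob p 0 = 0\<close>.\<close>
    have "{1..m} = insert m {1..m - 1}" using m2 by auto
    then show ?thesis using m2 by (simp add: contra_prob_def)
  qed
  also have "\<dots> = (\<Sum>S\<in>?I'. ?h (card S))"
    using sum_cons_sets_root[OF _ xV', of ?h] cV' assms(3) m2 by (simp add: numeral_2_eq_2)
  also have "\<dots> = (\<Sum>S\<in>?I'. Pr p (clauses_on V) (\<lambda>F. out_cluster F x = S) * contra_prob p (m - card S))"
    by (rule sum.cong) (use assms I' Pr_out_cluster_clauses_on in auto)
  also have "\<dots> \<le> (\<Sum>S\<in>?I'. Pr p (clauses_on V) (\<lambda>F. out_cluster F x = S \<and> leads_to F y (neg y)))"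
    unfolding I' by (rule sum_mono) (use Pr_cluster_eq_conj_ge[OF p assms(3)] assms in auto)
  also have "\<dots> \<le> (\<Sum>S\<in>?I. Pr p (clauses_on V) (\<lambda>F. out_cluster F x = S \<and> leads_to F y (neg y)))"
    by (rule sum_mono2) (use finI I' Pr_nonneg[OF p] in auto)
  also have "\<dots> = (\<Sum>S\<in>?I. Pr p (clauses_on V) (\<lambda>F. out_cluster F x = S \<and> (leads_to F y (neg y) \<and> \<not> leads_to F x (neg x))))"
    by (intro sum.cong refl) (auto intro!: Pr_cong simp: consistent_out_cluster[symmetric] cons_sets_def)
  also have "\<dots> = Pr p (clauses_on V) (\<lambda>F. leads_to F y (neg y) \<and> \<not> leads_to F x (neg x))"
    by (rule Pr_partition[symmetric], rule finI)
      (use out_cluster_lits[OF _ assms(4)] consistent_out_cluster in \<open>auto simp: cons_sets_def\<close>)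
  also have "\<dots> = contra_prob p m - Pr p (clauses_on V) (\<lambda>F. leads_to F y (neg y) \<and> leads_to F x (neg x))"
    using Pr_split[of p "clauses_on V" "\<lambda>F. leads_to F y (neg y)" "\<lambda>F. leads_to F x (neg x)"]
      Pr_contradiction[OF assms(3,5)] assms(7) by simp
  finally show ?thesis by (simp add: conj_commute)
qed

section \<open>The effect of one additional variable\<close>

lemma consistent_out_cluster_extend:
  assumes F: "F \<subseteq> clauses_on (insert v V)" and "v \<notin> V" "y \<in> lits V" "var l = v"
    and S: "S = out_cluster (F \<inter> clauses_on V) y" "consistent S"
    and nh: "\<And>w. w \<in> S \<Longrightarrow> {neg w, neg l} \<notin> F"
    and T: "T = out_cluster (F \<inter> clauses_on (insert v V - var ` S)) l" "consistent T"
  shows "consistent (out_cluster F y)"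
proof -
  have SV: "S \<subseteq> lits V" unfolding S(1) by (rule out_cluster_lits) (use assms in auto)
  have vS: "v \<notin> var ` S" using SV assms(2) by (auto simp: lits_def)
  have TV: "T \<subseteq> lits (insert v V - var ` S)"
    unfolding T(1) by (rule out_cluster_lits) (use assms(4) vS in \<open>auto simp: lits_def\<close>)
  have lT: "l \<in> T" unfolding T(1) by simp
  have cF: "var a \<noteq> var b \<and> var a \<in> insert v V \<and> var b \<in> insert v V" if "{a, b} \<in> F" for a b
    using that F clauses_on_pair[of a b "insert v V"] by auto
  have Sstep: "z \<in> S \<or> z = l" if "w \<in> S" "{neg w, z} \<in> F" for w z
  proof (cases "var z = v")
    case True
    then show ?thesis using nh[OF that(1)] that(2) assms(4) by (auto simp: var_eq_iff)
  next
    case False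
    then have "{neg w, z} \<in> F \<inter> clauses_on V" using that cF[OF that(2)] SV by (auto simp: clauses_on_pair lits_def)
    then show ?thesis using that(1) S(1) out_cluster_step by blast
  qed
  have "out_cluster F y \<subseteq> S \<union> T"
  proof (rule out_cluster_subset)
    show "y \<in> S \<union> T" unfolding S(1) by simp
    fix w z assume w: "w \<in> S \<union> T" and e: "{neg w, z} \<in> F"
    show "z \<in> S \<union> T"
    proof (cases "w \<in> S")
      case True
      then show ?thesis using Sstep e lT by auto
    next
      case False
      then have wT: "w \<in> T" using w by simp
      show ?thesis
      proof (cases "var z \<in> var ` S")
        case True
        then obtain s where s: "s \<in> S" "z = s \<or> z = neg s" by (auto simp: var_eq_iff)
        show ?thesis
        proof (cases "z = s")
          case False
          \<comment> \<open>An edge from \<open>T\<close> to the negation of a member of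
            \<open>S\<close> is, reversed, an edge from \<open>S\<close> to \<open>neg w\<close>.
            Such an edge ends in \<open>S\<close> or at \<open>l\<close>; the first is impossible as
            the variables of \<open>T\<close> avoid \<open>S\<close>, the second as \<open>T\<close>
            is consistent.\<close>
          then have "{neg s, neg w} \<in> F" using s e by (simp add: insert_commute)
          then have "neg w \<in> S \<or> neg w = l" using Sstep s by blast
          moreover have "var w \<notin> var ` S" using wT TV by (force simp: lits_def)
          then have "neg w \<notin> S" by (metis imageI var_neg)
          moreover have "neg w \<noteq> l" using wT lT T(2) by (auto simp: consistent_def)
          ultimately show ?thesis by blast
        qed (use s in auto)
      next
        case False
        then have "{neg w, z} \<in> F \<inter> clauses_on (insert v V - var ` S)"
          using e cF[OF e] wT TV by (auto simp: clauses_on_pair lits_def)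
        then show ?thesis using wT T(1) out_cluster_step by blast
      qed
    qed
  qed
  moreover have "consistent (S \<union> T)"
    unfolding consistent_def
  proof safe
    fix z
    { assume "z \<in> S" "neg z \<in> S" then show False using S(2) by (auto simp: consistent_def) }
    { assume "z \<in> T" "neg z \<in> T" then show False using T(2) by (auto simp: consistent_def) }
    { assume z: "z \<in> S" "neg z \<in> T"
      then have "var z \<notin> var ` S" using TV by (force simp: lits_def)
      then show False using z by blast }
    { assume z: "z \<in> T" "neg z \<in> S"
      then have "var (neg z) \<notin> var ` S" using TV by (force simp: lits_def)
      then show False using z by blast }
  qed
  ultimately show ?thesis by (auto simp: consistent_def)
qed

text \<open>If \<open>S\<close> enters no literal of \<open>v\<close>, the cluster does not grow. If
  \<open>S\<close> enters exactly one, the extended cluster remains consistent unless that literal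
  is contradictory over the variables outside \<open>S\<close>.\<close>

lemma leads_to_extend_cases:
  assumes F: "F \<subseteq> clauses_on (insert v V)" and "v \<notin> V" "y \<in> lits V" "var l = v"
    and S: "S = out_cluster (F \<inter> clauses_on V) y" "consistent S"
    and A: "leads_to F y (neg y)"
  defines "H \<equiv> \<lambda>l. \<exists>w\<in>S. {neg w, l} \<in> F"
    and "B \<equiv> \<lambda>l. leads_to (F \<inter> clauses_on (insert v V - var ` S)) l (neg l)"
  shows "H l \<and> H (neg l) \<or> H l \<and> B l \<or> H (neg l) \<and> B (neg l)"
proof (rule ccontr)
  assume n: "\<not> ?thesis"
  have nc: "\<not> consistent (out_cluster F y)" using A by (simp add: consistent_out_cluster)
  have SV: "S \<subseteq> lits V" unfolding S(1) by (rule out_cluster_lits) (use assms in auto)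
  have ext: "\<not> H (neg l') \<Longrightarrow> B l'" if "var l' = v" for l'
  proof (rule ccontr)
    assume h: "\<not> H (neg l')" "\<not> B l'"
    have "consistent (out_cluster F y)"
      by (rule consistent_out_cluster_extend[OF F assms(2,3) that S _ refl])
        (use h in \<open>auto simp: H_def B_def consistent_out_cluster\<close>)
    then show False using nc by simp
  qed
  have "H l \<or> H (neg l)"
  proof (rule ccontr)
    assume h: "\<not> (H l \<or> H (neg l))"
    have "out_cluster F y \<subseteq> S"
    proof (rule out_cluster_subset)
      show "y \<in> S" unfolding S(1) by simp
      fix w z assume wz: "w \<in> S" "{neg w, z} \<in> F"
      then have "z \<noteq> l" "z \<noteq> neg l" using h by (auto simp: H_def)
      then have "var z \<noteq> v" using assms(4) by (auto simp: var_eq_iff)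
      then have "{neg w, z} \<in> F \<inter> clauses_on V" using wz F SV clauses_on_pair[of "neg w" z "insert v V"]
        by (auto simp: clauses_on_pair lits_def)
      then show "z \<in> S" using wz(1) S(1) out_cluster_step by blast
    qed
    then show False using nc S(2) by (auto simp: consistent_def)
  qed
  then show False using n ext[of l] ext[of "neg l"] assms(4) by auto
qed

text \<open>Four disjoint families of clauses are involved: \<open>?D\<close> decides that the old
  cluster is \<open>S\<close>, \<open>J ?l\<close> and \<open>J (neg ?l)\<close> join
  \<open>S\<close> to the two new literals, and \<open>?G\<close> lives on the variables outside
  \<open>S\<close>. So each of the three cases of \<open>leads_to_extend_cases\<close> has a product
  probability, and a union bound adds them.\<close>

lemma Pr_new_contradiction_le:
  assumes p: "0 \<le> p" "p \<le> 1" and fV: "finite V" and "v \<notin> V" "S \<in> cons_sets V" "y \<in> S"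
    and k: "card S = k" and m: "card V = m"
  shows "Pr p (clauses_on (insert v V)) (\<lambda>F. out_cluster (F \<inter> clauses_on V) y = S \<and> leads_to F y (neg y))
    \<le> Pr p (clauses_on V) (\<lambda>F. out_cluster F y = S) * ((real k * p)\<^sup>2 + 2 * real k * p * contra_prob p (Suc m - k))"
proof -
  let ?V' = "insert v V"
  let ?D = "inside S \<union> bdry (clauses_on V) S" and ?G = "clauses_on (?V' - var ` S)"
  define J where "J = (\<lambda>l. (\<lambda>w. {neg w, l}) ` S)"
  let ?l = "Pos v"
  let ?a = "Pr p (clauses_on V) (\<lambda>F. out_cluster F y = S)"
  have S: "consistent S" "S \<subseteq> lits V" "finite S" using assms cons_sets_finite by (auto simp: cons_sets_def)
  have fin: "finite (clauses_on ?V')" using fV by (simp add: finite_clauses_on)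
  have vS: "v \<notin> var ` S" using S(2) assms(4) by (auto simp: lits_def)
  have vw: "var w \<in> V \<and> var w \<noteq> v" if "w \<in> S" for w using S(2) assms(4) that by (auto simp: lits_def)
  have DV: "?D \<subseteq> clauses_on V" using inside_subset_clauses_on[OF S(1,2)] by (auto simp: bdry_def)
  have subD: "?D \<subseteq> clauses_on ?V'" using DV clauses_on_mono[of V ?V'] by auto
  have subG: "?G \<subseteq> clauses_on ?V'" by (rule clauses_on_mono) auto
  have subJ: "J l \<subseteq> clauses_on ?V'" if "var l = v" for l
    using vw that by (auto simp: J_def clauses_on_pair)
  have nG: "{neg w, z} \<notin> ?G" if "w \<in> S" for w z using that by (simp add: clauses_on_pair)
  have DG: "?D \<inter> ?G = {}" using nG unfolding inside_def bdry_def by blast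
  have JG: "J l \<inter> ?G = {}" for l using nG unfolding J_def by blast
  have DJ: "?D \<inter> J l = {}" if "var l = v" for l
  proof -
    have "J l \<inter> clauses_on V = {}" using assms(4) that by (auto simp: J_def clauses_on_pair)
    then show ?thesis using DV by blast
  qed
  have JJ: "J ?l \<inter> J (neg ?l) = {}"
  proof -
    have "{neg a, ?l} \<noteq> {neg b, neg ?l}" if "a \<in> S" "b \<in> S" for a b
      using vw[OF that(1)] vw[OF that(2)] by (cases a; cases b) (auto simp: doubleton_eq_iff)
    then show ?thesis by (auto simp: J_def)
  qed
  have hit: "(\<exists>w\<in>S. {neg w, l} \<in> F) \<longleftrightarrow> F \<inter> J l \<noteq> {}" for F l by (auto simp: J_def)
  have PJ: "Pr p (J l) (\<lambda>F. F \<noteq> {}) \<le> k * p" for l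
  proof -
    have "Pr p (J l) (\<lambda>F. F \<noteq> {}) \<le> real (card (J l)) * p"
      by (rule Pr_hit_le[OF p]) (use S in \<open>simp add: J_def\<close>)
    also have "\<dots> \<le> k * p"
      using p card_image_le[OF S(3), of "\<lambda>w. {neg w, l}"] k by (intro mult_right_mono) (auto simp: J_def)
    finally show ?thesis .
  qed
  have PG: "Pr p ?G (\<lambda>F. leads_to F l (neg l)) = contra_prob p (Suc m - k)" if "var l = v" for l
  proof -
    have "card (?V' - var ` S) = Suc m - k"
      using S fV assms(4) k m by (subst card_Diff_subset) (auto simp: lits_def card_image inj_on_var)
    then show ?thesis
      using Pr_contradiction[of "?V' - var ` S" l p] fV vS that by (simp add: lits_def)
  qed
  have u0: "0 \<le> contra_prob p (Suc m - k)" using PG[of ?l] Pr_nonneg[OF p] by (metis var.simps(1))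
  have a0: "0 \<le> ?a" by (rule Pr_nonneg[OF p])
  have loc: "out_cluster F y = S \<longleftrightarrow> out_cluster (F \<inter> ?D) y = S" if "F \<subseteq> clauses_on V" for F
    by (rule out_cluster_eq_local) (use that assms in auto)
  have PD: "Pr p ?D (\<lambda>F. out_cluster F y = S) = ?a"
    unfolding Pr_restrict[OF finite_clauses_on[OF fV] DV, of p "\<lambda>F. out_cluster F y = S", symmetric]
    by (rule Pr_cong[symmetric]) (rule loc)
  let ?o = "\<lambda>F. out_cluster (F \<inter> ?D) y = S"
  let ?A1 = "\<lambda>F. ?o F \<and> F \<inter> J ?l \<noteq> {} \<and> F \<inter> J (neg ?l) \<noteq> {}"
  let ?A2 = "\<lambda>l F. ?o F \<and> F \<inter> J l \<noteq> {} \<and> leads_to (F \<inter> ?G) l (neg l)"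
  have "Pr p (clauses_on ?V') (\<lambda>F. out_cluster (F \<inter> clauses_on V) y = S \<and> leads_to F y (neg y))
    \<le> Pr p (clauses_on ?V') (\<lambda>F. ?A1 F \<or> (?A2 ?l F \<or> ?A2 (neg ?l) F))"
  proof (rule Pr_mono[OF p])
    fix F assume F: "F \<subseteq> clauses_on ?V'" and h: "out_cluster (F \<inter> clauses_on V) y = S \<and> leads_to F y (neg y)"
    have yV: "y \<in> lits V" using S(2) assms(6) by auto
    have "F \<inter> clauses_on V \<inter> ?D = F \<inter> ?D" using DV by auto
    then have "?o F" using loc[of "F \<inter> clauses_on V"] h by simp
    moreover have "(F \<inter> J ?l \<noteq> {} \<and> F \<inter> J (neg ?l) \<noteq> {}) \<or> (F \<inter> J ?l \<noteq> {} \<and> leads_to (F \<inter> ?G) ?l (neg ?l))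
       \<or> (F \<inter> J (neg ?l) \<noteq> {} \<and> leads_to (F \<inter> ?G) (neg ?l) (neg (neg ?l)))"
      unfolding hit[symmetric]
      by (rule leads_to_extend_cases[OF F assms(4) yV _ _ S(1)]) (use h in auto)
    ultimately show "?A1 F \<or> (?A2 ?l F \<or> ?A2 (neg ?l) F)" by blast
  qed
  also have "\<dots> \<le> Pr p (clauses_on ?V') ?A1 + (Pr p (clauses_on ?V') (?A2 ?l) + Pr p (clauses_on ?V') (?A2 (neg ?l)))"
    using Pr_disj_le[OF p, of "clauses_on ?V'" ?A1 "\<lambda>F. ?A2 ?l F \<or> ?A2 (neg ?l) F"]
      Pr_disj_le[OF p, of "clauses_on ?V'" "?A2 ?l" "?A2 (neg ?l)"] by linarith
  also have "Pr p (clauses_on ?V') ?A1 = ?a * Pr p (J ?l) (\<lambda>F. F \<noteq> {}) * Pr p (J (neg ?l)) (\<lambda>F. F \<noteq> {})"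
    unfolding PD[symmetric]
    by (rule Pr_indep3[OF fin subD subJ subJ DJ DJ JJ]) auto
  also have "\<dots> \<le> ?a * (k * p) * (k * p)"
    by (intro mult_mono mult_nonneg_nonneg PJ a0 Pr_nonneg[OF p]) (use p in auto)
  also have "Pr p (clauses_on ?V') (?A2 ?l) = ?a * Pr p (J ?l) (\<lambda>F. F \<noteq> {}) * contra_prob p (Suc m - k)"
    unfolding PD[symmetric] PG[of ?l, symmetric, simplified var.simps, OF refl]
    by (rule Pr_indep3[OF fin subD subJ subG DJ DG JG]) auto
  also have "\<dots> \<le> ?a * (k * p) * contra_prob p (Suc m - k)"
    by (intro mult_mono mult_nonneg_nonneg PJ a0 u0 Pr_nonneg[OF p]) (use p in auto)
  also have "Pr p (clauses_on ?V') (?A2 (neg ?l)) = ?a * Pr p (J (neg ?l)) (\<lambda>F. F \<noteq> {}) * contra_prob p (Suc m - k)"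
    unfolding PD[symmetric] PG[of "neg ?l", symmetric, simplified neg.simps var.simps, OF refl] neg.simps
    by (rule Pr_indep3[OF fin subD subJ subG DJ DG JG]) auto
  also have "\<dots> \<le> ?a * (k * p) * contra_prob p (Suc m - k)"
    by (intro mult_mono mult_nonneg_nonneg PJ a0 u0 Pr_nonneg[OF p]) (use p in auto)
  finally show ?thesis by (simp add: algebra_simps power2_eq_square)
qed

text \<open>Restricting a formula on \<open>Suc m\<close> variables to the first \<open>m\<close>
  couples the two probabilities. The increment is the probability that the contradiction appears
  only with the last variable, and it is split by the consistent cluster that is present
  before.\<close>

lemma contra_prob_Suc_diff:
  assumes p: "0 \<le> p" "p \<le> 1" and "1 \<le> m"
  shows "contra_prob p m \<le> contra_prob p (Suc m)"
    "contra_prob p (Suc m) - contra_prob p m \<le> (\<Sum>k=1..m. Pk p m k * ((real k * p)\<^sup>2 + 2 * real k * p * contra_prob p (Suc m - k)))"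
proof -
  let ?V = "{1..m}" and ?V' = "insert (Suc m) {1..m}" and ?y = "Pos 1"
  let ?A = "\<lambda>F. leads_to F ?y (neg ?y)"
  let ?I = "{S \<in> cons_sets ?V. ?y \<in> S}"
  have fin: "finite (clauses_on ?V')" by (rule finite_clauses_on) simp
  have sub: "clauses_on ?V \<subseteq> clauses_on ?V'" by (rule clauses_on_mono) auto
  have y: "?y \<in> lits ?V" "?y \<in> lits ?V'" using assms by (auto simp: lits_def)
  have 1: "Pr p (clauses_on ?V') ?A = contra_prob p (Suc m)" using Pr_contradiction[OF _ y(2), of p] by simp
  have 2: "Pr p (clauses_on ?V') (\<lambda>F. ?A (F \<inter> clauses_on ?V)) = contra_prob p m"
    using Pr_restrict[OF fin sub, of p ?A] Pr_contradiction[OF _ y(1), of p] by simp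
  have m: "?A F" if "?A (F \<inter> clauses_on ?V)" for F by (rule leads_to_mono[OF _ that]) auto
  show "contra_prob p m \<le> contra_prob p (Suc m)" unfolding 1[symmetric] 2[symmetric] by (rule Pr_mono[OF p m])
  have 3: "contra_prob p (Suc m) - contra_prob p m = Pr p (clauses_on ?V') (\<lambda>F. ?A F \<and> \<not> ?A (F \<inter> clauses_on ?V))"
  proof -
    have "Pr p (clauses_on ?V') (\<lambda>F. ?A F \<and> ?A (F \<inter> clauses_on ?V)) = contra_prob p m"
      unfolding 2[symmetric] by (rule Pr_cong) (use m in blast)
    then show ?thesis
      using Pr_split[of p "clauses_on ?V'" ?A "\<lambda>F. ?A (F \<inter> clauses_on ?V)"] 1 by linarith
  qed
  have "Pr p (clauses_on ?V') (\<lambda>F. ?A F \<and> \<not> ?A (F \<inter> clauses_on ?V))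
    = (\<Sum>S\<in>?I. Pr p (clauses_on ?V') (\<lambda>F. out_cluster (F \<inter> clauses_on ?V) ?y = S \<and> (?A F \<and> \<not> ?A (F \<inter> clauses_on ?V))))"
  proof (rule Pr_partition)
    show "finite ?I" using finite_cons_sets[of ?V] by simp
    fix F assume "?A F \<and> \<not> ?A (F \<inter> clauses_on ?V)"
    then have "consistent (out_cluster (F \<inter> clauses_on ?V) ?y)" by (simp add: consistent_out_cluster)
    moreover have "out_cluster (F \<inter> clauses_on ?V) ?y \<subseteq> lits ?V" by (rule out_cluster_lits[OF _ y(1)]) simp
    ultimately show "out_cluster (F \<inter> clauses_on ?V) ?y \<in> ?I" by (simp add: cons_sets_def)
  qed
  also have "\<dots> \<le> (\<Sum>S\<in>?I. Pr p (clauses_on ?V) (\<lambda>F. out_cluster F ?y = S)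
      * ((real (card S) * p)\<^sup>2 + 2 * real (card S) * p * contra_prob p (Suc m - card S)))"
  proof (rule sum_mono)
    fix S assume "S \<in> ?I"
    then have S: "S \<in> cons_sets ?V" "?y \<in> S" by auto
    have "Pr p (clauses_on ?V') (\<lambda>F. out_cluster (F \<inter> clauses_on ?V) ?y = S \<and> (?A F \<and> \<not> ?A (F \<inter> clauses_on ?V)))
      \<le> Pr p (clauses_on ?V') (\<lambda>F. out_cluster (F \<inter> clauses_on ?V) ?y = S \<and> ?A F)"
      by (rule Pr_mono[OF p]) auto
    also have "\<dots> \<le> Pr p (clauses_on ?V) (\<lambda>F. out_cluster F ?y = S) * ((real (card S) * p)\<^sup>2 + 2 * real (card S) * p * contra_prob p (Suc m - card S))"
      by (rule Pr_new_contradiction_le[OF p _ _ S refl]) simp_all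
    finally show "Pr p (clauses_on ?V') (\<lambda>F. out_cluster (F \<inter> clauses_on ?V) ?y = S \<and> (?A F \<and> \<not> ?A (F \<inter> clauses_on ?V)))
      \<le> Pr p (clauses_on ?V) (\<lambda>F. out_cluster F ?y = S) * ((real (card S) * p)\<^sup>2 + 2 * real (card S) * p * contra_prob p (Suc m - card S))" .
  qed
  also have "\<dots> = (\<Sum>k=1..m. Pk p m k * ((real k * p)\<^sup>2 + 2 * real k * p * contra_prob p (Suc m - k)))"
    using sum_Pr_out_cluster[OF _ y(1), of p "\<lambda>k. (real k * p)\<^sup>2 + 2 * real k * p * contra_prob p (Suc m - k)"] by simp
  finally show "contra_prob p (Suc m) - contra_prob p m \<le> (\<Sum>k=1..m. Pk p m k * ((real k * p)\<^sup>2 + 2 * real k * p * contra_prob p (Suc m - k)))"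
    unfolding 3 .
qed

text \<open>The recursion does not show the sign; it is read off from a realisation as a
  probability, on \<open>N\<close> positive literals.\<close>

lemma reach_prob_nonneg:
  assumes "0 \<le> p" "p \<le> 1" "1 \<le> N"
  shows "0 \<le> reach_prob p N"
proof -
  let ?S = "Pos ` {..<N}"
  have "card ?S = N" by (simp add: card_image inj_on_def)
  moreover have "consistent ?S" by (auto simp: consistent_def)
  moreover have "Pos 0 \<in> ?S" using assms by auto
  ultimately have "reach_prob p N = Pr p (inside ?S) (\<lambda>F. out_cluster F (Pos 0) = ?S)"
    using Pr_inside_eq_reach_prob[of ?S "Pos 0" p] by simp
  then show ?thesis using Pr_nonneg[OF assms(1,2)] by metis
qed

lemma contra_prob_nonneg: "0 \<le> p \<Longrightarrow> p \<le> 1 \<Longrightarrow> 0 \<le> contra_prob p m"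
  using Pr_contradiction[of "{1..m}" "Pos 1" p] Pr_nonneg[of p "clauses_on {1..m}"]
  by (cases "m = 0") (simp_all add: contra_prob_def[of p 0] lits_def, metis)

section \<open>Cluster sizes\<close>

text \<open>\<open>Qk p N\<close> is the distribution of the out-cluster size in a random digraph on \<open>N\<close> vertices.\<close>

definition Qk :: "real \<Rightarrow> nat \<Rightarrow> nat \<Rightarrow> real" where
  "Qk p N k = real ((N - 1) choose (k - 1)) * (reach_prob p k * (1 - p) ^ (k * (N - k)))"

lemma sum_Qk:
  assumes "1 \<le> N"
  shows "(\<Sum>k=1..N. Qk p N k) = 1"
proof -
  have "{1..N} = insert N {1..<N}" using assms by auto
  then have "(\<Sum>k=1..N. Qk p N k) = reach_prob p N + (\<Sum>k\<in>{1..<N}. Qk p N k)" by (simp add: Qk_def)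
  then show ?thesis unfolding Qk_def by (subst (asm) reach_prob.simps) (simp add: mult.assoc)
qed

text \<open>Here \<open>N\<close> enters each factor as a real number, so that different numbers of
  vertices can be compared factor by factor.\<close>

lemma real_choose_eq_prod:
  "1 \<le> N \<Longrightarrow> 1 \<le> k \<Longrightarrow> real ((N - 1) choose (k - 1)) = (\<Prod>i\<in>{1..<k}. real N - real i) / fact (k - 1)"
proof -
  assume a: "1 \<le> N" "1 \<le> k"
  have "real ((N - 1) choose (k - 1)) = (\<Prod>i\<in>{0..<k - 1}. real (N - 1) - real i) / fact (k - 1)"
    by (simp only: binomial_gbinomial gbinomial_prod_rev)
  also have "(\<Prod>i\<in>{0..<k - 1}. real (N - 1) - real i) = (\<Prod>i\<in>{1..<k}. real N - real i)"
    by (rule prod.reindex_bij_witness[of _ "\<lambda>i. i - 1" Suc]) (use a in auto)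
  finally show ?thesis .
qed

section \<open>Elementary inequalities\<close>

text \<open>Near 0, ln (1 + 2u) - ln (1 + u) is about u - 3/2 u^2, so the bound u - u^2 has some
  slack. The range down to -1/2, where the left-hand side vanishes, admits
  \<open>u = d / 2 - p * i\<close> for all factors of \<open>Pk\<close>, also when
  \<open>p * i\<close> is not small.\<close>

lemma one_plus_double_le:
  fixes u :: real
  assumes "- (1 / 2) \<le> u" "u \<le> 1 / 8"
  shows "1 + 2 * u \<le> (1 + u) * exp (u - u\<^sup>2)"
proof (cases "u = - (1 / 2)")
  case True
  then show ?thesis by simp
next
  case False
  then have u: "- (1 / 2) < u" using assms by simp
  define f where "f = (\<lambda>x::real. x - x\<^sup>2 + ln (1 + x) - ln (1 + 2 * x))"
  \<comment> \<open>On the given range the quadratic factor is nonnegative, so \<open>f'\<close> has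
    the sign of its argument and \<open>f\<close> is smallest at 0, where it vanishes.\<close>
  define f' where "f' = (\<lambda>x::real. x * (1 - 4 * x - 4 * x\<^sup>2) / ((1 + x) * (1 + 2 * x)))"
  have D: "(f has_real_derivative f' x) (at x)" if "- (1 / 2) < x" for x
  proof -
    have "(f has_real_derivative (1 - 2 * x + 1 / (1 + x) - 2 / (1 + 2 * x))) (at x)"
      unfolding f_def using that by (auto intro!: derivative_eq_intros simp: divide_simps)
    moreover have "1 - 2 * x + 1 / (1 + x) - 2 / (1 + 2 * x) = f' x"
    proof -
      have "1 + x \<noteq> 0" "1 + 2 * x \<noteq> 0" using that by auto
      then show ?thesis unfolding f'_def by (simp add: divide_simps) (simp add: algebra_simps power2_eq_square power3_eq_cube)
    qed
    ultimately show ?thesis by simp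
  qed
  have q: "1 - 4 * x - 4 * x\<^sup>2 \<ge> 0" if "- (1 / 2) \<le> x" "x \<le> 1 / 8" for x :: real
  proof -
    have "0 \<le> (x + 1 / 2) * (1 / 8 - x)" using that by (intro mult_nonneg_nonneg) auto
    then show ?thesis using that by (simp add: algebra_simps power2_eq_square)
  qed
  have "f 0 \<le> f u"
  proof (cases "0 \<le> u")
    case True
    show ?thesis
    proof (rule DERIV_nonneg_imp_nondecreasing[OF True])
      fix x assume x: "0 \<le> x" "x \<le> u"
      then have "0 \<le> f' x" unfolding f'_def using q[of x] assms by simp
      then show "\<exists>y. (f has_real_derivative y) (at x) \<and> 0 \<le> y" using D[of x] x by auto
    qed
  next
    case neg: False
    show ?thesis
    proof (rule DERIV_nonpos_imp_nonincreasing[of u 0 f])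
      show "u \<le> 0" using neg by simp
      fix x assume x: "u \<le> x" "x \<le> 0"
      then have "f' x \<le> 0" unfolding f'_def using q[of x] u
        by (intro divide_nonpos_pos mult_nonpos_nonneg mult_pos_pos) auto
      then show "\<exists>y. (f has_real_derivative y) (at x) \<and> y \<le> 0" using D[of x] x u by auto
    qed
  qed
  then have "ln (1 + 2 * u) \<le> ln (1 + u) + (u - u\<^sup>2)" by (simp add: f_def)
  then have "exp (ln (1 + 2 * u)) \<le> exp (ln (1 + u) + (u - u\<^sup>2))" by simp
  then show ?thesis using u by (simp add: exp_add)
qed

lemma prod_le_exp_sum:
  fixes a b c :: "'a \<Rightarrow> real"
  assumes "\<And>i. i \<in> I \<Longrightarrow> 0 \<le> a i \<and> a i \<le> b i * exp (c i)"
  shows "prod a I \<le> prod b I * exp (sum c I)"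
proof (cases "finite I")
  case True
  have "prod a I \<le> (\<Prod>i\<in>I. b i * exp (c i))" by (rule prod_mono) (use assms in auto)
  also have "\<dots> = prod b I * exp (sum c I)" using True by (simp add: prod.distrib exp_sum)
  finally show ?thesis .
qed auto

lemma mult_exp_neg_le: "0 \<le> y \<Longrightarrow> y * exp (- y) \<le> (1 :: real)"
proof -
  assume "0 \<le> y"
  have "y \<le> exp y" using exp_ge_add_one_self[of y] by linarith
  then show ?thesis by (simp add: exp_minus divide_simps)
qed

lemma square_mult_exp_neg_le: "0 \<le> y \<Longrightarrow> y\<^sup>2 * exp (- y) \<le> (4 :: real)"
  using mult_mono[OF mult_exp_neg_le[of "y / 2"] mult_exp_neg_le[of "y / 2"]]
  by (simp add: power2_eq_square exp_double[symmetric] mult_exp_exp field_simps)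

section \<open>Comparing the weights of one cluster size for different numbers of vertices\<close>

context
  fixes p :: real
  assumes p: "0 < p" "p \<le> 1 / 2"
begin

lemma one_minus_power_le: "(1 - p) ^ e \<le> exp (- p * real e)"
proof -
  have "(1 - p) ^ e \<le> exp (- p) ^ e" using p exp_ge_add_one_self[of "- p"] by (intro power_mono) auto
  then show ?thesis by (simp add: exp_of_nat_mult[symmetric] mult.commute)
qed

lemma one_minus_power_ge: "exp (- (p + 2 * p\<^sup>2) * real e) \<le> (1 - p) ^ e"
proof -
  have "- p - 2 * p\<^sup>2 \<le> ln (1 - p)" using p by (intro ln_one_minus_pos_lower_bound) auto
  then have "exp (- (p + 2 * p\<^sup>2)) \<le> 1 - p" using p by (simp add: ln_ge_iff)
  then have "exp (- (p + 2 * p\<^sup>2)) ^ e \<le> (1 - p) ^ e" by (intro power_mono) auto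
  then show ?thesis by (simp add: exp_of_nat_mult[symmetric] mult.commute)
qed

text \<open>The exponents to be compared differ by an amount of varying sign, so the upper bound for
  a positive and the lower bound for a negative difference are merged. The term with
  \<open>p\<^sup>2\<close> is the error of the lower bound.\<close>

lemma one_minus_power_compare:
  "(1 - p) ^ e1 \<le> (1 - p) ^ e2 * exp (- p * (real e1 - real e2) + 2 * p\<^sup>2 * real e2)"
proof (cases "e2 \<le> e1")
  case True
  have "(1 - p) ^ e1 = (1 - p) ^ e2 * (1 - p) ^ (e1 - e2)" using True by (simp flip: power_add)
  also have "\<dots> \<le> (1 - p) ^ e2 * exp (- p * real (e1 - e2))"
    using p one_minus_power_le by (intro mult_left_mono) auto
  also have "\<dots> \<le> (1 - p) ^ e2 * exp (- p * (real e1 - real e2) + 2 * p\<^sup>2 * real e2)"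
    using p True by (intro mult_left_mono) (auto simp: of_nat_diff)
  finally show ?thesis .
next
  case False
  let ?d = "e2 - e1"
  have e2: "e2 = e1 + ?d" using False by simp
  have "1 \<le> (1 - p) ^ ?d * exp ((p + 2 * p\<^sup>2) * real ?d)"
  proof -
    have "exp (- (p + 2 * p\<^sup>2) * real ?d) * exp ((p + 2 * p\<^sup>2) * real ?d) = 1"
      by (simp add: mult_exp_exp algebra_simps)
    then show ?thesis
      using mult_right_mono[OF one_minus_power_ge[of ?d], of "exp ((p + 2 * p\<^sup>2) * real ?d)"] by simp
  qed
  also have "\<dots> \<le> (1 - p) ^ ?d * exp (- p * (real e1 - real e2) + 2 * p\<^sup>2 * real e2)"
  proof (intro mult_left_mono)
    have "2 * p\<^sup>2 * real ?d \<le> 2 * p\<^sup>2 * real e2" by (intro mult_left_mono) auto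
    then show "exp ((p + 2 * p\<^sup>2) * real ?d) \<le> exp (- p * (real e1 - real e2) + 2 * p\<^sup>2 * real e2)"
      using False by (simp add: of_nat_diff algebra_simps)
  qed (use p in auto)
  finally have "(1 - p) ^ e1 * 1 \<le> (1 - p) ^ e1 * ((1 - p) ^ ?d * exp (- p * (real e1 - real e2) + 2 * p\<^sup>2 * real e2))"
    using p by (intro mult_left_mono) auto
  also have "\<dots> = (1 - p) ^ e2 * exp (- p * (real e1 - real e2) + 2 * p\<^sup>2 * real e2)"
    by (subst (3) e2) (simp add: power_add)
  finally show ?thesis by simp
qed

lemma reach_prob_nonneg': "1 \<le> k \<Longrightarrow> 0 \<le> reach_prob p k"
  using reach_prob_nonneg p by simp

lemma Qk_nonneg: "1 \<le> k \<Longrightarrow> 0 \<le> Qk p N k"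
  unfolding Qk_def using reach_prob_nonneg'[of k] p by simp

lemma Pk_nonneg: "1 \<le> k \<Longrightarrow> 0 \<le> Pk p m k"
  unfolding Pk_def using reach_prob_nonneg'[of k] p by simp

text \<open>The unknown factor \<open>reach_prob p k\<close> does not depend on the number of
  vertices and cancels in the ratio. What remains is the growth of the binomial coefficient against
  the \<open>k * (N' - N)\<close> further excluded edges.\<close>

lemma Qk_mult_le:
  assumes k: "1 \<le> k" "k \<le> N" and "N \<le> N'"
  shows "(real N' / real N) ^ (k - 1) * exp (- (p + 2 * p\<^sup>2) * (real k * (real N' - real N))) * Qk p N k \<le> Qk p N' k"
proof -
  let ?r = "real N' / real N"
  let ?e = "exp (- (p + 2 * p\<^sup>2) * (real k * (real N' - real N)))"
  have N: "0 < real N" using k by simp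
  have "(\<Prod>i\<in>{1..<k}. ?r * (real N - real i)) \<le> (\<Prod>i\<in>{1..<k}. real N' - real i)"
  proof (rule prod_mono, safe)
    fix i assume i: "i \<in> {1..<k}"
    then show "0 \<le> ?r * (real N - real i)" using k by (intro mult_nonneg_nonneg) auto
    have "real N * real i \<le> real N' * real i" using assms(3) by (intro mult_right_mono) auto
    then show "?r * (real N - real i) \<le> real N' - real i" using N by (simp add: field_simps)
  qed
  then have 1: "?r ^ (k - 1) * (\<Prod>i\<in>{1..<k}. real N - real i) \<le> (\<Prod>i\<in>{1..<k}. real N' - real i)"
    by (simp only: prod.distrib prod_constant card_atLeastLessThan)
  have c: "?r ^ (k - 1) * real ((N - 1) choose (k - 1)) \<le> real ((N' - 1) choose (k - 1))"
    using divide_right_mono[OF 1, of "fact (k - 1)"] k assms(3)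
    by (subst (1 2) real_choose_eq_prod) simp_all
  have e: "k * (N' - k) = k * (N - k) + k * (N' - N)" using k assms(3) by (simp flip: add_mult_distrib2)
  have d: "?e * (1 - p) ^ (k * (N - k)) \<le> (1 - p) ^ (k * (N' - k))"
    using mult_right_mono[OF one_minus_power_ge[of "k * (N' - N)"], of "(1 - p) ^ (k * (N - k))"] p assms(3)
    unfolding e power_add by (simp add: of_nat_diff mult.commute)
  have "?r ^ (k - 1) * ?e * Qk p N k
    = reach_prob p k * ((?r ^ (k - 1) * real ((N - 1) choose (k - 1))) * (?e * (1 - p) ^ (k * (N - k))))"
    by (simp add: Qk_def mult_ac)
  also have "\<dots> \<le> reach_prob p k * (real ((N' - 1) choose (k - 1)) * (1 - p) ^ (k * (N' - k)))"
    by (intro mult_left_mono mult_mono c d reach_prob_nonneg') (use k p in auto)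
  finally show ?thesis by (simp add: Qk_def mult_ac)
qed

lemma Qk_le_mult:
  assumes k: "1 \<le> k" "k \<le> N" and "N \<le> N'" and c: "\<And>i. 1 \<le> i \<Longrightarrow> i < k \<Longrightarrow> real N' - real i \<le> (real N - real i) * exp c"
  shows "Qk p N' k \<le> exp (real (k - 1) * c - p * (real k * (real N' - real N))) * Qk p N k"
proof -
  let ?e = "exp (- p * (real k * (real N' - real N)))"
  have 1: "(\<Prod>i\<in>{1..<k}. real N' - real i) \<le> (\<Prod>i\<in>{1..<k}. real N - real i) * exp (\<Sum>i\<in>{1..<k}. c)"
    by (rule prod_le_exp_sum) (use assms in auto)
  have 2: "real ((N' - 1) choose (k - 1)) \<le> real ((N - 1) choose (k - 1)) * exp (real (k - 1) * c)"
    using k assms(3) divide_right_mono[OF 1, of "fact (k - 1)"]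
    by (subst (1 2) real_choose_eq_prod) simp_all
  have e: "k * (N' - k) = k * (N - k) + k * (N' - N)" using k assms(3) by (simp flip: add_mult_distrib2)
  have d: "(1 - p) ^ (k * (N' - k)) \<le> (1 - p) ^ (k * (N - k)) * ?e"
    using mult_left_mono[OF one_minus_power_le[of "k * (N' - N)"], of "(1 - p) ^ (k * (N - k))"] p assms(3)
    unfolding e power_add by (simp add: of_nat_diff)
  have "Qk p N' k = reach_prob p k * (real ((N' - 1) choose (k - 1)) * (1 - p) ^ (k * (N' - k)))"
    by (simp add: Qk_def mult_ac)
  also have "\<dots> \<le> reach_prob p k * ((real ((N - 1) choose (k - 1)) * exp (real (k - 1) * c)) * ((1 - p) ^ (k * (N - k)) * ?e))"
    by (intro mult_left_mono mult_mono 2 d reach_prob_nonneg') (use k p in auto)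
  also have "\<dots> = exp (real (k - 1) * c - p * (real k * (real N' - real N))) * Qk p N k"
    by (simp add: Qk_def mult_ac exp_diff exp_minus divide_inverse)
  finally show ?thesis .
qed

lemma Pk_exponent:
  assumes "1 \<le> k" "k \<le> m"
  shows "real (2 * k * (m - k) + k * (k - 1) div 2)
    = 2 * real k * (real m - real k) + real k * (real k - 1) / 2"
proof -
  have "even (k * (k - 1))" by (cases k) auto
  then have "real (k * (k - 1) div 2) = real (k * (k - 1)) / 2" by (simp add: real_of_nat_div)
  then show ?thesis using assms by (simp add: of_nat_diff)
qed

lemma Pk_eq_prod:
  assumes "1 \<le> k" "k \<le> m"
  shows "Pk p m k = (\<Prod>i\<in>{1..<k}. 2 * real m - 2 * real i) / fact (k - 1)
    * (reach_prob p k * (1 - p) ^ (2 * k * (m - k) + k * (k - 1) div 2))"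
proof -
  have "(\<Prod>i\<in>{1..<k}. 2 * real m - 2 * real i) = (\<Prod>i\<in>{1..<k}. 2 * (real m - real i))"
    by (simp add: algebra_simps)
  then have "(\<Prod>i\<in>{1..<k}. 2 * real m - 2 * real i) = 2 ^ (k - 1) * (\<Prod>i\<in>{1..<k}. real m - real i)"
    by (simp only: prod.distrib prod_constant card_atLeastLessThan)
  then show ?thesis
    unfolding Pk_def using assms by (subst real_choose_eq_prod) simp_all
qed

text \<open>Again \<open>reach_prob p k\<close> is common to both sides. The powers of 2 turn the
  binomial coefficient in \<open>Pk\<close> into factors 2m - 2i, compared with N - i one by one;
  the other terms of the exponent come from the powers of \<open>1 - p\<close>.\<close>

lemma Pk_le_Qk:
  assumes k: "1 \<le> k" "k \<le> m" "m \<le> N"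
    and small: "p * real k \<le> 1" "p * real N \<le> 2"
    and c: "\<And>i. 1 \<le> i \<Longrightarrow> i < k \<Longrightarrow> 2 * real m - 2 * real i \<le> (real N - real i) * exp (c i)"
  shows "Pk p m k \<le> exp ((\<Sum>i\<in>{1..<k}. c i) - p * real k * (2 * real m - real N)
    + p * (real k)\<^sup>2 / 2 + p * real k / 2 + 4) * Qk p N k"
proof -
  let ?e1 = "2 * k * (m - k) + k * (k - 1) div 2" and ?e2 = "k * (N - k)"
  have 1: "(\<Prod>i\<in>{1..<k}. 2 * real m - 2 * real i) \<le> (\<Prod>i\<in>{1..<k}. real N - real i) * exp (\<Sum>i\<in>{1..<k}. c i)"
    by (rule prod_le_exp_sum) (use k c in auto)
  have e2: "real ?e2 = real k * (real N - real k)" using k by (simp add: of_nat_diff)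
  \<comment> \<open>The error term of \<open>one_minus_power_compare\<close> is twice this quantity,
    hence the constant 4 in the exponent.\<close>
  have "p\<^sup>2 * real ?e2 = (p * real k) * (p * (real N - real k))"
    unfolding e2 by (simp add: power2_eq_square)
  also have "\<dots> \<le> 1 * 2"
  proof (rule mult_mono[OF small(1)])
    have "0 \<le> p * real k" using p by simp
    then show "p * (real N - real k) \<le> 2" using small(2) unfolding right_diff_distrib by linarith
  qed (use k p in auto)
  finally have "- p * (real ?e1 - real ?e2) + 2 * p\<^sup>2 * real ?e2
    \<le> - p * real k * (2 * real m - real N) + p * (real k)\<^sup>2 / 2 + p * real k / 2 + 4"
    unfolding e2 Pk_exponent[OF k(1,2)] by (simp add: algebra_simps power2_eq_square add_divide_distrib diff_divide_distrib)
  then have 2: "(1 - p) ^ ?e1 \<le> (1 - p) ^ ?e2 *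
     exp (- p * real k * (2 * real m - real N) + p * (real k)\<^sup>2 / 2 + p * real k / 2 + 4)"
    using p by (intro order_trans[OF one_minus_power_compare[of ?e1 ?e2]] mult_left_mono) auto
  have "Pk p m k = reach_prob p k / fact (k - 1) * ((\<Prod>i\<in>{1..<k}. 2 * real m - 2 * real i) * (1 - p) ^ ?e1)"
    using Pk_eq_prod[OF k(1,2)] by simp
  also have "\<dots> \<le> reach_prob p k / fact (k - 1) * (((\<Prod>i\<in>{1..<k}. real N - real i) * exp (\<Sum>i\<in>{1..<k}. c i)) *
     ((1 - p) ^ ?e2 * exp (- p * real k * (2 * real m - real N) + p * (real k)\<^sup>2 / 2 + p * real k / 2 + 4)))"
    by (intro mult_left_mono mult_mono 1 2 divide_nonneg_nonneg reach_prob_nonneg' mult_nonneg_nonneg prod_nonneg)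
      (use k p in auto)
  also have "\<dots> = exp ((\<Sum>i\<in>{1..<k}. c i) - p * real k * (2 * real m - real N)
    + p * (real k)\<^sup>2 / 2 + p * real k / 2 + 4) * Qk p N k"
  proof -
    have a: "exp ((\<Sum>i\<in>{1..<k}. c i) - p * real k * (2 * real m - real N) + p * (real k)\<^sup>2 / 2 + p * real k / 2 + 4)
      = exp (\<Sum>i\<in>{1..<k}. c i) * exp (- p * real k * (2 * real m - real N) + p * (real k)\<^sup>2 / 2 + p * real k / 2 + 4)"
      by (simp add: mult_exp_exp)
    have b: "real ((N - 1) choose (k - 1)) = (\<Prod>i\<in>{1..<k}. real N - real i) / fact (k - 1)"
      using k by (intro real_choose_eq_prod) auto
    show ?thesis unfolding Qk_def a b by (simp only: times_divide_eq_left times_divide_eq_right mult_ac)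
  qed
  finally show ?thesis .
qed

section \<open>Moments and tails of the cluster size in a random digraph\<close>

text \<open>A discrete derivative of \<open>sum_Qk\<close> in \<open>N\<close>: passing from
  \<open>N\<close> to \<open>Suc N\<close> multiplies the weight of \<open>k\<close> by at least 1 +
  (k-1)/N - kp', while the total cannot exceed 1. So the mean times 1/N - p' is at most 1/N, and 1 -
  Np' is at least d/2.\<close>

lemma mean_Qk_le:
  assumes N: "1 \<le> N" "p * real N \<le> 1 - d" and d: "0 < d" "8 * p \<le> d"
  shows "(\<Sum>k=1..N. real k * Qk p N k) \<le> 2 / d"
proof -
  let ?p' = "p + 2 * p\<^sup>2"
  let ?M = "\<Sum>k=1..N. real k * Qk p N k"
  have N0: "0 < real N" using N by simp
  have step: "(1 + (real k - 1) / real N - real k * ?p') * Qk p N k \<le> Qk p (Suc N) k" if k: "k \<in> {1..N}" for k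
  proof -
    have y: "(real k - 1) / real N < 1" using k N0 by simp
    \<comment> \<open>The exact ratio of the two weights: N/(N+1-k) from the binomial coefficients
      and \<open>(1 - p) ^ k\<close> from the edges to the new vertex.\<close>
    have id: "real (N + 1 - k) * Qk p (Suc N) k = real N * (1 - p) ^ k * Qk p N k"
    proof -
      have "real (N + 1 - k) * real (N choose (k - 1)) = real N * real ((N - 1) choose (k - 1))"
        using arg_cong[OF binomial_absorb_comp[of N "k - 1"], of real] k N by simp
      moreover have "k * (Suc N - k) = k + k * (N - k)" using k by (simp add: Suc_diff_le)
      ultimately show ?thesis unfolding Qk_def by (simp add: power_add mult_ac)
    qed
    have "exp ((real k - 1) / real N) * (1 - (real k - 1) / real N) \<le> 1"
    proof -
      have "1 - (real k - 1) / real N \<le> exp (- ((real k - 1) / real N))"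
        using exp_ge_add_one_self[of "- ((real k - 1) / real N)"] by simp
      then show ?thesis by (simp add: exp_minus field_simps)
    qed
    then have a: "exp ((real k - 1) / real N) \<le> real N / real (N + 1 - k)"
      using k N0 by (simp add: field_simps of_nat_diff)
    have "1 + (real k - 1) / real N - real k * ?p' \<le> exp ((real k - 1) / real N + - ?p' * real k)"
      using exp_ge_add_one_self[of "(real k - 1) / real N + - ?p' * real k"] by (simp add: algebra_simps)
    also have "\<dots> \<le> real N / real (N + 1 - k) * (1 - p) ^ k"
      unfolding exp_add by (intro mult_mono a one_minus_power_ge) auto
    finally have "(1 + (real k - 1) / real N - real k * ?p') * Qk p N k
       \<le> real N / real (N + 1 - k) * (1 - p) ^ k * Qk p N k"
      using Qk_nonneg[of k N] k by (intro mult_right_mono) auto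
    also have "\<dots> = Qk p (Suc N) k" using id k by (simp add: field_simps)
    finally show ?thesis .
  qed
  have "(\<Sum>k=1..N. (1 + (real k - 1) / real N - real k * ?p') * Qk p N k) \<le> (\<Sum>k=1..N. Qk p (Suc N) k)"
    by (rule sum_mono) (use step in blast)
  also have "\<dots> \<le> (\<Sum>k=1..Suc N. Qk p (Suc N) k)"
    by (rule sum_mono2) (use Qk_nonneg in auto)
  also have "\<dots> = 1" by (rule sum_Qk) simp
  also have "(\<Sum>k=1..N. (1 + (real k - 1) / real N - real k * ?p') * Qk p N k)
     = (\<Sum>k=1..N. (1 - 1 / real N) * Qk p N k + (1 / real N - ?p') * (real k * Qk p N k))"
    by (rule sum.cong) (auto simp: algebra_simps diff_divide_distrib)
  also have "\<dots> = (1 - 1 / real N) * (\<Sum>k=1..N. Qk p N k) + (1 / real N - ?p') * ?M"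
    by (simp only: sum.distrib sum_distrib_left)
  finally have "(1 / real N - ?p') * ?M \<le> 1 / real N" using sum_Qk[OF N(1)] by simp
  then have "real N * ((1 / real N - ?p') * ?M) \<le> real N * (1 / real N)" by (rule mult_left_mono) simp
  moreover have "real N * ((1 / real N - ?p') * ?M) = (1 - real N * ?p') * ?M"
    unfolding mult.assoc[symmetric] using N0 by (simp add: right_diff_distrib)
  moreover have "real N * (1 / real N) = 1" using N0 by simp
  ultimately have "(1 - real N * ?p') * ?M \<le> 1" by linarith
  moreover have "d / 2 \<le> 1 - real N * ?p'"
  proof -
    have "real N * ?p' = p * real N + 2 * p * (p * real N)" by (simp add: algebra_simps power2_eq_square)
    moreover have "2 * p * (p * real N) \<le> 2 * p * 1" using N(2) d p by (intro mult_left_mono) auto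
    ultimately show ?thesis using N(2) d by simp
  qed
  moreover have "0 \<le> ?M" using Qk_nonneg by (intro sum_nonneg) auto
  ultimately have "d / 2 * ?M \<le> 1" by (meson mult_right_mono order_trans)
  then show ?thesis using d by (simp add: field_simps)
qed

text \<open>A number of vertices is an integer, so a prescribed value of \<open>p * real M\<close>
  is met only up to \<open>p\<close>. Where this is applied, \<open>p\<close> is small against the
  distance \<open>d\<close> to the threshold.\<close>

lemma exists_grid_point:
  assumes "0 \<le> x"
  shows "\<exists>M::nat. p * real M \<le> x \<and> x - p < p * real M"
proof (intro exI conjI)
  let ?M = "nat \<lfloor>x / p\<rfloor>"
  have M: "real ?M = of_int \<lfloor>x / p\<rfloor>" using assms p by simp
  show "p * real ?M \<le> x" unfolding M using mult_left_mono[OF of_int_floor_le[of "x / p"], of p] p by simp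
  have "x / p < of_int \<lfloor>x / p\<rfloor> + 1" by linarith
  then show "x - p < p * real ?M" unfolding M using p by (simp add: field_simps)
qed

text \<open>Passing to a larger but still subcritical \<open>N'\<close> gains the factor
  (N'/N)^(k-1) and loses at most exp (ky), where y = 1 - N/N'. As -ln (1-y) is at least y + y^2/2,
  the linear terms cancel; the gain k y^2/2 with y at least d/4 remains, so the weights decay on the
  scale 1/d^2.\<close>

lemma Qk_decay:
  assumes k: "1 \<le> k" "k \<le> N" "N \<le> N'" and d: "0 < d" "d \<le> 1" "8 * p \<le> d"
    and N: "p * real N \<le> 1 - d" and N': "1 - 3 * d / 4 \<le> p * real N'" "p * real N' \<le> 1 - d / 2"
  shows "Qk p N k \<le> exp 2 * exp (- (d\<^sup>2 * real k / 32)) * Qk p N' k"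
proof -
  let ?p' = "p + 2 * p\<^sup>2"
  define y where "y = 1 - real N / real N'"
  have pos: "0 < real N" "0 < real N'" using k by auto
  have b: "real N / real N' = 1 - y" by (simp add: y_def)
  have y01: "0 \<le> y" "y < 1" using k pos by (auto simp: y_def)
  have "p * real N' * y = p * real N' - p * real N" using pos by (simp add: y_def algebra_simps)
  then have "d / 4 \<le> p * real N' * y" using N N' by simp
  also have "\<dots> \<le> 1 * y" using N' d y01 by (intro mult_right_mono) auto
  finally have yd: "d / 4 \<le> y" by simp
  have "ln (1 - y) \<le> - y - y\<^sup>2 / 2"
  proof -
    define f where "f = (\<lambda>x::real. - x - x\<^sup>2 / 2 - ln (1 - x))"
    have "f 0 \<le> f y"
    proof (rule DERIV_nonneg_imp_nondecreasing[OF y01(1)])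
      fix x assume x: "0 \<le> x" "x \<le> y"
      have "(f has_real_derivative (- 1 - x + 1 / (1 - x))) (at x)"
        unfolding f_def using x y01
        by (auto intro!: derivative_eq_intros simp: divide_simps) (simp add: algebra_simps)
      moreover have "0 \<le> - 1 - x + 1 / (1 - x)" using x y01 by (simp add: field_simps)
      ultimately show "\<exists>z. (f has_real_derivative z) (at x) \<and> 0 \<le> z" by blast
    qed
    then show ?thesis by (simp add: f_def)
  qed
  then have "exp (ln (1 - y)) \<le> exp (- y - y\<^sup>2 / 2)" by simp
  then have "1 - y \<le> exp (- y - y\<^sup>2 / 2)" using y01 by simp
  then have "exp (y + y\<^sup>2 / 2) * (1 - y) \<le> exp (y + y\<^sup>2 / 2) * exp (- y - y\<^sup>2 / 2)" by (intro mult_left_mono) auto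
  then have "exp (y + y\<^sup>2 / 2) * (1 - y) \<le> 1" by (simp add: mult_exp_exp)
  then have "exp (y + y\<^sup>2 / 2) \<le> real N' / real N" unfolding b[symmetric] using pos by (simp add: field_simps)
  then have "exp (y + y\<^sup>2 / 2) ^ (k - 1) \<le> (real N' / real N) ^ (k - 1)" by (rule power_mono) simp
  then have 1: "exp (real (k - 1) * (y + y\<^sup>2 / 2)) \<le> (real N' / real N) ^ (k - 1)"
    by (simp add: exp_of_nat_mult[symmetric])
  have "?p' * real N' = p * real N' + 2 * p * (p * real N')" by (simp add: algebra_simps power2_eq_square)
  moreover have "2 * p * (p * real N') \<le> 2 * p * 1" using N' d p by (intro mult_left_mono) auto
  ultimately have p'N': "?p' * real N' \<le> 1" using N' d by simp
  have "?p' * (real k * (real N' - real N)) = real k * ((?p' * real N') * y)"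
    using pos by (simp add: y_def algebra_simps)
  also have "\<dots> \<le> real k * (1 * y)" using p'N' y01 by (intro mult_left_mono mult_right_mono) auto
  finally have 2: "?p' * (real k * (real N' - real N)) \<le> real k * y" by simp
  have "(d / 4)\<^sup>2 \<le> y\<^sup>2" using yd d by (intro power_mono) auto
  then have "real k * (d / 4)\<^sup>2 \<le> real k * y\<^sup>2" by (intro mult_left_mono) auto
  then have "d\<^sup>2 * real k / 32 \<le> real k * y\<^sup>2 / 2" by (simp add: power_divide mult.commute)
  moreover have "y\<^sup>2 \<le> 1" using y01 by (simp add: power_le_one)
  \<comment> \<open>Having k - 1 factors instead of k costs y + y^2/2, which the constant 2 in the
    exponent covers.\<close>
  moreover have "real (k - 1) * (y + y\<^sup>2 / 2) = real k * y + real k * y\<^sup>2 / 2 - y - y\<^sup>2 / 2"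
    using k(1) by (simp add: of_nat_diff field_simps)
  ultimately have "d\<^sup>2 * real k / 32 - 2 \<le> real (k - 1) * (y + y\<^sup>2 / 2) + - ?p' * (real k * (real N' - real N))"
    using 2 y01 unfolding mult_minus_left by linarith
  then have "exp (d\<^sup>2 * real k / 32 - 2) \<le> exp (real (k - 1) * (y + y\<^sup>2 / 2) + - ?p' * (real k * (real N' - real N)))"
    by simp
  also have "\<dots> \<le> (real N' / real N) ^ (k - 1) * exp (- ?p' * (real k * (real N' - real N)))"
    unfolding exp_add by (rule mult_right_mono[OF 1]) simp
  finally have "exp (d\<^sup>2 * real k / 32 - 2) * Qk p N k \<le> Qk p N' k"
    using Qk_mult_le[OF k] Qk_nonneg[OF k(1)] by (meson mult_right_mono order_trans)
  then have "exp (2 - d\<^sup>2 * real k / 32) * (exp (d\<^sup>2 * real k / 32 - 2) * Qk p N k)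
      \<le> exp (2 - d\<^sup>2 * real k / 32) * Qk p N' k" by (intro mult_left_mono) auto
  then show ?thesis unfolding mult.assoc[symmetric] mult_exp_exp by simp
qed

text \<open>With \<open>N'\<close> halfway to the threshold, one factor \<open>k\<close> is absorbed
  by the exponential decay at the price 32/d^2. The other gives the mean for \<open>N'\<close>,
  which is at most 4/d.\<close>

lemma square_mean_Qk_le:
  assumes N: "1 \<le> N" "p * real N \<le> 1 - d" and d: "0 < d" "d \<le> 1" "16 * p \<le> d"
  shows "(\<Sum>k=1..N. (real k)\<^sup>2 * Qk p N k) \<le> 128 * exp 2 / d ^ 3"
proof -
  obtain N' where N': "p * real N' \<le> 1 - d / 2" "1 - d / 2 - p < p * real N'"
    using exists_grid_point[of "1 - d / 2"] d by auto
  have "p * real N < p * real N'" using N N' d by linarith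
  then have NN: "N \<le> N'" using p by simp
  have "(\<Sum>k=1..N. (real k)\<^sup>2 * Qk p N k) \<le> (\<Sum>k=1..N. 32 * exp 2 / d\<^sup>2 * (real k * Qk p N' k))"
  proof (rule sum_mono)
    fix k assume k: "k \<in> {1..N}"
    let ?y = "d\<^sup>2 * real k / 32"
    have "Qk p N k \<le> exp 2 * exp (- ?y) * Qk p N' k"
      by (rule Qk_decay) (use k NN d N N' in auto)
    then have "(real k)\<^sup>2 * Qk p N k \<le> (real k)\<^sup>2 * (exp 2 * exp (- ?y) * Qk p N' k)"
      by (intro mult_left_mono) auto
    also have "\<dots> = 32 * exp 2 / d\<^sup>2 * ((?y * exp (- ?y)) * (real k * Qk p N' k))"
      using d by (simp add: power2_eq_square)
    also have "\<dots> \<le> 32 * exp 2 / d\<^sup>2 * (1 * (real k * Qk p N' k))"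
      using k d Qk_nonneg by (intro mult_left_mono mult_right_mono mult_exp_neg_le) auto
    finally show "(real k)\<^sup>2 * Qk p N k \<le> 32 * exp 2 / d\<^sup>2 * (real k * Qk p N' k)" by simp
  qed
  also have "\<dots> \<le> 32 * exp 2 / d\<^sup>2 * (\<Sum>k=1..N'. real k * Qk p N' k)"
    unfolding sum_distrib_left[symmetric]
    using NN Qk_nonneg by (intro mult_left_mono sum_mono2) auto
  also have "\<dots> \<le> 32 * exp 2 / d\<^sup>2 * (2 / (d / 2))"
    using N NN N' d by (intro mult_left_mono mean_Qk_le) auto
  also have "\<dots> = 128 * exp 2 / d ^ 3" by (simp add: power2_eq_square power3_eq_cube)
  finally show ?thesis .
qed

text \<open>Sizes below \<open>1 / d\<^sup>2\<close> do not distinguish \<open>N\<close> from the subcritical dual number \<open>M\<close> of vertices with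
  \<open>p * M \<approx> 1 - d\<close>; what is missing from their total mass is the tail.\<close>

lemma Qk_supercritical:
  assumes N: "1 - d \<le> p * real N" "p * real N \<le> 1 + d" and d: "0 < d" "d \<le> 1 / 8" "p \<le> d ^ 3"
  shows "(\<Sum>k\<in>{k\<in>{1..N}. 1 \<le> d\<^sup>2 * real k}. Qk p N k) \<le> 40 * d"
    and "(\<Sum>k\<in>{k\<in>{1..N}. d\<^sup>2 * real k < 1}. real k * Qk p N k) \<le> 2 * exp 15 / d"
proof -
  have d2: "d\<^sup>2 \<le> 1 / 64" using power_mono[of d "1 / 8" 2] d by (simp add: power2_eq_square)
  have "d ^ 3 = d\<^sup>2 * d" by (simp add: power2_eq_square power3_eq_cube)
  then have pd: "64 * p \<le> d" using mult_right_mono[OF d2, of d] d by linarith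
  obtain M where M: "p * real M \<le> 1 - d" "1 - d - p < p * real M"
    using exists_grid_point[of "1 - d"] d by auto
  define H where "H = p * (real N - real M)"
  define y where "y = (real N - real M) / real M"
  let ?K = "{k\<in>{1..N}. d\<^sup>2 * real k < 1}"
  have "p * real M \<le> p * real N" using N M by linarith
  then have MN: "M \<le> N" using p by simp
  have X: "3 / 4 \<le> p * real M" using M pd d by linarith
  then have M0: "1 \<le> M" using p by (cases M) auto
  have H: "0 \<le> H" "H \<le> 3 * d" using N M pd MN p d by (auto simp: H_def algebra_simps)
  have yM: "y * real M = real N - real M" using M0 by (simp add: y_def)
  have y0: "0 \<le> y" using MN by (simp add: y_def)
  have "y * (3 / 4) \<le> y * (p * real M)" using X y0 by (intro mult_left_mono)
  also have "\<dots> = H" by (simp add: H_def yM[symmetric])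
  finally have y: "y \<le> 4 * d" using H by simp
  have K: "k \<le> M \<and> p * real k \<le> d" if "k \<in> ?K" for k
  proof -
    have "p * real k \<le> d ^ 3 * real k" using d by (intro mult_right_mono) auto
    also have "\<dots> = d * (d\<^sup>2 * real k)" by (simp add: power2_eq_square power3_eq_cube)
    also have "\<dots> \<le> d * 1" using that d by (intro mult_left_mono) auto
    finally have "p * real k \<le> d" by simp
    moreover from this have "p * real k \<le> p * real M" using X d by linarith
    ultimately show ?thesis using p by simp
  qed
  have mean: "(\<Sum>k=1..M. real k * Qk p M k) \<le> 2 / d"
    by (rule mean_Qk_le) (use M0 M d pd p in auto)
  have KM: "?K \<subseteq> {1..M}" using K by auto
  have Kmean: "(\<Sum>k\<in>?K. real k * Qk p M k) \<le> 2 / d"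
    using sum_mono2[OF _ KM, of "\<lambda>k. real k * Qk p M k"] mean Qk_nonneg by auto
  \<comment> \<open>In the logarithm of the ratio the growth of the binomial coefficients, about
    (k-1)y, compensates the excluded edges, at most ky, because p'M is at most 1. The deficit is y
    plus a second-order term.\<close>
  have low: "Qk p M k - Qk p N k \<le> (y + real k * y\<^sup>2) * Qk p M k" if k: "k \<in> ?K" for k
  proof -
    let ?p' = "p + 2 * p\<^sup>2"
    have k1: "1 \<le> k" "k \<le> M" using k K by auto
    have "?p' * real M = p * real M + 2 * p * (p * real M)" by (simp add: algebra_simps power2_eq_square)
    moreover have "2 * p * (p * real M) \<le> 2 * p * 1" using M d p by (intro mult_left_mono) auto
    ultimately have "?p' * real M \<le> 1" using M pd p by linarith
    then have "real k * y * (?p' * real M) \<le> real k * y * 1" using y0 by (intro mult_left_mono) auto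
    then have a: "?p' * (real k * (real N - real M)) \<le> real k * y" unfolding yM[symmetric] by (simp add: mult_ac)
    have "y - y\<^sup>2 \<le> ln (1 + y)" by (rule ln_one_plus_pos_lower_bound) (use y0 y d in auto)
    then have "exp (y - y\<^sup>2) \<le> 1 + y" using y0 by (simp add: ln_ge_iff)
    moreover have NM: "real N / real M = 1 + y" using M0 by (simp add: y_def field_simps)
    ultimately have "exp (y - y\<^sup>2) ^ (k - 1) \<le> (real N / real M) ^ (k - 1)" by (intro power_mono) auto
    then have b: "exp (real (k - 1) * (y - y\<^sup>2)) \<le> (real N / real M) ^ (k - 1)"
      by (simp add: exp_of_nat_mult[symmetric])
    have "1 - (y + real k * y\<^sup>2) \<le> 1 + (real (k - 1) * (y - y\<^sup>2) + - ?p' * (real k * (real N - real M)))"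
    proof -
      have "real (k - 1) * (y - y\<^sup>2) = real k * y - real k * y\<^sup>2 - y + y\<^sup>2"
        using k1 by (simp add: of_nat_diff algebra_simps)
      then show ?thesis using a zero_le_power2[of y] unfolding mult_minus_left by linarith
    qed
    also have "\<dots> \<le> exp (real (k - 1) * (y - y\<^sup>2) + - ?p' * (real k * (real N - real M)))"
      by (rule exp_ge_add_one_self)
    also have "\<dots> \<le> (real N / real M) ^ (k - 1) * exp (- ?p' * (real k * (real N - real M)))"
      unfolding exp_add by (rule mult_right_mono[OF b]) simp
    finally have "(1 - (y + real k * y\<^sup>2)) * Qk p M k \<le> Qk p N k"
      using Qk_mult_le[OF k1 MN] Qk_nonneg[OF k1(1)] by (meson mult_right_mono order_trans)
    then show ?thesis by (simp add: algebra_simps)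
  qed
  have "(\<Sum>k\<in>{k\<in>{1..N}. 1 \<le> d\<^sup>2 * real k}. Qk p N k) = 1 - (\<Sum>k\<in>?K. Qk p N k)"
  proof -
    have "{1..N} = {k\<in>{1..N}. 1 \<le> d\<^sup>2 * real k} \<union> ?K" by auto
    then have "(\<Sum>k=1..N. Qk p N k) = (\<Sum>k\<in>{k\<in>{1..N}. 1 \<le> d\<^sup>2 * real k}. Qk p N k) + (\<Sum>k\<in>?K. Qk p N k)"
      by (metis (no_types, lifting) sum.union_disjoint[of "{k\<in>{1..N}. 1 \<le> d\<^sup>2 * real k}" ?K "Qk p N"]
        disjoint_iff finite_Un finite_atLeastAtMost linorder_not_le mem_Collect_eq)
    then show ?thesis using sum_Qk[of N p] M0 MN by simp
  qed
  \<comment> \<open>Both total masses are 1. So the tail for \<open>N\<close> is the tail for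
    \<open>M\<close>, to which Markov's inequality applies, plus what the small sizes lose.\<close>
  also have "\<dots> = (\<Sum>k\<in>{1..M} - ?K. Qk p M k) + (\<Sum>k\<in>?K. Qk p M k - Qk p N k)"
    using sum_diff[OF _ KM, of "Qk p M"] sum_Qk[OF M0] by (simp add: sum_subtractf)
  also have "\<dots> \<le> (\<Sum>k\<in>{1..M} - ?K. d\<^sup>2 * (real k * Qk p M k)) + (\<Sum>k\<in>?K. (y + real k * y\<^sup>2) * Qk p M k)"
  proof (rule add_mono)
    show "(\<Sum>k\<in>{1..M} - ?K. Qk p M k) \<le> (\<Sum>k\<in>{1..M} - ?K. d\<^sup>2 * (real k * Qk p M k))"
    proof (rule sum_mono)
      fix k assume "k \<in> {1..M} - ?K"
      then have k: "1 \<le> k" "1 \<le> d\<^sup>2 * real k" using MN by auto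
      show "Qk p M k \<le> d\<^sup>2 * (real k * Qk p M k)"
        using mult_right_mono[OF k(2) Qk_nonneg[OF k(1), of M]] by (simp add: mult_ac)
    qed
    show "(\<Sum>k\<in>?K. Qk p M k - Qk p N k) \<le> (\<Sum>k\<in>?K. (y + real k * y\<^sup>2) * Qk p M k)"
      by (rule sum_mono) (rule low)
  qed
  also have "(\<Sum>k\<in>?K. (y + real k * y\<^sup>2) * Qk p M k) = y * (\<Sum>k\<in>?K. Qk p M k) + y\<^sup>2 * (\<Sum>k\<in>?K. real k * Qk p M k)"
    by (simp add: sum_distrib_left sum.distrib[symmetric] algebra_simps)
  also have "(\<Sum>k\<in>{1..M} - ?K. d\<^sup>2 * (real k * Qk p M k)) + \<dots>
      \<le> d\<^sup>2 * (2 / d) + ((4 * d) * 1 + (4 * d)\<^sup>2 * (2 / d))"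
  proof (intro add_mono mult_mono)
    have "(\<Sum>k\<in>{1..M} - ?K. d\<^sup>2 * (real k * Qk p M k)) \<le> (\<Sum>k=1..M. d\<^sup>2 * (real k * Qk p M k))"
      using Qk_nonneg by (intro sum_mono2) auto
    also have "\<dots> \<le> d\<^sup>2 * (2 / d)"
      unfolding sum_distrib_left[symmetric] using mean by (intro mult_left_mono) auto
    finally show "(\<Sum>k\<in>{1..M} - ?K. d\<^sup>2 * (real k * Qk p M k)) \<le> d\<^sup>2 * (2 / d)" .
    show "(\<Sum>k\<in>?K. Qk p M k) \<le> 1"
      using sum_mono2[OF _ KM, of "Qk p M"] Qk_nonneg sum_Qk[OF M0] by auto
    show "y\<^sup>2 \<le> (4 * d)\<^sup>2" using y y0 by (rule power_mono)
  qed (use y d Kmean Qk_nonneg in \<open>auto intro!: sum_nonneg\<close>)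
  \<comment> \<open>The contributions are 2d, 4d and 32d.\<close>
  also have "\<dots> \<le> 40 * d" using d by (simp add: power2_eq_square)
  finally show "(\<Sum>k\<in>{k\<in>{1..N}. 1 \<le> d\<^sup>2 * real k}. Qk p N k) \<le> 40 * d" .
  \<comment> \<open>The exponent is at most k H (1/X' - 1), where H and 1 - X' are both at most 3d.
    This is of order d^2 k, hence bounded for the sizes in \<open>?K\<close>.\<close>
  have up: "Qk p N k \<le> exp 15 * Qk p M k" if k: "k \<in> ?K" for k
  proof -
    have k1: "1 \<le> k" "k \<le> M" "p * real k \<le> d" and kd: "d\<^sup>2 * real k < 1" using k K by auto
    define X' where "X' = p * real M - p * real k"
    have "0 \<le> p * real k" using p by simp
    then have X': "5 / 8 \<le> X'" "1 - X' \<le> 3 * d" "X' \<le> 1" using X k1 d M pd unfolding X'_def by linarith+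
    let ?c = "H / X'"
    have "Qk p N k \<le> exp (real (k - 1) * ?c - p * (real k * (real N - real M))) * Qk p M k"
    proof (rule Qk_le_mult[OF k1(1,2) MN])
      fix i assume i: "1 \<le> i" "i < k"
      have a: "X' \<le> p * (real M - real i)" using i p by (simp add: X'_def algebra_simps)
      then have pos: "0 < p * (real M - real i)" using X' by linarith
      have "H \<le> ?c * (p * (real M - real i))"
        using mult_left_mono[OF a, of ?c] H X' by simp
      then have "p * (real N - real M) \<le> p * (?c * (real M - real i))" by (simp add: H_def mult_ac)
      then have "real N - real M \<le> ?c * (real M - real i)" by (simp only: mult_le_cancel_left_pos[OF p(1)])
      then have "real N - real i \<le> (real M - real i) * (1 + ?c)" by (simp add: algebra_simps)
      also have "\<dots> \<le> (real M - real i) * exp ?c"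
        using pos p by (intro mult_left_mono exp_ge_add_one_self) (simp add: zero_less_mult_iff)
      finally show "real N - real i \<le> (real M - real i) * exp ?c" .
    qed
    moreover have "real (k - 1) * ?c - p * (real k * (real N - real M)) \<le> 15"
    proof -
      have "real (k - 1) * ?c \<le> real k * ?c" using H X' by (intro mult_right_mono) auto
      then have "real (k - 1) * ?c - p * (real k * (real N - real M)) \<le> real k * (H / X' - H)"
        by (simp add: H_def algebra_simps)
      also have "\<dots> \<le> real k * ((3 * d) * (3 * d / (5 / 8)))"
      proof (rule mult_left_mono)
        have "H / X' - H = H * ((1 - X') / X')" using X' by (simp add: field_simps)
        also have "\<dots> \<le> (3 * d) * (3 * d / (5 / 8))"
          using H X' d by (intro mult_mono frac_le divide_nonneg_nonneg) auto
        finally show "H / X' - H \<le> (3 * d) * (3 * d / (5 / 8))" .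
      qed simp
      also have "\<dots> = 72 / 5 * (d\<^sup>2 * real k)" by (simp add: power2_eq_square)
      finally show ?thesis using kd by linarith
    qed
    ultimately show ?thesis using Qk_nonneg[OF k1(1), of M]
      by (meson exp_le_cancel_iff mult_right_mono order_trans)
  qed
  have "(\<Sum>k\<in>?K. real k * Qk p N k) \<le> (\<Sum>k\<in>?K. exp 15 * (real k * Qk p M k))"
  proof (rule sum_mono)
    fix k assume "k \<in> ?K"
    then show "real k * Qk p N k \<le> exp 15 * (real k * Qk p M k)"
      using mult_left_mono[OF up, of k "real k"] by (simp add: mult_ac)
  qed
  also have "\<dots> \<le> exp 15 * (2 / d)" unfolding sum_distrib_left[symmetric] using Kmean by (intro mult_left_mono) auto
  finally show "(\<Sum>k\<in>?K. real k * Qk p N k) \<le> 2 * exp 15 / d" by (simp add: mult.commute)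
qed

end

section \<open>Moments of the cluster size\<close>

text \<open>Single terms may vanish, but not the whole sum: with z = p(k-1), the excess over the
  bound is k times (3a-2z)^2/12 plus a nonnegative term. The factor 1/4 is what the worst case z =
  3a/2 leaves.\<close>

lemma sum_square_diff_ge:
  fixes a p :: real
  assumes "1 \<le> k" "0 \<le> p"
  shows "real k * a\<^sup>2 / 4 - a\<^sup>2 \<le> (\<Sum>i\<in>{1..<k}. (a - p * real i)\<^sup>2)"
proof -
  have closed: "(\<Sum>i\<in>{1..<Suc j}. (a - p * real i)\<^sup>2)
    = real j * a\<^sup>2 - a * p * (real j * (real j + 1)) + p\<^sup>2 * (real j * (real j + 1) * (2 * real j + 1) / 6)" for j
    by (induction j) (simp_all add: field_simps power2_eq_square)
  obtain j where j: "k = Suc j" using assms(1) by (cases k) auto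
  define z where "z = p * real j"
  have "(\<Sum>i\<in>{1..<k}. (a - p * real i)\<^sup>2) - (real k * a\<^sup>2 / 4 - a\<^sup>2)
    = real k * ((3 * a - 2 * z)\<^sup>2 / 12 + z * p / 6)"
    unfolding j closed z_def by (simp add: field_simps power2_eq_square)
  also have "\<dots> \<ge> 0"
    unfolding z_def using assms by (intro mult_nonneg_nonneg add_nonneg_nonneg) auto
  finally show ?thesis by simp
qed

lemma sum_real_from_1: "1 \<le> k \<Longrightarrow> (\<Sum>i\<in>{1..<k}. real i) = real k * (real k - 1) / 2"
proof -
  have "(\<Sum>i\<in>{1..<Suc j}. real i) = real j * (real j + 1) / 2" for j
    by (induction j) (simp_all add: field_simps)
  then show "1 \<le> k \<Longrightarrow> ?thesis" by (cases k) (simp_all add: mult.commute)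
qed

text \<open>Serves to absorb numerical factors into the common constant
  \<open>exp 30\<close>.\<close>

lemma exp_ge_two_power: "2 ^ n \<le> exp (real n)"
proof -
  have "(2::real) ^ n \<le> exp 1 ^ n"
    using exp_ge_add_one_self[of 1] by (intro power_mono) auto
  then show ?thesis by (simp add: exp_of_nat_mult[symmetric])
qed

context
  fixes p :: real
  assumes p: "0 < p" "p \<le> 1 / 2"
begin

text \<open>With \<open>p * N = 1 + d / 2\<close> the logarithm of the ratio becomes a sum of the terms
  \<open>ln (1 + 2 * u) - ln (1 + u) - u\<close> at \<open>u = d / 2 - p * i\<close>, none of which is positive.\<close>

lemma Pk_decay:
  assumes k: "1 \<le> k" "k \<le> m" and m: "2 * p * real m = 1 + d" and d: "0 < d" "d \<le> 1 / 8"
    and N: "1 + d / 2 \<le> p * real N" "p * real N \<le> 1 + d / 2 + p"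
  shows "Pk p m k \<le> exp 6 * exp (- (d\<^sup>2 * real k / 16)) * Qk p N k"
proof -
  define c where "c = (\<lambda>i. (d / 2 - p * real i) - (d / 2 - p * real i)\<^sup>2)"
  have pm: "p * real m = (1 + d) / 2" using m by simp
  have pk: "p * real k \<le> 9 / 16"
  proof -
    have "p * real k \<le> p * real m" using k p by simp
    then show ?thesis using pm d by simp
  qed
  have "p * real m \<le> p * real N" using pm N d by simp
  then have mN: "m \<le> N" using p by simp
  have c: "2 * real m - 2 * real i \<le> (real N - real i) * exp (c i)" if i: "1 \<le> i" "i < k" for i
  proof -
    let ?u = "d / 2 - p * real i"
    have "p * real i \<le> p * real m" using i k p by simp
    moreover have "0 \<le> p * real i" using p by simp
    ultimately have "- (1 / 2) \<le> ?u \<and> ?u \<le> 1 / 8" using pm d by argo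
    then have "1 + 2 * ?u \<le> (1 + ?u) * exp (c i)" unfolding c_def by (intro one_plus_double_le) simp_all
    also have "\<dots> \<le> (p * (real N - real i)) * exp (c i)"
      using N by (intro mult_right_mono) (auto simp: algebra_simps)
    also have "1 + 2 * ?u = p * (2 * real m - 2 * real i)" using m by (simp add: algebra_simps)
    finally have "p * (2 * real m - 2 * real i) \<le> p * ((real N - real i) * exp (c i))" by (simp add: mult_ac)
    then show ?thesis by (simp only: mult_le_cancel_left_pos[OF p(1)])
  qed
  have "Pk p m k \<le> exp ((\<Sum>i\<in>{1..<k}. c i) - p * real k * (2 * real m - real N)
    + p * (real k)\<^sup>2 / 2 + p * real k / 2 + 4) * Qk p N k"
    using pk N d p by (intro Pk_le_Qk[OF p k mN] c) auto
  also have "\<dots> \<le> exp (6 + - (d\<^sup>2 * real k / 16)) * Qk p N k"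
  proof (intro mult_right_mono Qk_nonneg[OF p] k, simp only: exp_le_cancel_iff)
    have 1: "(\<Sum>i\<in>{1..<k}. d / 2 - p * real i) = (real k - 1) * (d / 2) - p * (real k * (real k - 1)) / 2"
      using k sum_real_from_1[OF k(1)] by (simp add: sum_subtractf of_nat_diff flip: sum_distrib_left)
    have 2: "real k * (d / 2)\<^sup>2 / 4 - (d / 2)\<^sup>2 \<le> (\<Sum>i\<in>{1..<k}. (d / 2 - p * real i)\<^sup>2)"
      by (rule sum_square_diff_ge) (use k p in auto)
    have "real k * (d / 2 - p) \<le> real k * (1 + d - p * real N)" using N by (intro mult_left_mono) auto
    also have "\<dots> = p * real k * (2 * real m - real N)" unfolding m[symmetric] by (simp add: algebra_simps)
    finally have 3: "real k * (d / 2 - p) \<le> p * real k * (2 * real m - real N)" .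
    have "(\<Sum>i\<in>{1..<k}. c i) = (real k - 1) * (d / 2) - p * (real k * (real k - 1)) / 2
       - (\<Sum>i\<in>{1..<k}. (d / 2 - p * real i)\<^sup>2)"
      unfolding c_def sum_subtractf 1[symmetric] by simp
    then have "(\<Sum>i\<in>{1..<k}. c i) - p * real k * (2 * real m - real N) + p * (real k)\<^sup>2 / 2 + p * real k / 2 + 4
      \<le> (real k - 1) * (d / 2) - p * (real k * (real k - 1)) / 2 - (real k * (d / 2)\<^sup>2 / 4 - (d / 2)\<^sup>2)
        - real k * (d / 2 - p) + p * (real k)\<^sup>2 / 2 + p * real k / 2 + 4"
      using 2 3 by linarith
    \<comment> \<open>The terms in kd and in pk^2 cancel. What drives the decay is the sum of
      squares, a quarter of k (d/2)^2.\<close>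
    also have "\<dots> = 4 - d / 2 + d\<^sup>2 / 4 + 2 * (p * real k) - d\<^sup>2 * real k / 16"
      by (simp add: field_simps power2_eq_square)
    also have "\<dots> \<le> 6 + - (d\<^sup>2 * real k / 16)"
    proof -
      have "d\<^sup>2 \<le> 1" using d by (simp add: power_le_one)
      then show ?thesis using pk d by linarith
    qed
    finally show "(\<Sum>i\<in>{1..<k}. c i) - p * real k * (2 * real m - real N) + p * (real k)\<^sup>2 / 2 + p * real k / 2 + 4
      \<le> 6 + - (d\<^sup>2 * real k / 16)" .
  qed
  finally show ?thesis by (simp only: exp_add)
qed

text \<open>The factors 2m - 2i lose at least exp (-k(k-1)/(4m)) against 2m - i, whereas the smaller
  number of forbidden clauses gains about exp (pk^2/2). The quadratic terms of the loss prevail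
  because 2pm is at most 1, and the remainders stay below 5.\<close>

lemma Pk_le_Qk_double:
  assumes k: "1 \<le> k" "k \<le> m" and m: "2 * p * real m \<le> 1"
  shows "Pk p m k \<le> exp 5 * Qk p (2 * m) k"
proof -
  define c where "c = (\<lambda>i. - real i / (2 * real m))"
  have m0: "0 < real m" using k by simp
  have "p * real k \<le> p * real m" using k p by simp
  then have pk: "p * real k \<le> 1 / 2" using m by simp
  have c: "2 * real m - 2 * real i \<le> (real (2 * m) - real i) * exp (c i)" if i: "1 \<le> i" "i < k" for i
  proof -
    have "2 * real m - 2 * real i \<le> (2 * real m - real i) * (1 + c i)"
      using m0 i by (simp add: c_def field_simps)
    also have "\<dots> \<le> (2 * real m - real i) * exp (c i)"
      using i k by (intro mult_left_mono exp_ge_add_one_self) auto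
    finally show ?thesis by simp
  qed
  have "Pk p m k \<le> exp ((\<Sum>i\<in>{1..<k}. c i) - p * real k * (2 * real m - real (2 * m))
    + p * (real k)\<^sup>2 / 2 + p * real k / 2 + 4) * Qk p (2 * m) k"
    by (rule Pk_le_Qk[OF p k]) (use pk m p c in auto)
  also have "\<dots> \<le> exp 5 * Qk p (2 * m) k"
  proof (intro mult_right_mono Qk_nonneg[OF p] k, simp only: exp_le_cancel_iff)
    have "(\<Sum>i\<in>{1..<k}. c i) = - ((\<Sum>i\<in>{1..<k}. real i) / (2 * real m))"
      by (simp add: c_def sum_negf sum_divide_distrib)
    also have "\<dots> = - ((real k)\<^sup>2 - real k) / (4 * real m)"
      unfolding sum_real_from_1[OF k(1)] using m0 by (simp add: field_simps power2_eq_square)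
    also have "\<dots> = real k / (4 * real m) - (real k)\<^sup>2 / (4 * real m)" by (simp add: diff_divide_distrib)
    finally have 1: "(\<Sum>i\<in>{1..<k}. c i) = real k / (4 * real m) - (real k)\<^sup>2 / (4 * real m)" .
    have "p * (real k)\<^sup>2 / 2 = (2 * p * real m) * ((real k)\<^sup>2 / (4 * real m))" using m0 by simp
    also have "\<dots> \<le> 1 * ((real k)\<^sup>2 / (4 * real m))" using m m0 by (intro mult_right_mono) auto
    finally have 2: "p * (real k)\<^sup>2 / 2 \<le> (real k)\<^sup>2 / (4 * real m)" by simp
    have 3: "real k / (4 * real m) \<le> 1 / 4" using k m0 by (simp add: field_simps)
    show "(\<Sum>i\<in>{1..<k}. c i) - p * real k * (2 * real m - real (2 * m))
      + p * (real k)\<^sup>2 / 2 + p * real k / 2 + 4 \<le> 5" using 1 2 3 pk by simp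
  qed
  finally show ?thesis .
qed

lemma moments_Pk_subcritical:
  assumes m: "2 * p * real m \<le> 1 - d" and d: "0 < d" "d \<le> 1 / 8" "100 * p \<le> d ^ 3"
  shows "(\<Sum>k=1..m. real k * Pk p m k) \<le> exp 30 / d"
    and "(\<Sum>k=1..m. (real k)\<^sup>2 * Pk p m k) \<le> exp 30 / d ^ 3"
proof -
  have "d ^ 3 \<le> d" using d power_decreasing[of 1 3 d] by simp
  then have pd: "100 * p \<le> d" using d by linarith
  have m1: "2 * p * real m \<le> 1" using m d by simp
  have N: "p * real (2 * m) \<le> 1 - d" using m by simp
  have mono: "(\<Sum>k=1..m. f k * Pk p m k) \<le> exp 5 * (\<Sum>k=1..2 * m. f k * Qk p (2 * m) k)"
    if f: "\<And>k. 0 \<le> f k" for f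
  proof -
    have "(\<Sum>k=1..m. f k * Pk p m k) \<le> (\<Sum>k=1..m. exp 5 * (f k * Qk p (2 * m) k))"
    proof (rule sum_mono)
      fix k assume "k \<in> {1..m}"
      then show "f k * Pk p m k \<le> exp 5 * (f k * Qk p (2 * m) k)"
        using mult_left_mono[OF Pk_le_Qk_double[of k m] f[of k]] m1 by (simp add: mult_ac)
    qed
    also have "\<dots> \<le> (\<Sum>k=1..2 * m. exp 5 * (f k * Qk p (2 * m) k))"
      using f Qk_nonneg[OF p] by (intro sum_mono2) auto
    finally show ?thesis by (simp only: sum_distrib_left)
  qed
  have e: "2 * exp 5 \<le> exp (30::real)" "128 * exp 7 \<le> exp (30::real)"
    using mult_right_mono[OF exp_ge_two_power[of 7], of "exp 7"] mult_right_mono[OF exp_ge_two_power[of 1], of "exp 5"]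
    by (auto simp: mult_exp_exp intro: order_trans)
  show "(\<Sum>k=1..m. real k * Pk p m k) \<le> exp 30 / d"
  proof (cases "m = 0")
    case False
    have "(\<Sum>k=1..m. real k * Pk p m k) \<le> exp 5 * (\<Sum>k=1..2 * m. real k * Qk p (2 * m) k)"
      by (rule mono) simp
    also have "\<dots> \<le> exp 5 * (2 / d)"
      using False N d pd by (intro mult_left_mono mean_Qk_le[OF p]) auto
    also have "\<dots> \<le> exp 30 / d" using e d by (simp add: divide_right_mono mult.commute)
    finally show ?thesis .
  qed (use d in simp)
  show "(\<Sum>k=1..m. (real k)\<^sup>2 * Pk p m k) \<le> exp 30 / d ^ 3"
  proof (cases "m = 0")
    case False
    have "(\<Sum>k=1..m. (real k)\<^sup>2 * Pk p m k) \<le> exp 5 * (\<Sum>k=1..2 * m. (real k)\<^sup>2 * Qk p (2 * m) k)"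
      by (rule mono) simp
    also have "\<dots> \<le> exp 5 * (128 * exp 2 / d ^ 3)"
      using False N d pd by (intro mult_left_mono square_mean_Qk_le[OF p]) auto
    also have "\<dots> = 128 * exp 7 / d ^ 3" by (simp add: mult_exp_exp mult.left_commute[of "exp 5"])
    also have "\<dots> \<le> exp 30 / d ^ 3" using e d by (intro divide_right_mono) auto
    finally show ?thesis .
  qed (use d in simp)
qed

text \<open>The comparison is with a digraph on \<open>N\<close> vertices, where pN is close to 1 +
  d/2. Sizes below 1/d^2 are covered by its truncated mean. Beyond, the decay from
  \<open>Pk_decay\<close> turns \<open>f k\<close> into a constant \<open>B\<close>, and the mass
  there is at most 40d.\<close>

lemma moments_Pk_supercritical:
  assumes m: "2 * p * real m = 1 + d" and d: "0 < d" "d \<le> 1 / 8" "100 * p \<le> d ^ 3"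
  shows "(\<Sum>k=1..m. real k * Pk p m k) \<le> exp 30 / d"
    and "(\<Sum>k=1..m. (real k)\<^sup>2 * Pk p m k) \<le> exp 30 / d ^ 3"
proof -
  have "d ^ 3 \<le> d" using d power_decreasing[of 1 3 d] by simp
  then have pd: "100 * p \<le> d" using d by linarith
  obtain N where N: "p * real N \<le> 1 + d / 2 + p" "1 + d / 2 < p * real N"
    using exists_grid_point[OF p, of "1 + d / 2 + p"] p d by auto
  have "p * real m \<le> p * real N" using m N d by linarith
  then have mN: "m \<le> N" using p by simp
  let ?L = "{k\<in>{1..N}. d\<^sup>2 * real k < 1}" and ?U = "{k\<in>{1..N}. 1 \<le> d\<^sup>2 * real k}"
  have Qn: "0 \<le> Qk p N k" if "1 \<le> k" for k using Qk_nonneg[OF p that] .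
  have p3: "p \<le> d ^ 3" using d p by simp
  note super = Qk_supercritical[OF p _ _ d(1,2) p3, of N]
  have U: "(\<Sum>k\<in>?U. Qk p N k) \<le> 40 * d" and L: "(\<Sum>k\<in>?L. real k * Qk p N k) \<le> 2 * exp 15 / d"
    using N pd d by (intro super; linarith)+
  have UL: "{1..N} = ?L \<union> ?U" "?L \<inter> ?U = {}" by auto
  have mono: "(\<Sum>k=1..m. f k * Pk p m k) \<le> exp 6 * (A * (2 * exp 15 / d) + B * (40 * d))"
    if f: "\<And>k. 0 \<le> f k" and A: "\<And>k. k \<in> ?L \<Longrightarrow> f k \<le> A * real k" "0 \<le> A"
      and B: "\<And>k. f k * exp (- (d\<^sup>2 * real k / 16)) \<le> B" "0 \<le> B" for f A B
  proof -
    let ?g = "\<lambda>k. f k * exp (- (d\<^sup>2 * real k / 16)) * Qk p N k"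
    have g: "0 \<le> ?g k" if "1 \<le> k" for k using f Qn[OF that] by simp
    have "(\<Sum>k=1..m. f k * Pk p m k) \<le> (\<Sum>k=1..m. exp 6 * ?g k)"
    proof (rule sum_mono)
      fix k assume "k \<in> {1..m}"
      then have "Pk p m k \<le> exp 6 * exp (- (d\<^sup>2 * real k / 16)) * Qk p N k"
        using m d N by (intro Pk_decay) auto
      from mult_left_mono[OF this f[of k]]
      show "f k * Pk p m k \<le> exp 6 * ?g k" by (simp add: mult_ac)
    qed
    also have "\<dots> \<le> (\<Sum>k=1..N. exp 6 * ?g k)" using mN g by (intro sum_mono2) auto
    also have "\<dots> = exp 6 * ((\<Sum>k\<in>?L. ?g k) + (\<Sum>k\<in>?U. ?g k))"
      unfolding sum_distrib_left[symmetric] by (subst UL(1), subst sum.union_disjoint) auto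
    also have "\<dots> \<le> exp 6 * (A * (2 * exp 15 / d) + B * (40 * d))"
    proof (intro mult_left_mono add_mono)
      have "(\<Sum>k\<in>?L. ?g k) \<le> (\<Sum>k\<in>?L. A * (real k * Qk p N k))"
      proof (rule sum_mono)
        fix k assume k: "k \<in> ?L"
        have "f k * exp (- (d\<^sup>2 * real k / 16)) \<le> f k * 1" using f by (intro mult_left_mono) auto
        also have "\<dots> \<le> A * real k" using A k by simp
        finally have "?g k \<le> A * real k * Qk p N k" using Qn k by (intro mult_right_mono) auto
        then show "?g k \<le> A * (real k * Qk p N k)" by simp
      qed
      also have "\<dots> \<le> A * (2 * exp 15 / d)"
        unfolding sum_distrib_left[symmetric] by (rule mult_left_mono[OF L A(2)])
      finally show "(\<Sum>k\<in>?L. ?g k) \<le> A * (2 * exp 15 / d)" .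
      have "(\<Sum>k\<in>?U. ?g k) \<le> (\<Sum>k\<in>?U. B * Qk p N k)"
        by (intro sum_mono mult_right_mono B Qn) auto
      also have "\<dots> \<le> B * (40 * d)"
        unfolding sum_distrib_left[symmetric] by (rule mult_left_mono[OF U B(2)])
      finally show "(\<Sum>k\<in>?U. ?g k) \<le> B * (40 * d)" .
    qed simp
    finally show ?thesis .
  qed
  have e: "2 * exp 21 + 40960 * exp 6 \<le> exp (30::real)"
  proof -
    have "40960 * exp (6::real) \<le> 2 ^ 16 * exp 6" by simp
    also have "\<dots> \<le> exp 16 * exp 6" using exp_ge_two_power[of 16] by (intro mult_right_mono) auto
    finally have 1: "40960 * exp (6::real) \<le> exp 22" by (simp add: mult_exp_exp)
    have "2 * exp (21::real) \<le> exp 1 * exp 21" using exp_ge_two_power[of 1] by (intro mult_right_mono) auto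
    then have 2: "2 * exp (21::real) \<le> exp 22" by (simp add: mult_exp_exp)
    have "2 * exp (22::real) \<le> exp 1 * exp 22" using exp_ge_two_power[of 1] by (intro mult_right_mono) auto
    then have 3: "2 * exp (22::real) \<le> exp 23" by (simp add: mult_exp_exp)
    have "exp 23 \<le> exp (30::real)" by simp
    then show ?thesis using 1 2 3 by linarith
  qed
  have y: "0 \<le> d\<^sup>2 * real k / 16" for k by simp
  have "(\<Sum>k=1..m. real k * Pk p m k) \<le> exp 6 * (1 * (2 * exp 15 / d) + 16 / d\<^sup>2 * (40 * d))"
  proof (rule mono)
    fix k
    have "real k * exp (- (d\<^sup>2 * real k / 16)) = 16 / d\<^sup>2 * (d\<^sup>2 * real k / 16 * exp (- (d\<^sup>2 * real k / 16)))"
      using d by simp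
    also have "\<dots> \<le> 16 / d\<^sup>2 * 1" by (intro mult_left_mono mult_exp_neg_le y) auto
    finally show "real k * exp (- (d\<^sup>2 * real k / 16)) \<le> 16 / d\<^sup>2" by simp
  qed auto
  also have "\<dots> = (2 * exp 21 + 640 * exp 6) / d"
    using d by (simp add: field_simps power2_eq_square mult_exp_exp)
  also have "\<dots> \<le> exp 30 / d"
  proof -
    have "640 * exp (6::real) \<le> 40960 * exp 6" by simp
    then show ?thesis using e d by (intro divide_right_mono) linarith+
  qed
  finally show "(\<Sum>k=1..m. real k * Pk p m k) \<le> exp 30 / d" .
  \<comment> \<open>Below 1/d^2 one factor \<open>k\<close> is replaced by 1/d^2. The constant 1024
    is 16^2 times the bound 4 for y^2 exp (-y), used at y = d^2 k/16.\<close>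
  have "(\<Sum>k=1..m. (real k)\<^sup>2 * Pk p m k) \<le> exp 6 * (1 / d\<^sup>2 * (2 * exp 15 / d) + 1024 / d ^ 4 * (40 * d))"
  proof (rule mono)
    fix k
    have "(real k)\<^sup>2 * exp (- (d\<^sup>2 * real k / 16)) = 256 / d ^ 4 * ((d\<^sup>2 * real k / 16)\<^sup>2 * exp (- (d\<^sup>2 * real k / 16)))"
      using d by (simp add: power_divide power_mult_distrib flip: power_mult)
    also have "\<dots> \<le> 256 / d ^ 4 * 4" by (intro mult_left_mono square_mult_exp_neg_le y) auto
    finally show "(real k)\<^sup>2 * exp (- (d\<^sup>2 * real k / 16)) \<le> 1024 / d ^ 4" by simp
  next
    fix k assume "k \<in> ?L"
    then have "real k * (d\<^sup>2 * real k) \<le> real k * 1" by (intro mult_left_mono) auto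
    then show "(real k)\<^sup>2 \<le> 1 / d\<^sup>2 * real k" using d by (simp add: field_simps power2_eq_square)
  qed auto
  also have "\<dots> = (2 * exp 21 + 40960 * exp 6) / d ^ 3"
    using d by (simp add: field_simps power2_eq_square eval_nat_numeral mult_exp_exp)
  also have "\<dots> \<le> exp 30 / d ^ 3" using e d by (intro divide_right_mono) auto
  finally show "(\<Sum>k=1..m. (real k)\<^sup>2 * Pk p m k) \<le> exp 30 / d ^ 3" .
qed

section \<open>The contradiction probability as missing mass\<close>

text \<open>The ratio of \<open>Qk\<close> to \<open>Pk\<close> is at most exp E, and 1 - exp (-E)
  is at most E. The first term of E is k^2/(4m) from the factors minus pk^2/2 from the exponents,
  which cancel at the threshold 2pm = 1. The second is the next order of the factors, where 2k at
  most m keeps 2m - 2i above m.\<close>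

lemma Qk_diff_Pk_le:
  assumes k: "1 \<le> k" "2 * k \<le> m"
  shows "Qk p (2 * m) k - Pk p m k
    \<le> ((real k)\<^sup>2 * (1 - 2 * p * real m) / (4 * real m) + (real k) ^ 3 / (real m)\<^sup>2) * Qk p (2 * m) k"
proof -
  define c where "c = (\<lambda>i. real i / (2 * real m) + (real i)\<^sup>2 / (real m)\<^sup>2)"
  let ?e1 = "2 * k * (m - k) + k * (k - 1) div 2" and ?e2 = "k * (2 * m - k)"
  define E where "E = (real k)\<^sup>2 * (1 - 2 * p * real m) / (4 * real m) + (real k) ^ 3 / (real m)\<^sup>2"
  have m0: "0 < real m" using k by simp
  have 1: "(\<Prod>i\<in>{1..<k}. real (2 * m) - real i) \<le> (\<Prod>i\<in>{1..<k}. 2 * real m - 2 * real i) * exp (\<Sum>i\<in>{1..<k}. c i)"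
  proof (rule prod_le_exp_sum)
    fix i assume i: "i \<in> {1..<k}"
    have mi: "real m \<le> 2 * real m - 2 * real i" using i k by auto
    have "real i / (2 * real m - 2 * real i) - real i / (2 * real m)
        = (real i)\<^sup>2 / (real m * (2 * real m - 2 * real i))"
      using mi m0 by (simp add: divide_simps) (simp add: algebra_simps power2_eq_square)
    also have "\<dots> \<le> (real i)\<^sup>2 / (real m * real m)"
      using mi m0 by (intro divide_left_mono mult_left_mono mult_pos_pos) auto
    finally have "1 + real i / (2 * real m - 2 * real i) \<le> 1 + c i"
      by (simp add: c_def power2_eq_square)
    also have "\<dots> \<le> exp (c i)" by (rule exp_ge_add_one_self)
    finally have "(2 * real m - 2 * real i) * (1 + real i / (2 * real m - 2 * real i))
      \<le> (2 * real m - 2 * real i) * exp (c i)" using mi by (intro mult_left_mono) auto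
    moreover have "(2 * real m - 2 * real i) * (1 + real i / (2 * real m - 2 * real i)) = 2 * real m - real i"
      using mi m0 by (simp add: distrib_left)
    ultimately show "0 \<le> real (2 * m) - real i \<and> real (2 * m) - real i \<le> (2 * real m - 2 * real i) * exp (c i)"
      using mi m0 by simp
  qed
  have c: "(\<Sum>i\<in>{1..<k}. c i) \<le> (real k)\<^sup>2 / (4 * real m) + (real k) ^ 3 / (real m)\<^sup>2"
  proof -
    have "(\<Sum>i\<in>{1..<k}. real i) = real k * (real k - 1) / 2" by (rule sum_real_from_1[OF k(1)])
    also have "\<dots> \<le> (real k)\<^sup>2 / 2" by (simp add: power2_eq_square algebra_simps)
    finally have a: "(\<Sum>i\<in>{1..<k}. real i) / (2 * real m) \<le> (real k)\<^sup>2 / 2 / (2 * real m)"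
      by (rule divide_right_mono) simp
    have "(\<Sum>i\<in>{1..<k}. (real i)\<^sup>2) \<le> (\<Sum>i\<in>{1..<k}. (real k)\<^sup>2)" by (intro sum_mono power_mono) auto
    also have "\<dots> \<le> real k * (real k)\<^sup>2" by (simp add: mult_right_mono)
    also have "\<dots> = (real k) ^ 3" by (simp add: power2_eq_square power3_eq_cube)
    finally have b: "(\<Sum>i\<in>{1..<k}. (real i)\<^sup>2) / (real m)\<^sup>2 \<le> (real k) ^ 3 / (real m)\<^sup>2"
      by (rule divide_right_mono) simp
    show ?thesis using a b by (simp add: c_def sum.distrib sum_divide_distrib)
  qed
  have pw: "(1 - p) ^ ?e2 \<le> (1 - p) ^ ?e1 * exp (- p * (real k)\<^sup>2 / 2)"
  proof -
    have e: "real ?e2 - real ?e1 = (real k)\<^sup>2 / 2 + real k / 2"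
      using Pk_exponent[OF p, of k m] k by (simp add: of_nat_diff field_simps power2_eq_square)
    then have "0 \<le> real ?e2 - real ?e1" by simp
    then have le: "?e1 \<le> ?e2" by linarith
    have "(1 - p) ^ ?e2 = (1 - p) ^ ?e1 * (1 - p) ^ (?e2 - ?e1)" using le by (simp flip: power_add)
    also have "\<dots> \<le> (1 - p) ^ ?e1 * exp (- p * real (?e2 - ?e1))"
      using p by (intro mult_left_mono one_minus_power_le[OF p]) auto
    also have "\<dots> \<le> (1 - p) ^ ?e1 * exp (- p * (real k)\<^sup>2 / 2)"
      using p le e by (intro mult_left_mono) (auto simp: of_nat_diff simp del: of_nat_mult of_nat_add)
    finally show ?thesis .
  qed
  have "Qk p (2 * m) k = reach_prob p k / fact (k - 1) * ((\<Prod>i\<in>{1..<k}. real (2 * m) - real i) * (1 - p) ^ ?e2)"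
    unfolding Qk_def using k by (subst real_choose_eq_prod) simp_all
  also have "\<dots> \<le> reach_prob p k / fact (k - 1) * (((\<Prod>i\<in>{1..<k}. 2 * real m - 2 * real i) * exp (\<Sum>i\<in>{1..<k}. c i))
      * ((1 - p) ^ ?e1 * exp (- p * (real k)\<^sup>2 / 2)))"
    by (intro mult_left_mono mult_mono 1 pw divide_nonneg_nonneg reach_prob_nonneg'[OF p] mult_nonneg_nonneg prod_nonneg)
      (use k p in auto)
  also have "\<dots> = Pk p m k * exp ((\<Sum>i\<in>{1..<k}. c i) + - p * (real k)\<^sup>2 / 2)"
  proof -
    have "Pk p m k = (\<Prod>i\<in>{1..<k}. 2 * real m - 2 * real i) / fact (k - 1) * (reach_prob p k * (1 - p) ^ ?e1)"
      using k by (intro Pk_eq_prod[OF p]) auto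
    then show ?thesis by (simp only: exp_add times_divide_eq_left times_divide_eq_right mult_ac)
  qed
  also have "\<dots> \<le> Pk p m k * exp E"
  proof (intro mult_left_mono Pk_nonneg[OF p] k, simp only: exp_le_cancel_iff)
    have "E = (real k)\<^sup>2 / (4 * real m) + (real k) ^ 3 / (real m)\<^sup>2 + - p * (real k)\<^sup>2 / 2"
      unfolding E_def using m0 by (simp add: field_simps)
    then show "(\<Sum>i\<in>{1..<k}. c i) + - p * (real k)\<^sup>2 / 2 \<le> E" using c by linarith
  qed
  finally have QP: "Qk p (2 * m) k \<le> Pk p m k * exp E" .
  have "(1 - E) * Qk p (2 * m) k \<le> exp (- E) * Qk p (2 * m) k"
    using exp_ge_add_one_self[of "- E"] by (intro mult_right_mono Qk_nonneg[OF p] k) simp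
  also have "\<dots> \<le> exp (- E) * (Pk p m k * exp E)" using QP by (rule mult_left_mono) simp
  also have "\<dots> = Pk p m k" by (simp add: exp_minus)
  finally show ?thesis unfolding E_def by (simp add: algebra_simps)
qed

text \<open>The 1 in the definition of \<open>contra_prob\<close> is replaced by the total mass of
  \<open>Qk\<close> on 2m vertices, so that only differences of comparable weights remain to be
  estimated.\<close>

lemma contra_prob_eq_sum:
  assumes "1 \<le> m"
  shows "contra_prob p m = (\<Sum>k=1..2 * m. Qk p (2 * m) k - Pk p m k)"
proof -
  have "(\<Sum>k=1..2 * m. Pk p m k) = (\<Sum>k=1..m. Pk p m k)"
    by (rule sum.mono_neutral_right) (auto simp: Pk_def)
  then show ?thesis using sum_Qk[of "2 * m" p] assms by (simp add: contra_prob_def sum_subtractf)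
qed

text \<open>For sizes below 1/d^2 the first error term of \<open>Qk_diff_Pk_le\<close> is
  nonpositive, and the second is at most d^2 k because 1/m is at most d^3; the truncated mean makes
  this of order d. For larger sizes the tail of \<open>Qk\<close> alone is of order d.\<close>

lemma contra_prob_supercritical:
  assumes m: "2 * p * real m = 1 + d" and d: "0 < d" "d \<le> 1 / 8" "100 * p \<le> d ^ 3"
  shows "contra_prob p m \<le> exp 30 * d"
proof -
  let ?N = "2 * m"
  let ?L = "{k\<in>{1..?N}. d\<^sup>2 * real k < 1}" and ?U = "{k\<in>{1..?N}. 1 \<le> d\<^sup>2 * real k}"
  have m1: "1 \<le> m" using m d by (cases m) auto
  then have m0: "0 < real m" by simp
  have p3: "p \<le> d ^ 3" using d p by simp
  have N: "p * real ?N = 1 + d" using m by simp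
  have U: "(\<Sum>k\<in>?U. Qk p ?N k) \<le> 40 * d" and L: "(\<Sum>k\<in>?L. real k * Qk p ?N k) \<le> 2 * exp 15 / d"
    by (rule Qk_supercritical[OF p _ _ d(1,2) p3]; use N d in linarith)+
  have UL: "{1..?N} = ?L \<union> ?U" "?L \<inter> ?U = {}" by auto
  have im: "1 / real m \<le> d ^ 3"
  proof -
    have "1 / real m \<le> (2 * p * real m) / real m" using m d m0 by (intro divide_right_mono) auto
    then show ?thesis using m0 d p by simp
  qed
  have low: "Qk p ?N k - Pk p m k \<le> d\<^sup>2 * (real k * Qk p ?N k)" if k: "k \<in> ?L" for k
  proof -
    have k1: "1 \<le> k" and kd: "d\<^sup>2 * real k < 1" using k by auto
    have "100 * p * real k \<le> d ^ 3 * real k" using d by (intro mult_right_mono) auto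
    also have "\<dots> = d * (d\<^sup>2 * real k)" by (simp add: power2_eq_square power3_eq_cube)
    also have "\<dots> \<le> d * 1" using kd d by (intro mult_left_mono) auto
    finally have "p * (2 * real k) \<le> p * real m" using m d by simp
    then have km: "2 * k \<le> m" using p by simp
    have "(real k)\<^sup>2 * (1 - 2 * p * real m) / (4 * real m) \<le> 0"
      using m d m0 by (intro divide_nonpos_pos mult_nonneg_nonpos) auto
    moreover have "(real k) ^ 3 / (real m)\<^sup>2 \<le> d\<^sup>2 * real k"
    proof -
      have "(real k) ^ 3 / (real m)\<^sup>2 = real k * ((real k)\<^sup>2 * (1 / real m)\<^sup>2)"
        by (simp add: power2_eq_square power3_eq_cube)
      also have "\<dots> \<le> real k * ((real k)\<^sup>2 * (d ^ 3)\<^sup>2)"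
        using im by (intro mult_left_mono power_mono) auto
      also have "\<dots> = real k * (d\<^sup>2 * (d\<^sup>2 * real k)\<^sup>2)"
        by (simp add: power2_eq_square power3_eq_cube)
      also have "\<dots> \<le> real k * (d\<^sup>2 * 1)"
        using kd by (intro mult_left_mono power_le_one) auto
      finally show ?thesis by (simp add: mult.commute)
    qed
    ultimately have "((real k)\<^sup>2 * (1 - 2 * p * real m) / (4 * real m) + (real k) ^ 3 / (real m)\<^sup>2) * Qk p ?N k
       \<le> (d\<^sup>2 * real k) * Qk p ?N k" using Qk_nonneg[OF p k1] by (intro mult_right_mono) auto
    then show ?thesis using Qk_diff_Pk_le[OF k1 km] by simp
  qed
  have "contra_prob p m = (\<Sum>k\<in>?L. Qk p ?N k - Pk p m k) + (\<Sum>k\<in>?U. Qk p ?N k - Pk p m k)"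
    unfolding contra_prob_eq_sum[OF m1] by (subst UL(1), subst sum.union_disjoint) auto
  also have "\<dots> \<le> (\<Sum>k\<in>?L. d\<^sup>2 * (real k * Qk p ?N k)) + (\<Sum>k\<in>?U. Qk p ?N k)"
    using low Pk_nonneg[OF p] by (intro add_mono sum_mono) auto
  also have "\<dots> \<le> d\<^sup>2 * (2 * exp 15 / d) + 40 * d"
    unfolding sum_distrib_left[symmetric] by (intro add_mono U mult_left_mono L) auto
  also have "\<dots> = (2 * exp 15 + 40) * d" using d by (simp add: power2_eq_square algebra_simps)
  also have "\<dots> \<le> exp 30 * d"
  proof -
    have "2 * exp (15::real) \<le> exp 1 * exp 15" using exp_ge_two_power[of 1] by (intro mult_right_mono) auto
    then have 1: "2 * exp (15::real) \<le> exp 16" by (simp add: mult_exp_exp)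
    have "2 * exp (16::real) \<le> exp 1 * exp 16" using exp_ge_two_power[of 1] by (intro mult_right_mono) auto
    then have 2: "2 * exp (16::real) \<le> exp 17" by (simp add: mult_exp_exp)
    have "exp 17 \<le> exp (30::real)" "64 \<le> exp (6::real)" "exp 6 \<le> exp (16::real)"
      using exp_ge_two_power[of 6] by auto
    then show ?thesis using 1 2 d by (intro mult_right_mono) linarith+
  qed
  finally show ?thesis .
qed

text \<open>Every size is charged 2dk^2/m. Up to k = dm both error terms of
  \<open>Qk_diff_Pk_le\<close> are at most dk^2/m; beyond, the charge exceeds 1 because d^3 m is at
  least 1. The second moment of \<open>Qk\<close> then gives the order 1/(m d^2).\<close>

lemma contra_prob_subcritical:
  assumes m: "2 * p * real m = 1 - d" and d: "0 < d" "d \<le> 1 / 8" "100 * p \<le> d ^ 3"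
  shows "contra_prob p m \<le> exp 30 / (real m * d\<^sup>2)"
proof -
  let ?N = "2 * m"
  have "d ^ 3 \<le> d" using d power_decreasing[of 1 3 d] by simp
  then have pd: "100 * p \<le> d" using d by linarith
  have m1: "1 \<le> m" using m d by (cases m) auto
  then have m0: "0 < real m" by simp
  have im: "1 / real m \<le> d ^ 3"
  proof -
    have "1 / real m \<le> (4 * p * real m) / real m" using m d m0 by (intro divide_right_mono) auto
    then show ?thesis using m0 d p by simp
  qed
  have low: "Qk p ?N k - Pk p m k \<le> 2 * d / real m * ((real k)\<^sup>2 * Qk p ?N k)" if k: "k \<in> {1..?N}" for k
  proof (cases "real k \<le> d * real m")
    case True
    have k1: "1 \<le> k" using k by auto
    have "d * real m \<le> 1 / 8 * real m" using d by (intro mult_right_mono) auto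
    then have km: "2 * k \<le> m" using True by linarith
    have "(real k)\<^sup>2 * (1 - 2 * p * real m) / (4 * real m) \<le> d / real m * (real k)\<^sup>2"
    proof -
      have eq: "1 - 2 * p * real m = d" using m by simp
      define a where "a = d / real m * (real k)\<^sup>2"
      have "(real k)\<^sup>2 * d / (4 * real m) = a / 4" by (simp add: a_def mult_ac)
      moreover have "0 \<le> a" using d by (simp add: a_def)
      ultimately show ?thesis unfolding eq a_def[symmetric] by simp
    qed
    moreover have "(real k) ^ 3 / (real m)\<^sup>2 \<le> d / real m * (real k)\<^sup>2"
    proof -
      have "(real k) ^ 3 / (real m)\<^sup>2 = real k * (real k)\<^sup>2 / (real m)\<^sup>2" by (simp add: power2_eq_square power3_eq_cube)
      also have "\<dots> \<le> (d * real m) * (real k)\<^sup>2 / (real m)\<^sup>2"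
        using True by (intro divide_right_mono mult_right_mono) auto
      also have "\<dots> = d / real m * (real k)\<^sup>2" using m0 by (simp add: power2_eq_square)
      finally show ?thesis .
    qed
    ultimately have "((real k)\<^sup>2 * (1 - 2 * p * real m) / (4 * real m) + (real k) ^ 3 / (real m)\<^sup>2) * Qk p ?N k
       \<le> (d / real m * (real k)\<^sup>2 + d / real m * (real k)\<^sup>2) * Qk p ?N k"
      by (intro mult_right_mono Qk_nonneg[OF p k1] add_mono)
    also have "d / real m * (real k)\<^sup>2 + d / real m * (real k)\<^sup>2 = 2 * d / real m * (real k)\<^sup>2" by simp
    finally have "((real k)\<^sup>2 * (1 - 2 * p * real m) / (4 * real m) + (real k) ^ 3 / (real m)\<^sup>2) * Qk p ?N k
       \<le> 2 * d / real m * (real k)\<^sup>2 * Qk p ?N k" .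
    then show ?thesis using Qk_diff_Pk_le[OF k1 km] by (simp add: mult.assoc)
  next
    case False
    have k1: "1 \<le> k" using k by auto
    have "1 \<le> 2 * d / real m * (real k)\<^sup>2"
    proof -
      have "1 \<le> d ^ 3 * real m" using im m0 by (simp add: field_simps)
      also have "d ^ 3 * real m = d / real m * (d * real m)\<^sup>2" using m0 by (simp add: power2_eq_square power3_eq_cube)
      also have "\<dots> \<le> d / real m * (real k)\<^sup>2"
        using False d m0 by (intro mult_left_mono power_mono) auto
      also have "\<dots> \<le> 2 * d / real m * (real k)\<^sup>2" using d m0 by (intro mult_right_mono divide_right_mono) auto
      finally show ?thesis .
    qed
    from mult_right_mono[OF this Qk_nonneg[OF p k1, of ?N]]
    show ?thesis using Pk_nonneg[OF p k1, of m] by (simp add: mult.assoc)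
  qed
  have "contra_prob p m \<le> (\<Sum>k=1..?N. 2 * d / real m * ((real k)\<^sup>2 * Qk p ?N k))"
    unfolding contra_prob_eq_sum[OF m1] by (rule sum_mono) (rule low)
  also have "\<dots> \<le> 2 * d / real m * (128 * exp 2 / d ^ 3)"
    unfolding sum_distrib_left[symmetric]
    using m m1 d pd by (intro mult_left_mono square_mean_Qk_le[OF p]) auto
  also have "\<dots> = 256 * exp 2 / (real m * d\<^sup>2)"
    using d by (simp add: power2_eq_square power3_eq_cube)
  also have "\<dots> \<le> exp 30 / (real m * d\<^sup>2)"
  proof -
    have "256 * exp (2::real) \<le> exp 8 * exp 2" using exp_ge_two_power[of 8] by (intro mult_right_mono) auto
    also have "\<dots> \<le> exp 30" by (simp add: mult_exp_exp)
    finally show ?thesis using d m0 by (intro divide_right_mono) auto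
  qed
  finally show ?thesis .
qed

end

section \<open>Two contradictory literals\<close>

lemma contra_prob_mono:
  assumes p: "0 \<le> p" "p \<le> 1" and "m \<le> n"
  shows "contra_prob p m \<le> contra_prob p n"
  using assms(3)
proof (induction n rule: dec_induct)
  case (step k)
  have "contra_prob p k \<le> contra_prob p (Suc k)"
  proof (cases "k = 0")
    case True
    then show ?thesis using contra_prob_nonneg[OF p, of "Suc k"] by (simp add: contra_prob_def[of p 0])
  next
    case False
    then show ?thesis using contra_prob_Suc_diff(1)[OF p, of k] by simp
  qed
  then show ?case using step by simp
qed simp

lemma contra_prob_diff_le:
  assumes "k \<le> n" "\<And>m. n - k \<le> m \<Longrightarrow> m < n \<Longrightarrow> contra_prob p (Suc m) - contra_prob p m \<le> D"
  shows "contra_prob p n - contra_prob p (n - k) \<le> real k * D"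
  using assms
proof (induction k)
  case (Suc k)
  have "contra_prob p n - contra_prob p (n - k) \<le> real k * D" using Suc by simp
  moreover have "contra_prob p (Suc (n - Suc k)) - contra_prob p (n - Suc k) \<le> D" using Suc.prems by simp
  moreover have "Suc (n - Suc k) = n - k" using Suc.prems(1) by simp
  ultimately show ?case by (simp add: algebra_simps)
qed simp

lemma contra_prob_Suc_diff_le_moments:
  assumes p: "0 \<le> p" "p \<le> 1" and "1 \<le> m" and U: "\<And>k. k \<le> m \<Longrightarrow> contra_prob p k \<le> U" "0 \<le> U"
    and M1: "(\<Sum>k=1..m. real k * Pk p m k) \<le> M1" and M2: "(\<Sum>k=1..m. (real k)\<^sup>2 * Pk p m k) \<le> M2"
    and Pk: "\<And>k. 1 \<le> k \<Longrightarrow> 0 \<le> Pk p m k"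
  shows "contra_prob p (Suc m) - contra_prob p m \<le> p\<^sup>2 * M2 + 2 * p * U * M1"
proof -
  have "contra_prob p (Suc m) - contra_prob p m \<le> (\<Sum>k=1..m. Pk p m k * ((real k * p)\<^sup>2 + 2 * real k * p * contra_prob p (Suc m - k)))"
    by (rule contra_prob_Suc_diff(2)[OF p assms(3)])
  also have "\<dots> \<le> (\<Sum>k=1..m. Pk p m k * ((real k * p)\<^sup>2 + 2 * real k * p * U))"
    using p Pk U(1) by (intro sum_mono mult_left_mono add_mono) auto
  also have "\<dots> = p\<^sup>2 * (\<Sum>k=1..m. (real k)\<^sup>2 * Pk p m k) + 2 * p * U * (\<Sum>k=1..m. real k * Pk p m k)"
    unfolding sum_distrib_left sum.distrib[symmetric]
    by (rule sum.cong) (simp_all add: algebra_simps power_mult_distrib)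
  also have "\<dots> \<le> p\<^sup>2 * M2 + 2 * p * U * M1"
    using p U M1 M2 by (intro add_mono mult_left_mono) auto
  finally show ?thesis .
qed

text \<open>The weights \<open>Pk\<close> sum to \<open>1 - contra_prob p n\<close>, so the square
  splits off and leaves an average over \<open>k\<close>. In it the factor (n-k)/(n-1) costs at most
  (k/n) U and the lost variables at most kD. The alternative with \<open>E\<close> serves sizes for
  which the increments are not controlled down to n - k; it is paid by the second moment.\<close>

lemma Pr_two_contradictions_le_square:
  assumes p: "0 < p" "p \<le> 1 / 2" and "finite V" "x \<in> lits V" "y \<in> lits V" "var x \<noteq> var y" "card V = n"
    and D: "0 \<le> D" "0 \<le> E" "0 \<le> U" "contra_prob p n \<le> U"
    and diff: "\<And>k. 1 \<le> k \<Longrightarrow> k < n \<Longrightarrow> contra_prob p n \<le> contra_prob p (n - k) + real k * D \<or> contra_prob p n \<le> (real k)\<^sup>2 * E"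
    and M1: "(\<Sum>k=1..n. real k * Pk p n k) \<le> M1" and M2: "(\<Sum>k=1..n. (real k)\<^sup>2 * Pk p n k) \<le> M2"
  shows "Pr p (clauses_on V) (\<lambda>F. leads_to F x (neg x) \<and> leads_to F y (neg y))
    \<le> (contra_prob p n)\<^sup>2 + ((D + U / real n) * M1 + E * M2)"
proof -
  have p01: "0 \<le> p" "p \<le> 1" using p by auto
  have "card {var x, var y} \<le> card V" using assms by (intro card_mono) (auto simp: lits_def)
  then have n2: "2 \<le> n" using assms by simp
  let ?c = "\<lambda>k. real (n - k) / real (n - 1)"
  have bnd: "contra_prob p n - ?c k * contra_prob p (n - k) \<le> real k * (D + U / real n) + (real k)\<^sup>2 * E" if k: "k \<in> {1..n}" for k
  proof -
    define c where "c = ?c k"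
    have un: "0 \<le> contra_prob p n" "0 \<le> contra_prob p (n - k)" using contra_prob_nonneg[OF p01] by auto
    have c: "0 \<le> c" "c \<le> 1" using k n2 by (auto simp: c_def of_nat_diff)
    have c': "1 - c \<le> real k / real n"
    proof -
      have "1 - c = (real k - 1) / (real n - 1)" using k n2 by (simp add: c_def of_nat_diff field_simps)
      also have "\<dots> \<le> real k / real n" using k n2 by (simp add: field_simps of_nat_diff)
      finally show ?thesis .
    qed
    have kU: "(1 - c) * contra_prob p n \<le> real k * (U / real n)"
    proof -
      have "(1 - c) * contra_prob p n \<le> (real k / real n) * U" using c c' un D by (intro mult_mono) auto
      then show ?thesis by simp
    qed
    have "contra_prob p n - c * contra_prob p (n - k) \<le> real k * (D + U / real n) + (real k)\<^sup>2 * E"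
    proof (cases "k = n")
      case True
      have "0 \<le> real k * D + (real k)\<^sup>2 * E" using D by simp
      moreover have "contra_prob p n \<le> real k * (U / real n)" using kU True by (simp add: c_def)
      ultimately show ?thesis using True by (simp add: c_def algebra_simps)
    next
      case False
      then consider "contra_prob p n \<le> contra_prob p (n - k) + real k * D" | "contra_prob p n \<le> (real k)\<^sup>2 * E"
        using diff[of k] k by auto
      then show ?thesis
      proof cases
        case 1
        have "c * (contra_prob p n - contra_prob p (n - k)) \<le> 1 * (real k * D)"
        proof (rule mult_mono)
          show "0 \<le> contra_prob p n - contra_prob p (n - k)" using contra_prob_mono[OF p01, of "n - k" n] by simp
        qed (use 1 c in auto)
        moreover have "contra_prob p n - c * contra_prob p (n - k) = c * (contra_prob p n - contra_prob p (n - k)) + (1 - c) * contra_prob p n"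
          by (simp add: algebra_simps)
        moreover have "0 \<le> (real k)\<^sup>2 * E" using D by simp
        ultimately show ?thesis using kU by (simp add: distrib_left)
      next
        case 2
        have "0 \<le> real k * (D + U / real n)" using D by simp
        moreover have "0 \<le> c * contra_prob p (n - k)" using c un by simp
        ultimately show ?thesis using 2 by linarith
      qed
    qed
    then show ?thesis unfolding c_def .
  qed
  have un: "contra_prob p n = 1 - (\<Sum>k=1..n. Pk p n k)" using n2 by (simp add: contra_prob_def)
  have "Pr p (clauses_on V) (\<lambda>F. leads_to F x (neg x) \<and> leads_to F y (neg y))
    \<le> contra_prob p n - (\<Sum>k=1..n. Pk p n k * ?c k * contra_prob p (n - k))"
    by (rule Pr_two_contradictions_le) (use assms p01 in auto)
  also have "\<dots> = (contra_prob p n)\<^sup>2 + (\<Sum>k=1..n. Pk p n k * (contra_prob p n - ?c k * contra_prob p (n - k)))"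
  proof -
    have "(\<Sum>k=1..n. Pk p n k * (contra_prob p n - ?c k * contra_prob p (n - k)))
      = (\<Sum>k=1..n. Pk p n k) * contra_prob p n - (\<Sum>k=1..n. Pk p n k * ?c k * contra_prob p (n - k))"
      by (simp only: sum_subtractf sum_distrib_right right_diff_distrib mult.assoc)
    also have "(\<Sum>k=1..n. Pk p n k) = 1 - contra_prob p n" using un by simp
    finally show ?thesis by (simp add: algebra_simps power2_eq_square)
  qed
  also have "(\<Sum>k=1..n. Pk p n k * (contra_prob p n - ?c k * contra_prob p (n - k)))
     \<le> (\<Sum>k=1..n. Pk p n k * (real k * (D + U / real n) + (real k)\<^sup>2 * E))"
    using bnd Pk_nonneg[OF p] by (intro sum_mono mult_left_mono) auto
  also have "\<dots> = (D + U / real n) * (\<Sum>k=1..n. real k * Pk p n k) + E * (\<Sum>k=1..n. (real k)\<^sup>2 * Pk p n k)"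
    unfolding sum_distrib_left sum.distrib[symmetric] by (rule sum.cong) (simp_all add: algebra_simps)
  also have "\<dots> \<le> (D + U / real n) * M1 + E * M2"
    using D M1 M2 by (intro add_mono mult_left_mono) auto
  finally show ?thesis by simp
qed

text \<open>Fewer variables at the same \<open>p\<close> are further below the threshold, so one
  increment bound \<open>D\<close> holds for all \<open>m < n\<close>, and \<open>E\<close> is taken
  as 0. The square of the single probability is itself within the order 1/(n^2 d^4).\<close>

lemma Pr_two_contradictions_subcritical:
  assumes p: "0 < p" and n: "2 * p * real n = 1 - d" and d: "0 < d" "d \<le> 1 / 8" "800 * p \<le> d ^ 3"
    and xy: "x \<in> lits {1..n}" "y \<in> lits {1..n}" "var x \<noteq> var y"
  shows "Pr p (clauses_on {1..n}) (\<lambda>F. leads_to F x (neg x) \<and> leads_to F y (neg y))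
    \<le> 5 * exp 90 / ((real n)\<^sup>2 * d ^ 4)"
proof -
  define K where "K = exp (30::real)"
  have K1: "1 \<le> K" by (simp add: K_def)
  have "d ^ 3 \<le> 1" using d by (intro power_le_one) auto
  then have p2: "p \<le> 1 / 2" using d by linarith
  have d3: "100 * p \<le> d ^ 3" using d p by linarith
  have n0: "0 < real n" using n d by (cases n) auto
  have pn: "p \<le> 1 / real n" using n d n0 by (simp add: field_simps)
  define U where "U = K / (real n * d\<^sup>2)"
  have U0: "0 \<le> U" using K1 by (simp add: U_def)
  have un: "contra_prob p n \<le> U" unfolding U_def K_def by (rule contra_prob_subcritical[OF p p2 n d(1,2) d3])
  define D where "D = 3 * K\<^sup>2 / ((real n)\<^sup>2 * d ^ 3)"
  have D0: "0 \<le> D" using d by (simp add: D_def)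
  have KK: "K \<le> K\<^sup>2" using K1 by (simp add: power2_eq_square)
  have step: "contra_prob p (Suc m) - contra_prob p m \<le> D" if m: "1 \<le> m" "m < n" for m
  proof -
    have m': "2 * p * real m \<le> 1 - d"
    proof -
      have "2 * p * real m \<le> 2 * p * real n" using m p by (intro mult_left_mono) auto
      then show ?thesis using n by simp
    qed
    have "contra_prob p (Suc m) - contra_prob p m \<le> p\<^sup>2 * (K / d ^ 3) + 2 * p * U * (K / d)"
    proof (rule contra_prob_Suc_diff_le_moments)
      fix k assume "k \<le> m"
      then show "contra_prob p k \<le> U" using contra_prob_mono[of p k n] un m p p2 by auto
    qed (use p p2 m U0 moments_Pk_subcritical[OF p p2 m' d(1,2) d3] Pk_nonneg[OF p p2] in \<open>auto simp: K_def\<close>)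
    also have "\<dots> \<le> (1 / real n)\<^sup>2 * (K / d ^ 3) + 2 * (1 / real n) * U * (K / d)"
      using p pn d K1 U0 by (intro add_mono mult_right_mono mult_left_mono power_mono) auto
    also have "\<dots> = (K + 2 * K\<^sup>2) / ((real n)\<^sup>2 * d ^ 3)"
      using d n0 by (simp add: U_def field_simps eval_nat_numeral)
    also have "\<dots> \<le> D" unfolding D_def using KK d by (intro divide_right_mono) auto
    finally show ?thesis .
  qed
  have "Pr p (clauses_on {1..n}) (\<lambda>F. leads_to F x (neg x) \<and> leads_to F y (neg y))
    \<le> (contra_prob p n)\<^sup>2 + ((D + U / real n) * (K / d) + 0 * (K / d ^ 3))"
  proof (rule Pr_two_contradictions_le_square[OF p p2 _ xy])
    fix k assume k: "1 \<le> k" "k < n"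
    have "contra_prob p n - contra_prob p (n - k) \<le> real k * D" by (rule contra_prob_diff_le) (use k step in auto)
    then show "contra_prob p n \<le> contra_prob p (n - k) + real k * D \<or> contra_prob p n \<le> (real k)\<^sup>2 * 0" by simp
  qed (use D0 U0 un moments_Pk_subcritical[OF p p2 _ d(1,2) d3, of n] n in \<open>auto simp: K_def\<close>)
  also have "\<dots> \<le> U\<^sup>2 + (D + U / real n) * (K / d)"
    using un contra_prob_nonneg[of p n] p p2 by (simp add: power_mono)
  also have "\<dots> = (K\<^sup>2 + 3 * K ^ 3 + K\<^sup>2 * d) / ((real n)\<^sup>2 * d ^ 4)"
    using d n0 by (simp add: U_def D_def field_simps eval_nat_numeral)
  also have "\<dots> \<le> (5 * K ^ 3) / ((real n)\<^sup>2 * d ^ 4)"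
  proof (intro divide_right_mono)
    have "K\<^sup>2 * 1 \<le> K\<^sup>2 * K" using K1 by (intro mult_left_mono) auto
    then have "K\<^sup>2 \<le> K ^ 3" by (simp add: eval_nat_numeral)
    moreover have "K\<^sup>2 * d \<le> K\<^sup>2 * 1" using d by (intro mult_left_mono) auto
    ultimately show "K\<^sup>2 + 3 * K ^ 3 + K\<^sup>2 * d \<le> 5 * K ^ 3" using K1 by linarith
  qed auto
  finally show ?thesis by (simp add: K_def exp_of_nat_mult[symmetric])
qed

text \<open>Removing variables brings the formula closer to the threshold, so the increment bound
  \<open>D\<close> is shown only for m at least n(1 - e/4). Clusters larger than en/4 are charged to
  \<open>E\<close>, whose contribution of order 1/(n^2 e^4) is within 1/(ne) because e^3 n is at
  least 1.\<close>

lemma Pr_two_contradictions_supercritical: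
  assumes p: "0 < p" and n: "2 * p * real n = 1 + e" and e: "0 < e" "e \<le> 1 / 8" "800 * p \<le> e ^ 3"
    and xy: "x \<in> lits {1..n}" "y \<in> lits {1..n}" "var x \<noteq> var y"
  shows "Pr p (clauses_on {1..n}) (\<lambda>F. leads_to F x (neg x) \<and> leads_to F y (neg y))
    \<le> (contra_prob p n)\<^sup>2 + 22 * exp 90 / (real n * e)"
proof -
  define K where "K = exp (30::real)"
  have K1: "1 \<le> K" by (simp add: K_def)
  have "e ^ 3 \<le> 1" using e by (intro power_le_one) auto
  then have p2: "p \<le> 1 / 2" using e by linarith
  have e3: "100 * p \<le> e ^ 3" using e p by linarith
  have n0: "0 < real n" using n e by (cases n) auto
  have pn: "p \<le> 1 / real n" using n e n0 by (simp add: field_simps)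
  have ne: "1 \<le> e ^ 3 * real n"
  proof -
    have "1 \<le> 2 * p * real n" using n e by simp
    also have "\<dots> \<le> e ^ 3 * real n" using e p by (intro mult_right_mono) auto
    finally show ?thesis .
  qed
  define U where "U = K * e"
  have U0: "0 \<le> U" using K1 e by (simp add: U_def)
  have un: "contra_prob p n \<le> U" unfolding U_def K_def by (rule contra_prob_supercritical[OF p p2 n e(1,2) e3])
  define D where "D = 5 * K\<^sup>2 / real n"
  have D0: "0 \<le> D" by (simp add: D_def)
  have KK: "K \<le> K\<^sup>2" using K1 by (simp add: power2_eq_square)
  have step: "contra_prob p (Suc m) - contra_prob p m \<le> D" if m: "real n * (1 - e / 4) \<le> real m" "m < n" for m
  proof -
    define d where "d = 2 * p * real m - 1"
    have "2 * p * real m \<le> 2 * p * real n" using m p by (intro mult_left_mono) auto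
    then have de: "d \<le> e" using n by (simp add: d_def)
    have ed: "e / 2 \<le> d"
    proof -
      have "e * e \<le> 1 * e" using e by (intro mult_right_mono) auto
      moreover have "(1 + e) * (1 - e / 4) = 1 + 3 * e / 4 - e * e / 4" by (simp add: field_simps)
      ultimately have "1 + e / 2 \<le> (1 + e) * (1 - e / 4)" by linarith
      also have "\<dots> = 2 * p * (real n * (1 - e / 4))" unfolding n[symmetric] by simp
      also have "\<dots> \<le> 2 * p * real m" using m p by (intro mult_left_mono) auto
      finally show ?thesis by (simp add: d_def)
    qed
    have d: "0 < d" "d \<le> 1 / 8" using ed de e by auto
    \<comment> \<open>Halving the distance to the threshold costs a factor 8, hence 800 in the
      hypothesis where the moment bounds ask for 100.\<close>
    have "(e / 2) ^ 3 \<le> d ^ 3" using ed e by (intro power_mono) auto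
    then have d3: "100 * p \<le> d ^ 3" using e by (simp add: power_divide)
    have m': "2 * p * real m = 1 + d" by (simp add: d_def)
    have m1: "1 \<le> m" using m' d by (cases m) auto
    have "contra_prob p (Suc m) - contra_prob p m \<le> p\<^sup>2 * (K / d ^ 3) + 2 * p * U * (K / d)"
    proof (rule contra_prob_Suc_diff_le_moments)
      fix k assume "k \<le> m"
      then show "contra_prob p k \<le> U" using contra_prob_mono[of p k n] un m p p2 by auto
    qed (use p p2 m1 U0 moments_Pk_supercritical[OF p p2 m' d d3] Pk_nonneg[OF p p2] in \<open>auto simp: K_def\<close>)
    also have "\<dots> \<le> p\<^sup>2 * (K / (e / 2) ^ 3) + 2 * p * U * (K / (e / 2))"
      using p e ed d K1 U0 by (intro add_mono mult_left_mono divide_left_mono power_mono mult_pos_pos) auto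
    also have "\<dots> = p * (8 * K * (p / e ^ 3)) + 4 * K\<^sup>2 * p"
      using e by (simp add: U_def field_simps eval_nat_numeral)
    also have "\<dots> \<le> p * (8 * K * (1 / 8)) + 4 * K\<^sup>2 * p"
      using e p K1 by (intro add_mono mult_left_mono) (auto simp: field_simps)
    also have "\<dots> \<le> 5 * K\<^sup>2 * p" using mult_right_mono[OF KK, of p] p by (simp add: mult.commute)
    also have "\<dots> \<le> 5 * K\<^sup>2 * (1 / real n)" using pn by (intro mult_left_mono) auto
    finally show ?thesis by (simp add: D_def)
  qed
  define E where "E = 16 * U / (e\<^sup>2 * (real n)\<^sup>2)"
  have E0: "0 \<le> E" using U0 by (simp add: E_def)
  have "Pr p (clauses_on {1..n}) (\<lambda>F. leads_to F x (neg x) \<and> leads_to F y (neg y))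
    \<le> (contra_prob p n)\<^sup>2 + ((D + U / real n) * (K / e) + E * (K / e ^ 3))"
  proof (rule Pr_two_contradictions_le_square[OF p p2 _ xy])
    fix k assume k: "1 \<le> k" "k < n"
    show "contra_prob p n \<le> contra_prob p (n - k) + real k * D \<or> contra_prob p n \<le> (real k)\<^sup>2 * E"
    proof (cases "real k \<le> e * real n / 4")
      case True
      have "contra_prob p n - contra_prob p (n - k) \<le> real k * D"
      proof (rule contra_prob_diff_le)
        fix m assume m: "n - k \<le> m" "m < n"
        then have "real n - real k \<le> real m" using k by linarith
        then show "contra_prob p (Suc m) - contra_prob p m \<le> D" using m True by (intro step) (auto simp: algebra_simps)
      qed (use k in simp)
      then show ?thesis by simp
    next
      case False
      then have "e * real n \<le> 4 * real k" by simp
      then have "(e * real n)\<^sup>2 \<le> (4 * real k)\<^sup>2" using e by (intro power_mono) auto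
      then have "1 \<le> 16 * (real k)\<^sup>2 / (e\<^sup>2 * (real n)\<^sup>2)" using e n0 by (simp add: power_mult_distrib)
      from mult_right_mono[OF this U0] have "U \<le> (real k)\<^sup>2 * E" by (simp add: E_def mult_ac)
      then show ?thesis using un by simp
    qed
  qed (use D0 E0 U0 un moments_Pk_supercritical[OF p p2 n e(1,2) e3] in \<open>auto simp: K_def\<close>)
  also have "(D + U / real n) * (K / e) + E * (K / e ^ 3)
    = (5 * K ^ 3 + K\<^sup>2 * e + 16 * K\<^sup>2 * (1 / (e ^ 3 * real n))) / (real n * e)"
    using e n0 by (simp add: U_def D_def E_def field_simps eval_nat_numeral)
  \<comment> \<open>Here 22 = 5 + 1 + 16, one summand for each of the increments, the factor
    (n-k)/(n-1) and the large clusters.\<close>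
  also have "\<dots> \<le> (22 * K ^ 3) / (real n * e)"
  proof (intro divide_right_mono)
    have "K\<^sup>2 * 1 \<le> K\<^sup>2 * K" using K1 by (intro mult_left_mono) auto
    then have "K\<^sup>2 \<le> K ^ 3" by (simp add: eval_nat_numeral)
    moreover have "K\<^sup>2 * e \<le> K\<^sup>2 * 1" using e by (intro mult_left_mono) auto
    moreover have "16 * K\<^sup>2 * (1 / (e ^ 3 * real n)) \<le> 16 * K\<^sup>2 * 1"
      using ne by (intro mult_left_mono) (auto simp: divide_le_eq)
    ultimately show "5 * K ^ 3 + K\<^sup>2 * e + 16 * K\<^sup>2 * (1 / (e ^ 3 * real n)) \<le> 22 * K ^ 3" by linarith
  qed (use e in auto)
  finally show ?thesis by (simp add: K_def exp_of_nat_mult[symmetric])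
qed

section \<open>Scaling by the cube root of n, and the choice of constants\<close>

theorem theorem3p2:
  "\<exists>(lambda0 :: real) (eps0 :: real) (C1 :: real) (C2 :: real).
     0 < lambda0 \<and> 0 < eps0 \<and> eps0 < 1 \<and>
     (\<forall>(n :: nat) (lambda :: real) (eps :: real) (p :: real) (x :: literal) (y :: literal).
        eps = lambda * real n powr (-1/3) \<longrightarrow>
        p = 1 / (2 * real n) * (1 + eps) \<longrightarrow>
        lambda0 \<le> \<bar>lambda\<bar> \<longrightarrow> \<bar>lambda\<bar> \<le> eps0 * real n powr (1/3) \<longrightarrow>
        x \<in> literals n \<longrightarrow> y \<in> literals n \<longrightarrow> strictly_distinct x y \<longrightarrow>
        (let Px = measure_pmf.prob (random_formula n p) {F. leads_to F x (neg x)};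
             Py = measure_pmf.prob (random_formula n p) {F. leads_to F y (neg y)};
             Pxy = measure_pmf.prob (random_formula n p)
                     {F. leads_to F x (neg x) \<and> leads_to F y (neg y)}
         in (eps < 0 \<longrightarrow>
               Px * Py \<le> Pxy \<and> Pxy \<le> C1 * \<bar>real n powr (-2/3) / lambda ^ 4\<bar>) \<and>
            (eps > 0 \<longrightarrow>
               0 \<le> Pxy - Px * Py \<and> Pxy - Px * Py \<le> C2 * \<bar>real n powr (-2/3) / lambda\<bar>)))"
proof -
  let ?goal = "\<lambda>n lambda eps p x y.
        let Px = measure_pmf.prob (random_formula n p) {F. leads_to F x (neg x)};
             Py = measure_pmf.prob (random_formula n p) {F. leads_to F y (neg y)};
             Pxy = measure_pmf.prob (random_formula n p)
                     {F. leads_to F x (neg x) \<and> leads_to F y (neg y)}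
         in (eps < 0 \<longrightarrow>
               Px * Py \<le> Pxy \<and> Pxy \<le> (5 * exp 90) * \<bar>real n powr (-2/3) / lambda ^ 4\<bar>) \<and>
            (eps > 0 \<longrightarrow>
               0 \<le> Pxy - Px * Py \<and> Pxy - Px * Py \<le> (22 * exp 90) * \<bar>real n powr (-2/3) / lambda\<bar>)"
  have main: "?goal n lambda eps p x y"
    if eps: "eps = lambda * real n powr (-1/3)" and pdef: "p = 1 / (2 * real n) * (1 + eps)"
      and l: "10 \<le> \<bar>lambda\<bar>" "\<bar>lambda\<bar> \<le> 1 / 8 * real n powr (1/3)"
      and xy: "x \<in> literals n" "y \<in> literals n" "strictly_distinct x y"
    for n lambda eps p x y
  proof -
    have n0: "0 < real n" using xy(1) by (cases n) (auto simp: literals_def)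
    define r where "r = real n powr (1/3)"
    have r0: "0 < r" using n0 by (simp add: r_def)
    have r3: "r ^ 3 = real n" using n0 by (simp add: r_def powr_realpow[symmetric] powr_powr)
    have pow1: "real n powr (-1/3) = 1 / r" by (simp add: r_def powr_minus_divide)
    have pow2: "real n powr (-2/3) = 1 / r\<^sup>2"
    proof -
      have "r\<^sup>2 = real n powr (2/3)" using n0 by (simp add: r_def powr_realpow[symmetric] powr_powr)
      then show ?thesis by (simp add: powr_minus_divide)
    qed
    have lam: "lambda = eps * r" using r0 unfolding eps pow1 by simp
    have e: "\<bar>eps\<bar> \<le> 1 / 8" using l(2) r0 unfolding lam r_def[symmetric] by (simp add: abs_mult)
    \<comment> \<open>The value 10 for the lower bound on |lambda| gives |eps|^3 n at least 1000,
      whereas 800pn = 400(1 + eps) is at most 450.\<close>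
    have "10 ^ 3 \<le> \<bar>lambda\<bar> ^ 3" by (rule power_mono) (use l in auto)
    also have "\<dots> = \<bar>eps\<bar> ^ 3 * real n" using r0 by (simp add: lam abs_mult power_mult_distrib r3)
    finally have en: "1000 \<le> \<bar>eps\<bar> ^ 3 * real n" by simp
    have pn: "2 * p * real n = 1 + eps" using n0 by (simp add: pdef)
    have p0: "0 < p" using e n0 unfolding pdef by (intro mult_pos_pos) auto
    have "800 * p * real n \<le> \<bar>eps\<bar> ^ 3 * real n" using pn e en by linarith
    then have p800: "800 * p \<le> \<bar>eps\<bar> ^ 3" using n0 by simp
    have "\<bar>eps\<bar> ^ 3 \<le> 1" using e by (intro power_le_one) auto
    then have p1: "p \<le> 1" using p800 by linarith
    have p01: "0 \<le> p" "p \<le> 1" using p0 p1 by auto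
    let ?V = "{1..n}"
    have lit: "literals n = lits ?V" by (simp add: literals_def lits_altdef)
    have xyV: "x \<in> lits ?V" "y \<in> lits ?V" "var x \<noteq> var y"
      using xy by (auto simp: lit strictly_distinct_iff_var)
    have prob: "measure_pmf.prob (random_formula n p) {F. A F} = Pr p (clauses_on ?V) A" for A
      unfolding random_formula_def clauses_eq_clauses_on by (rule prob_random_subset[OF p01]) (simp add: finite_clauses_on)
    let ?A = "\<lambda>z F. leads_to F z (neg z)"
    have ux: "Pr p (clauses_on ?V) (?A x) = contra_prob p n" "Pr p (clauses_on ?V) (?A y) = contra_prob p n"
      using Pr_contradiction[of ?V _ p] xyV by auto
    have harris: "Pr p (clauses_on ?V) (?A x) * Pr p (clauses_on ?V) (?A y) \<le> Pr p (clauses_on ?V) (\<lambda>F. ?A x F \<and> ?A y F)"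
      by (rule Harris_Pr[OF p01]) (auto simp: finite_clauses_on intro: leads_to_mono)
    have sub: "Pr p (clauses_on ?V) (\<lambda>F. ?A x F \<and> ?A y F) \<le> 5 * exp 90 * \<bar>real n powr (-2/3) / lambda ^ 4\<bar>" if "eps < 0"
    proof -
      have "Pr p (clauses_on ?V) (\<lambda>F. ?A x F \<and> ?A y F) \<le> 5 * exp 90 / ((real n)\<^sup>2 * (- eps) ^ 4)"
        by (rule Pr_two_contradictions_subcritical[OF p0 _ _ _ _ xyV]) (use that pn e p800 in auto)
      \<comment> \<open>By n = r^3 and lambda = eps r, four of the six powers of r combine with
        eps^4.\<close>
      also have "(real n)\<^sup>2 * (- eps) ^ 4 = r\<^sup>2 * lambda ^ 4"
        unfolding lam r3[symmetric] by (simp add: eval_nat_numeral)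
      finally show ?thesis unfolding pow2 by simp
    qed
    have super: "Pr p (clauses_on ?V) (\<lambda>F. ?A x F \<and> ?A y F) - contra_prob p n * contra_prob p n \<le> 22 * exp 90 * \<bar>real n powr (-2/3) / lambda\<bar>" if "0 < eps"
    proof -
      have "Pr p (clauses_on ?V) (\<lambda>F. ?A x F \<and> ?A y F) \<le> (contra_prob p n)\<^sup>2 + 22 * exp 90 / (real n * eps)"
        by (rule Pr_two_contradictions_supercritical[OF p0 pn _ _ _ xyV]) (use that e p800 in auto)
      moreover have "real n * eps = r\<^sup>2 * lambda" unfolding lam r3[symmetric] by (simp add: eval_nat_numeral)
      moreover have "0 < lambda" using that r0 by (simp add: lam)
      ultimately show ?thesis unfolding pow2 by (simp add: power2_eq_square)
    qed
    show ?thesis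
      unfolding Let_def prob ux using harris[unfolded ux] sub super by auto
  qed
  show ?thesis
    by (rule exI[of _ 10], rule exI[of _ "1 / 8"], rule exI[of _ "5 * exp 90"], rule exI[of _ "22 * exp 90"])
      (use main in auto)
qed

end
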